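(* For $\alpha \in \mathbb{T}$, let $H^{\alpha}$ be the operator acting on finitely supported functions $f$ on $\mathbb{Z}$ by $$H^{\alpha} f(n) = \sum_{m \in \mathbb{Z},\, m \neq 0} \frac{e^{2\pi i \alpha m^2} f(n-m)}{m}, \qquad n \in \mathbb{Z}.$$ There exists $r$ with $1 < r < 2$ such that for every weight $w$ on $\mathbb{Z}$ satisfying $w \in A_2\cap RH_r$ and $w^{-1} \in A_2 \cap RH_r$, there is a finite constant $C=C(w)$, independent of $\alpha$, such that $$\| H^{\alpha} : \ell^2(w) \to \ell^2(w) \| \leq C \qquad \text{for all } \alpha \in \mathbb{T}.$$
   Context: $\mathbb{T}=\mathbb{R}/\mathbb{Z}$. A weight is a function $w:\mathbb{Z}\to(0,\infty)$, and $\|f\|_{\ell^2(w)}^2=\sum_{n\in\mathbb{Z}}|f(n)|^2w(n)$. The norm $\|H^\alpha:\ell^2(w)\to\ell^2(w)\|$ is the least constant $C$ such that $\|H^\alpha f\|_{\ell^2(w)}\le C\|f\|_{\ell^2(w)}$ for all finitely supported $f$ on $\mathbb{Z}$. An interval is a nonempty finite set $I=\mathbb{Z}\cap[a,b]$ with $a,b\in\mathbb{R}$, and $|I|$ is its cardinality. $A_2$ is the Muckenhoupt class on $\mathbb{Z}$: $w\in A_2$ if $$\sup_I\Big(\frac1{|I|}\sum_{x\in I}w(x)\Big)\Big(\frac1{|I|}\sum_{x\in I}w(x)^{-1}\Big)<\infty.$$ $RH_r$ is the reverse Hölder class on $\mathbb{Z}$: $w\in RH_r$ if there is a constant $C$ such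 that for every interval $I$, $$\Big(\frac1{|I|}\sum_{x\in I}w(x)^r\Big)^{1/r}\le C\,\frac1{|I|}\sum_{x\in I}w(x).$$ *)

theory Defs
  imports "HOL-Analysis.Analysis"
begin

definition weight :: "(int \<Rightarrow> real) \<Rightarrow> bool" where
  "weight w \<longleftrightarrow> (\<forall>n. 0 < w n)"

definition finitely_supported :: "(int \<Rightarrow> complex) \<Rightarrow> bool" where
  "finitely_supported f \<longleftrightarrow> finite {n. f n \<noteq> 0}"

text \<open>The weighted norm takes values in \<open>[0, \<infinity>]\<close>, because the image of a finitely supported
  function under the operator below need not have finite norm for an arbitrary weight.\<close>

definition l2_norm :: "(int \<Rightarrow> real) \<Rightarrow> (int \<Rightarrow> complex) \<Rightarrow> ennreal" where
  "l2_norm w f =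
    (if (\<lambda>n. (cmod (f n))\<^sup>2 * w n) summable_on UNIV
     then ennreal (sqrt (\<Sum>\<^sub>\<infinity>n. (cmod (f n))\<^sup>2 * w n))
     else \<infinity>)"

text \<open>The parameter in \<open>\<real>/\<int>\<close> is given by a real representative; the operator depends only on
  its class, see \<open>H_add_int\<close>. For finitely supported \<open>f\<close> only finitely many terms of the
  sum are nonzero.\<close>

definition H :: "real \<Rightarrow> (int \<Rightarrow> complex) \<Rightarrow> int \<Rightarrow> complex" where
  "H \<alpha> f n =
    (\<Sum>\<^sub>\<infinity>m\<in>-{0}. exp (2 * of_real pi * \<i> * of_real \<alpha> * of_int (m\<^sup>2)) * f (n - m) / of_int m)"

lemma H_add_int: "H (\<alpha> + of_int k) = H \<alpha>"
proof -
  have "exp (2 * of_real pi * \<i> * of_real (\<alpha> + of_int k) * of_int (m\<^sup>2)) =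
        exp (2 * of_real pi * \<i> * of_real \<alpha> * (of_int (m\<^sup>2) :: complex))" for m :: int
  proof -
    have "2 * of_real pi * \<i> * of_real (\<alpha> + of_int k) * of_int (m\<^sup>2) =
          2 * of_real pi * \<i> * of_real \<alpha> * (of_int (m\<^sup>2) :: complex)
          + of_real (real_of_int (2 * (k * m\<^sup>2)) * pi) * \<i>"
      by (simp add: algebra_simps)
    then show ?thesis
      unfolding exp_eq by blast
  qed
  then show ?thesis
    by (simp add: H_def fun_eq_iff)
qed

text \<open>The least constant in the norm inequality, equal to \<open>\<infinity>\<close> if there is no finite one.\<close>

definition op_norm ::
  "((int \<Rightarrow> complex) \<Rightarrow> int \<Rightarrow> complex) \<Rightarrow> (int \<Rightarrow> real) \<Rightarrow> ennreal" where
  "op_norm T w =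
    Inf {C. \<forall>f. finitely_supported f \<longrightarrow> l2_norm w (T f) \<le> C * l2_norm w f}"

definition intervals :: "int set set" where
  "intervals = {I. I \<noteq> {} \<and> finite I \<and> (\<exists>a b :: real. I = {n. real_of_int n \<in> {a..b}})}"

definition avg :: "int set \<Rightarrow> (int \<Rightarrow> real) \<Rightarrow> real" where
  "avg I g = (1 / real (card I)) * (\<Sum>x\<in>I. g x)"

definition A2 :: "(int \<Rightarrow> real) set" where
  "A2 = {w. weight w \<and>
    (SUP I\<in>intervals. ereal (avg I w * avg I (\<lambda>x. inverse (w x)))) < \<infinity>}"

definition RH :: "real \<Rightarrow> (int \<Rightarrow> real) set" where
  "RH r = {w. weight w \<and>
    (\<exists>C :: real. \<forall>I\<in>intervals. avg I (\<lambda>x. w x powr r) powr (1 / r) \<le> C * avg I w)}"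

end

theory Submission
  imports Defs
begin

text \<open>The proof works with \<open>r = 3/2\<close>. The hypotheses then make \<open>w\<^bsup>3/2\<^esup>\<close> an \<open>A\<^sub>2\<close> weight
  (\<open>bump_of_A2_RH\<close>), and the spare power has two effects. In a bilinear form
  in \<open>f = \<phi> w\<^bsup>-1/2\<^esup>\<close> and \<open>g = \<psi> w\<^bsup>1/2\<^esup>\<close> the product of the \<open>L\<^sup>p\<close> averages of \<open>f\<close> and \<open>g\<close> over an interval,
  with \<open>p = 9/8\<close>, is bounded by the product of the \<open>L\<^sup>u\<close> averages of \<open>\<phi>\<close> and \<open>\<psi>\<close>, with \<open>u = 9/5 < 2\<close>
  (\<open>pav_pav_le\<close>). Hence a bound by \<open>L\<^sup>p\<close> averages over intervals, localised or sparse, is a bound on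
  \<open>\<ell>\<^sup>2(w)\<close>. And since \<open>p > 1\<close>, a gain on \<open>\<ell>\<^sup>2\<close> is a gain on \<open>\<ell>\<^sup>2(w)\<close>: an elementary truncation
  (\<open>truncated_pairing\<close>) takes the place of interpolation between \<open>\<ell>\<^sup>2\<close> and the trivial bound.

  Cut the kernel into dyadic pieces, the piece \<open>j\<close> living on \<open>\<bar>m\<bar> \<approx> 2\<^sup>j\<close>. The \<open>TT\<^sup>*\<close> method turns the
  quadratic phase into a linear one with frequency \<open>2 \<alpha>\<close>. If Dirichlet's theorem gives
  \<open>2 \<alpha> = b/q + \<theta>\<close> at this scale, the squared norm of the piece on \<open>\<ell>\<^sup>2\<close> is at most a constant times
  \<open>2\<^bsup>-j/2\<^esup> + q\<^bsup>-1\<^esup> min(1, (4\<^sup>j \<bar>\<theta>\<bar>)\<^bsup>-1/2\<^esup>)\<close> (\<open>piece_l2\<close>), and a power of this bounds its norm on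
  \<open>\<ell>\<^sup>2(w)\<close> (\<open>piece_weighted\<close>). This is summable over \<open>j\<close> except for the scales at which \<open>2 \<alpha>\<close> is
  within \<open>4\<^bsup>-j\<^esup>\<close> of a fraction \<open>b/q\<close> with \<open>q\<^sup>2 \<le> 2\<^sup>j\<close>. For a fixed fraction these scales form an
  interval, whose length cannot be bounded, so their sum has to be treated as a single operator.

  Write \<open>n = 2 q l + x\<close> with \<open>0 \<le> x < 2 q\<close>. Up to a harmless error, the operator of such a block is the
  product of a matrix with entries \<open>e(b (x - y)\<^sup>2 / (2 q)) / (2 q)\<close>, acting on \<open>x\<close>, and a truncated
  Hilbert transform acting on \<open>l\<close>. The matrix gains a power of \<open>q\<close> as a form on the
  normalised space \<open>L\<^sup>p\<close> (\<open>gauss_matrix_pairing\<close>). The Hilbert transform acts on functions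
  of \<open>l\<close> with values in this \<open>L\<^sup>p\<close> space; it is bounded on \<open>\<ell>\<^sup>p(L\<^sup>p)\<close> by the scalar case, and a stopping-time
  argument in the manner of sparse domination (\<open>stopping_time_bound\<close>) localises the bound to
  averages over intervals of \<open>l\<close>. An average over an interval of \<open>l\<close> of the norm in \<open>x\<close> is an average over
  an interval of \<open>\<int>\<close>, so the weight is again absorbed, now with the help of the maximal function
  (\<open>tensor_form_bdd\<close>). The block has norm at most a constant times \<open>q\<^bsup>-1/16\<^esup>\<close> on \<open>\<ell>\<^sup>2(w)\<close>
  (\<open>block_weighted\<close>). The denominators that occur for a given \<open>\<alpha>\<close> at least double from each to the next
  (\<open>close_frac_lacunary\<close>), so the blocks can be summed as well (\<open>truncated_kernel_bdd\<close>).

  The scalar bound on \<open>\<ell>\<^sup>p\<close> comes from the same stopping-time argument: it gives \<open>\<ell>\<^sup>9\<close> from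
  \<open>\<ell>\<^sup>2\<close>, and \<open>\<ell>\<^bsup>9/8\<^esup>\<close> follows by duality (\<open>odd_cz_pairing\<close>, \<open>odd_cz_lp\<close>).\<close>

section \<open>Power means over finite sets\<close>

lemma Holder_sum:
  fixes a b :: "'a \<Rightarrow> real"
  assumes "finite A" "s > 0" "t > 0" "s + t = 1"
    and "\<And>x. x \<in> A \<Longrightarrow> a x \<ge> 0" "\<And>x. x \<in> A \<Longrightarrow> b x \<ge> 0"
  shows "(\<Sum>x\<in>A. a x powr s * b x powr t) \<le> (\<Sum>x\<in>A. a x) powr s * (\<Sum>x\<in>A. b x) powr t"
proof -
  define U where "U = (\<Sum>x\<in>A. a x)"
  define V where "V = (\<Sum>x\<in>A. b x)"
  have UV: "U \<ge> 0" "V \<ge> 0" using assms by (auto simp: U_def V_def intro: sum_nonneg)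
  show ?thesis
  proof (cases "U = 0 \<or> V = 0")
    case True
    then have "(\<forall>x\<in>A. a x = 0) \<or> (\<forall>x\<in>A. b x = 0)"
      using assms by (auto simp: U_def V_def sum_nonneg_eq_0_iff)
    then have "(\<Sum>x\<in>A. a x powr s * b x powr t) = 0"
      by (intro sum.neutral) auto
    then show ?thesis by simp
  next
    case False
    with UV have pos: "U > 0" "V > 0" by auto
    have pt: "a x powr s * b x powr t \<le> U powr s * V powr t * (s * (a x / U) + t * (b x / V))"
      if x: "x \<in> A" for x
    proof (cases "a x = 0 \<or> b x = 0")
      case True
      then show ?thesis using assms x pos by (auto intro!: mult_nonneg_nonneg add_nonneg_nonneg)
    next
      case False
      then have "a x > 0" "b x > 0" using assms(5,6)[OF x] by auto
      then have "(a x / U) powr s * (b x / V) powr t \<le> s * (a x / U) + t * (b x / V)"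
        using Youngs_inequality_0[of s t "a x / U" "b x / V"] assms pos by auto
      then have "U powr s * V powr t * ((a x / U) powr s * (b x / V) powr t)
            \<le> U powr s * V powr t * (s * (a x / U) + t * (b x / V))"
        by (intro mult_left_mono) auto
      then show ?thesis using pos \<open>a x > 0\<close> \<open>b x > 0\<close> by (simp add: powr_divide)
    qed
    have "(\<Sum>x\<in>A. a x powr s * b x powr t)
        \<le> (\<Sum>x\<in>A. U powr s * V powr t * (s * (a x / U) + t * (b x / V)))"
      by (intro sum_mono pt)
    also have "\<dots> = U powr s * V powr t * (s * (U / U) + t * (V / V))"
      unfolding U_def V_def sum_divide_distrib sum_distrib_left sum.distrib[symmetric]
      by (rule refl)
    also have "\<dots> = U powr s * V powr t" using pos assms by simp
    finally show ?thesis unfolding U_def V_def .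
  qed
qed

lemma weighted_power_mean:
  fixes a d :: "'a \<Rightarrow> real"
  assumes "finite A" "p > 1"
    and "\<And>x. x \<in> A \<Longrightarrow> a x \<ge> 0" "\<And>x. x \<in> A \<Longrightarrow> d x \<ge> 0"
  shows "(\<Sum>x\<in>A. d x * a x) powr p \<le> (\<Sum>x\<in>A. d x) powr (p - 1) * (\<Sum>x\<in>A. d x * a x powr p)"
proof -
  have "(\<Sum>x\<in>A. d x * a x) = (\<Sum>x\<in>A. (d x * a x powr p) powr (1/p) * d x powr (1 - 1/p))"
  proof (rule sum.cong)
    fix x assume x: "x \<in> A"
    show "d x * a x = (d x * a x powr p) powr (1/p) * d x powr (1 - 1/p)"
    proof (cases "d x = 0")
      case False
      then have "d x > 0" using assms(4)[OF x] by auto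
      have "(d x * a x powr p) powr (1/p) = d x powr (1/p) * a x"
        using assms(2) assms(3)[OF x] \<open>d x > 0\<close>
        by (simp add: powr_mult powr_powr)
      then have "(d x * a x powr p) powr (1/p) * d x powr (1 - 1/p)
         = (d x powr (1/p) * d x powr (1 - 1/p)) * a x" by simp
      also have "d x powr (1/p) * d x powr (1 - 1/p) = d x"
        using \<open>d x > 0\<close> by (simp flip: powr_add)
      finally show ?thesis by simp
    qed simp
  qed simp
  also have "\<dots> \<le> (\<Sum>x\<in>A. d x * a x powr p) powr (1/p) * (\<Sum>x\<in>A. d x) powr (1 - 1/p)"
    using assms by (intro Holder_sum) auto
  finally have "(\<Sum>x\<in>A. d x * a x) powr p
      \<le> ((\<Sum>x\<in>A. d x * a x powr p) powr (1/p) * (\<Sum>x\<in>A. d x) powr (1 - 1/p)) powr p"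
    using assms by (intro powr_mono2) (auto intro!: sum_nonneg)
  also have "\<dots> = (\<Sum>x\<in>A. d x * a x powr p) * (\<Sum>x\<in>A. d x) powr (p - 1)"
  proof -
    have "(\<Sum>x\<in>A. d x * a x powr p) \<ge> 0" using assms by (intro sum_nonneg) auto
    moreover have "(1 - 1/p) * p = p - 1" using assms by (simp add: field_simps)
    ultimately show ?thesis using assms by (simp add: powr_mult powr_powr)
  qed
  finally show ?thesis by (simp add: mult.commute)
qed

lemma avg_nonneg: "(\<And>x. x \<in> I \<Longrightarrow> f x \<ge> 0) \<Longrightarrow> avg I f \<ge> 0"
  unfolding avg_def by (intro mult_nonneg_nonneg sum_nonneg) auto

lemma sum_eq_card_avg: "finite I \<Longrightarrow> I \<noteq> {} \<Longrightarrow> (\<Sum>x\<in>I. f x) = real (card I) * avg I f"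
  unfolding avg_def by auto

lemma avg_power_mean:
  assumes "finite I" "p > 1" "\<And>x. x \<in> I \<Longrightarrow> a x \<ge> 0"
  shows "avg I a powr p \<le> avg I (\<lambda>x. a x powr p)"
proof (cases "I = {}")
  case True then show ?thesis by (simp add: avg_def)
next
  case False
  have "(\<Sum>x\<in>I. 1 / real (card I) * a x) powr p
    \<le> (\<Sum>x\<in>I. 1 / real (card I)) powr (p - 1) * (\<Sum>x\<in>I. 1 / real (card I) * a x powr p)"
    using assms by (intro weighted_power_mean) auto
  then show ?thesis using False assms by (simp add: avg_def sum_divide_distrib)
qed

text \<open>The normalised \<open>L\<^sup>p\<close> norm over a finite set.\<close>

definition pav :: "real \<Rightarrow> int set \<Rightarrow> (int \<Rightarrow> complex) \<Rightarrow> real" where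
  "pav p I f = avg I (\<lambda>x. cmod (f x) powr p) powr (1 / p)"

lemma pav_nonneg [simp]: "pav p I f \<ge> 0" by (simp add: pav_def)

lemma sum_powr_eq_pav:
  assumes "finite I" "I \<noteq> {}" "p > 0"
  shows "(\<Sum>x\<in>I. cmod (f x) powr p) = real (card I) * pav p I f powr p"
proof -
  have "avg I (\<lambda>x. cmod (f x) powr p) \<ge> 0" by (intro avg_nonneg) auto
  then show ?thesis using assms by (simp add: sum_eq_card_avg pav_def powr_powr)
qed

lemma sum_norm_le_pav:
  assumes "finite I" "I \<noteq> {}" "p > 1"
  shows "(\<Sum>x\<in>I. cmod (f x)) \<le> real (card I) * pav p I f"
proof -
  have "avg I (\<lambda>x. cmod (f x)) powr p \<le> avg I (\<lambda>x. cmod (f x) powr p)"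
    using assms by (intro avg_power_mean) auto
  then have "(avg I (\<lambda>x. cmod (f x)) powr p) powr (1/p) \<le> pav p I f"
    unfolding pav_def using assms by (intro powr_mono2) auto
  moreover have "avg I (\<lambda>x. cmod (f x)) \<ge> 0" by (intro avg_nonneg) auto
  ultimately have "avg I (\<lambda>x. cmod (f x)) \<le> pav p I f" using assms by (simp add: powr_powr)
  then show ?thesis using assms by (simp add: sum_eq_card_avg mult_left_mono)
qed

text \<open>A substitute for complex interpolation between \<open>\<ell>\<^sup>2 \<rightarrow> \<ell>\<^sup>2\<close> and
  \<open>\<ell>\<^sup>1 \<rightarrow> \<ell>\<^sup>\<infinity>\<close>. Cut both functions at \<open>1 / \<epsilon>\<close> times their
  normalised \<open>L\<^sup>p\<close> norm: the bounded parts have controlled \<open>L\<^sup>2\<close> norms and see the small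
  operator norm, while each of the remaining terms contains a part of small \<open>L\<^sup>1\<close> norm, for which
  the size of the kernel suffices.\<close>

lemma truncated_pairing:
  fixes k :: "int \<Rightarrow> int \<Rightarrow> complex"
  assumes I: "finite I" "I \<noteq> {}" and p: "1 < p" "p \<le> 2" and B: "B \<ge> 0" and e: "0 < \<epsilon>" "\<epsilon> \<le> 1"
    and k: "\<And>x y. x \<in> I \<Longrightarrow> y \<in> I \<Longrightarrow> cmod (k x y) \<le> B / real (card I)"
    and l2: "\<And>f g. cmod (\<Sum>x\<in>I. \<Sum>y\<in>I. k x y * f y * g x)
        \<le> B * \<epsilon> * sqrt (\<Sum>y\<in>I. (cmod (f y))\<^sup>2) * sqrt (\<Sum>x\<in>I. (cmod (g x))\<^sup>2)"
  shows "cmod (\<Sum>x\<in>I. \<Sum>y\<in>I. k x y * f y * g x)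
        \<le> 3 * B * real (card I) * \<epsilon> powr (p - 1) * pav p I f * pav p I g"
proof -
  define L where "L = real (card I)"
  have L: "L > 0" using I by (auto simp: L_def card_gt_0_iff)
  have pz: "h x = 0" if "pav p I h = 0" "x \<in> I" for h x
  proof -
    have "(\<Sum>x\<in>I. cmod (h x) powr p) = 0" using I p that by (simp add: sum_powr_eq_pav)
    then show ?thesis using I that by (auto simp: sum_nonneg_eq_0_iff)
  qed
  show ?thesis
  proof (cases "pav p I f = 0 \<or> pav p I g = 0")
    case True
    then have "(\<Sum>x\<in>I. \<Sum>y\<in>I. k x y * f y * g x) = 0"
      using pz by (intro sum.neutral ballI) auto
    then show ?thesis using True by auto
  next
    case False
    have triv: "cmod (\<Sum>x\<in>I. \<Sum>y\<in>I. k x y * u y * v x)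
        \<le> B / L * (\<Sum>y\<in>I. cmod (u y)) * (\<Sum>x\<in>I. cmod (v x))" for u v
    proof -
      have "cmod (\<Sum>x\<in>I. \<Sum>y\<in>I. k x y * u y * v x) \<le> (\<Sum>x\<in>I. \<Sum>y\<in>I. cmod (k x y * u y * v x))"
        by (intro order_trans[OF norm_sum] sum_mono norm_sum)
      also have "\<dots> \<le> (\<Sum>x\<in>I. \<Sum>y\<in>I. B / L * cmod (u y) * cmod (v x))"
        unfolding norm_mult using k by (intro sum_mono mult_right_mono) (auto simp: L_def)
      also have "\<dots> = B / L * (\<Sum>y\<in>I. cmod (u y)) * (\<Sum>x\<in>I. cmod (v x))"
      proof -
        have "B / L * (\<Sum>y\<in>I. cmod (u y)) * (\<Sum>x\<in>I. cmod (v x))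
           = B / L * ((\<Sum>x\<in>I. cmod (v x)) * (\<Sum>y\<in>I. cmod (u y)))" by simp
        then show ?thesis unfolding sum_product by (simp add: sum_distrib_left mult_ac)
      qed
      finally show ?thesis .
    qed
    define lo where "lo h x = (if cmod (h x) \<le> pav p I h / \<epsilon> then h x else 0)" for h x
    define hi where "hi h x = h x - lo h x" for h x
    have split: "h x = lo h x + hi h x" for h x by (simp add: hi_def)
    have lo2: "(\<Sum>x\<in>I. (cmod (lo h x))\<^sup>2) \<le> L * \<epsilon> powr (p - 2) * (pav p I h)\<^sup>2" if "pav p I h > 0" for h
    proof -
      define F where "F = pav p I h"
      have F: "F > 0" using that by (simp add: F_def)
      have "(\<Sum>x\<in>I. (cmod (lo h x))\<^sup>2) \<le> (\<Sum>x\<in>I. (F / \<epsilon>) powr (2 - p) * cmod (h x) powr p)"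
      proof (rule sum_mono)
        fix x assume "x \<in> I"
        show "(cmod (lo h x))\<^sup>2 \<le> (F / \<epsilon>) powr (2 - p) * cmod (h x) powr p"
        proof (cases "cmod (h x) \<le> F / \<epsilon> \<and> h x \<noteq> 0")
          case True
          then have "(cmod (h x))\<^sup>2 = cmod (h x) powr (2 - p) * cmod (h x) powr p"
            by (simp flip: powr_add)
          also have "\<dots> \<le> (F / \<epsilon>) powr (2 - p) * cmod (h x) powr p"
            using True p by (intro mult_right_mono powr_mono2) auto
          finally show ?thesis using True by (simp add: lo_def F_def)
        next
          case False
          then have "lo h x = 0" by (auto simp: lo_def F_def)
          then show ?thesis by simp
        qed
      qed
      also have "\<dots> = (F / \<epsilon>) powr (2 - p) * (L * F powr p)"
        using I p by (simp add: sum_powr_eq_pav F_def L_def flip: sum_distrib_left)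
      also have "\<dots> = L * \<epsilon> powr (p - 2) * (F powr (2 - p) * F powr p)"
        using F e by (simp add: powr_divide powr_diff)
      also have "F powr (2 - p) * F powr p = F\<^sup>2"
        using F by (simp flip: powr_add)
      finally show ?thesis by (simp add: F_def)
    qed
    have hi1: "(\<Sum>x\<in>I. cmod (hi h x)) \<le> L * \<epsilon> powr (p - 1) * pav p I h" if "pav p I h > 0" for h
    proof -
      define F where "F = pav p I h"
      have F: "F > 0" using that by (simp add: F_def)
      have "(\<Sum>x\<in>I. cmod (hi h x)) \<le> (\<Sum>x\<in>I. (F / \<epsilon>) powr (1 - p) * cmod (h x) powr p)"
      proof (rule sum_mono)
        fix x assume "x \<in> I"
        show "cmod (hi h x) \<le> (F / \<epsilon>) powr (1 - p) * cmod (h x) powr p"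
        proof (cases "cmod (h x) \<le> F / \<epsilon>")
          case True
          then have "hi h x = 0" by (auto simp: hi_def lo_def F_def)
          then show ?thesis by simp
        next
          case False
          then have n: "cmod (h x) > F / \<epsilon>" by simp
          have pos: "F / \<epsilon> > 0" using F e by simp
          have "cmod (h x) = cmod (h x) powr (1 - p) * cmod (h x) powr p"
            using n pos by (simp flip: powr_add)
          also have "\<dots> \<le> (F / \<epsilon>) powr (1 - p) * cmod (h x) powr p"
            using n pos p by (intro mult_right_mono powr_mono2') auto
          finally show ?thesis using False by (simp add: hi_def lo_def F_def)
        qed
      qed
      also have "\<dots> = (F / \<epsilon>) powr (1 - p) * (L * F powr p)"
        using I p by (simp add: sum_powr_eq_pav F_def L_def flip: sum_distrib_left)
      also have "\<dots> = L * \<epsilon> powr (p - 1) * (F powr (1 - p) * F powr p)"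
        using F e by (simp add: powr_divide powr_diff)
      also have "F powr (1 - p) * F powr p = F"
        using F by (simp flip: powr_add)
      finally show ?thesis by (simp add: F_def)
    qed
    have lo1: "(\<Sum>x\<in>I. cmod (lo h x)) \<le> L * pav p I h" for h
    proof -
      have "(\<Sum>x\<in>I. cmod (lo h x)) \<le> (\<Sum>x\<in>I. cmod (h x))"
        by (intro sum_mono) (auto simp: lo_def)
      also have "\<dots> \<le> L * pav p I h" using I p by (simp add: sum_norm_le_pav L_def)
      finally show ?thesis .
    qed
    have g1: "(\<Sum>x\<in>I. cmod (g x)) \<le> L * pav p I g" using I p by (simp add: sum_norm_le_pav L_def)
    define F where "F = pav p I f"
    define G where "G = pav p I g"
    have FG: "F > 0" "G > 0"
      using False pav_nonneg[of p I f] pav_nonneg[of p I g] unfolding F_def G_def by linarith+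
    have "cmod (\<Sum>x\<in>I. \<Sum>y\<in>I. k x y * lo f y * lo g x)
       \<le> B * \<epsilon> * sqrt (\<Sum>y\<in>I. (cmod (lo f y))\<^sup>2) * sqrt (\<Sum>x\<in>I. (cmod (lo g x))\<^sup>2)" by (rule l2)
    also have "\<dots> \<le> B * \<epsilon> * sqrt (L * \<epsilon> powr (p - 2) * F\<^sup>2) * sqrt (L * \<epsilon> powr (p - 2) * G\<^sup>2)"
      using lo2[of f] lo2[of g] FG B e L unfolding F_def G_def
      by (intro mult_mono real_sqrt_le_mono mult_nonneg_nonneg) (auto intro: sum_nonneg)
    also have "\<dots> = B * \<epsilon> * (sqrt (L * \<epsilon> powr (p - 2)) * sqrt (L * \<epsilon> powr (p - 2))) * F * G"
      using FG by (simp add: real_sqrt_mult[of _ "F\<^sup>2"] real_sqrt_mult[of _ "G\<^sup>2"])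
    also have "sqrt (L * \<epsilon> powr (p - 2)) * sqrt (L * \<epsilon> powr (p - 2)) = L * \<epsilon> powr (p - 2)"
      using L by simp
    also have "B * \<epsilon> * (L * \<epsilon> powr (p - 2)) * F * G = B * L * (\<epsilon> * \<epsilon> powr (p - 2)) * F * G"
      by simp
    also have "\<epsilon> * \<epsilon> powr (p - 2) = \<epsilon> powr (p - 1)"
      using e powr_add[of \<epsilon> 1 "p - 2"] by simp
    finally have t1: "cmod (\<Sum>x\<in>I. \<Sum>y\<in>I. k x y * lo f y * lo g x) \<le> B * L * \<epsilon> powr (p - 1) * F * G" .
    have "cmod (\<Sum>x\<in>I. \<Sum>y\<in>I. k x y * hi f y * g x)
       \<le> B / L * (\<Sum>y\<in>I. cmod (hi f y)) * (\<Sum>x\<in>I. cmod (g x))" by (rule triv)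
    also have "\<dots> \<le> B / L * (L * \<epsilon> powr (p - 1) * F) * (L * G)"
      using hi1[of f] g1 FG B L unfolding F_def G_def
      by (intro mult_mono mult_nonneg_nonneg) (auto intro: sum_nonneg)
    also have "\<dots> = B * L * \<epsilon> powr (p - 1) * F * G" using L by simp
    finally have t2: "cmod (\<Sum>x\<in>I. \<Sum>y\<in>I. k x y * hi f y * g x) \<le> B * L * \<epsilon> powr (p - 1) * F * G" .
    have "cmod (\<Sum>x\<in>I. \<Sum>y\<in>I. k x y * lo f y * hi g x)
       \<le> B / L * (\<Sum>y\<in>I. cmod (lo f y)) * (\<Sum>x\<in>I. cmod (hi g x))" by (rule triv)
    also have "\<dots> \<le> B / L * (L * F) * (L * \<epsilon> powr (p - 1) * G)"
      using hi1[of g] lo1[of f] FG B L unfolding F_def G_def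
      by (intro mult_mono mult_nonneg_nonneg) (auto intro: sum_nonneg)
    also have "\<dots> = B * L * \<epsilon> powr (p - 1) * F * G" using L by simp
    finally have t3: "cmod (\<Sum>x\<in>I. \<Sum>y\<in>I. k x y * lo f y * hi g x) \<le> B * L * \<epsilon> powr (p - 1) * F * G" .
    have "(\<Sum>x\<in>I. \<Sum>y\<in>I. k x y * f y * g x) = (\<Sum>x\<in>I. \<Sum>y\<in>I. k x y * lo f y * lo g x)
        + (\<Sum>x\<in>I. \<Sum>y\<in>I. k x y * hi f y * g x) + (\<Sum>x\<in>I. \<Sum>y\<in>I. k x y * lo f y * hi g x)"
      unfolding sum.distrib[symmetric]
      by (intro sum.cong refl) (simp add: hi_def algebra_simps)
    then have "cmod (\<Sum>x\<in>I. \<Sum>y\<in>I. k x y * f y * g x) \<le> 3 * (B * L * \<epsilon> powr (p - 1) * F * G)"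
      using t1 t2 t3 norm_triangle_ineq by (smt (verit))
    then show ?thesis by (simp add: F_def G_def L_def)
  qed
qed

section \<open>Bilinear forms on weighted spaces\<close>

text \<open>The kernel \<open>k\<close> defines an operator of norm at most \<open>C\<close> on \<open>\<ell>\<^sup>2(w)\<close>, in dual form.
  Restricting to finite sets avoids all questions of convergence, and the functions need not
  be supported in \<open>W\<close>.\<close>

definition form_bdd :: "(int \<Rightarrow> real) \<Rightarrow> real \<Rightarrow> (int \<Rightarrow> int \<Rightarrow> complex) \<Rightarrow> bool" where
  "form_bdd w C k \<longleftrightarrow> (\<forall>W f g. finite W \<longrightarrow>
     cmod (\<Sum>n\<in>W. \<Sum>m\<in>W. k n m * f m * g n)
       \<le> C * sqrt (\<Sum>m\<in>W. (cmod (f m))\<^sup>2 * w m) * sqrt (\<Sum>n\<in>W. (cmod (g n))\<^sup>2 / w n))"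

lemma form_bddD:
  "form_bdd w C k \<Longrightarrow> finite W \<Longrightarrow>
     cmod (\<Sum>n\<in>W. \<Sum>m\<in>W. k n m * f m * g n)
       \<le> C * sqrt (\<Sum>m\<in>W. (cmod (f m))\<^sup>2 * w m) * sqrt (\<Sum>n\<in>W. (cmod (g n))\<^sup>2 / w n)"
  by (simp add: form_bdd_def)

lemma form_bdd_mono:
  assumes "form_bdd w C k" "C \<le> D" "weight w"
  shows "form_bdd w D k"
  unfolding form_bdd_def
proof (intro allI impI)
  fix W :: "int set" and f g :: "int \<Rightarrow> complex" assume W: "finite W"
  have "C * sqrt (\<Sum>m\<in>W. (cmod (f m))\<^sup>2 * w m) * sqrt (\<Sum>n\<in>W. (cmod (g n))\<^sup>2 / w n)
     \<le> D * sqrt (\<Sum>m\<in>W. (cmod (f m))\<^sup>2 * w m) * sqrt (\<Sum>n\<in>W. (cmod (g n))\<^sup>2 / w n)"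
    using assms less_imp_le unfolding weight_def
    by (intro mult_right_mono real_sqrt_ge_zero sum_nonneg mult_nonneg_nonneg divide_nonneg_nonneg) auto
  with form_bddD[OF assms(1) W, of f g]
  show "cmod (\<Sum>n\<in>W. \<Sum>m\<in>W. k n m * f m * g n)
     \<le> D * sqrt (\<Sum>m\<in>W. (cmod (f m))\<^sup>2 * w m) * sqrt (\<Sum>n\<in>W. (cmod (g n))\<^sup>2 / w n)" by linarith
qed

lemma form_bdd_add:
  assumes "form_bdd w C k" "form_bdd w D l"
  shows "form_bdd w (C + D) (\<lambda>n m. k n m + l n m)"
  unfolding form_bdd_def
proof (intro allI impI)
  fix W :: "int set" and f g :: "int \<Rightarrow> complex" assume W: "finite W"
  have "(\<Sum>n\<in>W. \<Sum>m\<in>W. (k n m + l n m) * f m * g n)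
     = (\<Sum>n\<in>W. \<Sum>m\<in>W. k n m * f m * g n) + (\<Sum>n\<in>W. \<Sum>m\<in>W. l n m * f m * g n)"
    by (simp add: algebra_simps sum.distrib)
  then show "cmod (\<Sum>n\<in>W. \<Sum>m\<in>W. (k n m + l n m) * f m * g n)
     \<le> (C + D) * sqrt (\<Sum>m\<in>W. (cmod (f m))\<^sup>2 * w m) * sqrt (\<Sum>n\<in>W. (cmod (g n))\<^sup>2 / w n)"
    using form_bddD[OF assms(1) W, of f g] form_bddD[OF assms(2) W, of f g]
    by (simp add: distrib_right) (smt (verit) norm_triangle_ineq)
qed

lemma form_bdd_zero: "form_bdd w 0 (\<lambda>n m. 0)"
  by (simp add: form_bdd_def)

lemma form_bdd_sum:
  assumes "finite J" "\<And>j. j \<in> J \<Longrightarrow> form_bdd w (C j) (k j)"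
  shows "form_bdd w (\<Sum>j\<in>J. C j) (\<lambda>n m. \<Sum>j\<in>J. k j n m)"
  using assms
proof (induction J rule: finite_induct)
  case empty
  then show ?case by (simp add: form_bdd_zero)
next
  case (insert j J)
  then have "form_bdd w (C j + (\<Sum>j\<in>J. C j)) (\<lambda>n m. k j n m + (\<Sum>j\<in>J. k j n m))"
    by (intro form_bdd_add) auto
  then show ?case using insert by simp
qed

lemma Cauchy_Schwarz_sqrt:
  fixes a b :: "'a \<Rightarrow> real"
  assumes "\<And>i. i \<in> I \<Longrightarrow> a i \<ge> 0" "\<And>i. i \<in> I \<Longrightarrow> b i \<ge> 0"
  shows "(\<Sum>i\<in>I. sqrt (a i) * sqrt (b i)) \<le> sqrt (\<Sum>i\<in>I. a i) * sqrt (\<Sum>i\<in>I. b i)"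
proof -
  have "(\<Sum>i\<in>I. sqrt (a i) * sqrt (b i))\<^sup>2 \<le> (\<Sum>i\<in>I. (sqrt (a i))\<^sup>2) * (\<Sum>i\<in>I. (sqrt (b i))\<^sup>2)"
    by (rule Cauchy_Schwarz_ineq_sum)
  also have "\<dots> = (\<Sum>i\<in>I. a i) * (\<Sum>i\<in>I. b i)"
    using assms by (simp cong: sum.cong)
  finally have "(\<Sum>i\<in>I. sqrt (a i) * sqrt (b i)) \<le> sqrt ((\<Sum>i\<in>I. a i) * (\<Sum>i\<in>I. b i))"
    by (rule real_le_rsqrt)
  then show ?thesis by (simp add: real_sqrt_mult)
qed

text \<open>Schur's test for kernels dominated by a summable function of \<open>n - m\<close>.\<close>

lemma form_bdd_Schur:
  fixes k :: "int \<Rightarrow> int \<Rightarrow> complex" and c :: "int \<Rightarrow> real"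
  assumes Z: "finite Z" and c0: "\<And>h. c h \<ge> 0" and cH: "\<And>n m. n - m \<notin> Z \<Longrightarrow> k n m = 0"
    and k: "\<And>n m. cmod (k n m) \<le> c (n - m)" and S: "(\<Sum>h\<in>Z. c h) \<le> S"
  shows "form_bdd (\<lambda>_. 1) S k"
  unfolding form_bdd_def
proof (intro allI impI)
  fix W :: "int set" and f g :: "int \<Rightarrow> complex" assume W: "finite W"
  define d where "d h = (if h \<in> Z then c h else 0)" for h
  have d0: "d h \<ge> 0" for h using c0 by (simp add: d_def)
  have kd: "cmod (k n m) \<le> d (n - m)" for n m using cH[of n m] k[of n m] by (auto simp: d_def)
  have S0: "S \<ge> 0" using S sum_nonneg[of Z c] c0 by fastforce
  have row: "(\<Sum>m\<in>W. d (n - m)) \<le> S" "(\<Sum>m\<in>W. d (m - n)) \<le> S" for n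
  proof -
    have "(\<Sum>m\<in>W. d (n - m)) = (\<Sum>h\<in>(\<lambda>m. n - m) ` W. d h)"
      by (subst sum.reindex) (auto simp: inj_on_def)
    also have "\<dots> \<le> (\<Sum>h\<in>(\<lambda>m. n - m) ` W \<union> Z. d h)"
      using W Z d0 by (intro sum_mono2) auto
    also have "\<dots> = (\<Sum>h\<in>Z. d h)"
      using W Z by (intro sum.mono_neutral_right) (auto simp: d_def)
    finally show "(\<Sum>m\<in>W. d (n - m)) \<le> S" using S by (simp add: d_def)
    have "(\<Sum>m\<in>W. d (m - n)) = (\<Sum>h\<in>(\<lambda>m. m - n) ` W. d h)"
      by (subst sum.reindex) (auto simp: inj_on_def)
    also have "\<dots> \<le> (\<Sum>h\<in>(\<lambda>m. m - n) ` W \<union> Z. d h)"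
      using W Z d0 by (intro sum_mono2) auto
    also have "\<dots> = (\<Sum>h\<in>Z. d h)"
      using W Z by (intro sum.mono_neutral_right) (auto simp: d_def)
    finally show "(\<Sum>m\<in>W. d (m - n)) \<le> S" using S by (simp add: d_def)
  qed
  have "cmod (\<Sum>n\<in>W. \<Sum>m\<in>W. k n m * f m * g n) \<le> (\<Sum>n\<in>W. \<Sum>m\<in>W. cmod (k n m * f m * g n))"
    by (intro order_trans[OF norm_sum] sum_mono norm_sum)
  also have "\<dots> \<le> (\<Sum>n\<in>W. \<Sum>m\<in>W. d (n - m) * cmod (f m) * cmod (g n))"
    unfolding norm_mult by (intro sum_mono mult_right_mono kd) auto
  also have "\<dots> = (\<Sum>(n, m)\<in>W \<times> W. sqrt (d (n - m) * (cmod (f m))\<^sup>2) * sqrt (d (n - m) * (cmod (g n))\<^sup>2))"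
    unfolding sum.cartesian_product using d0 by (intro sum.cong) (auto simp: real_sqrt_mult)
  also have "\<dots> \<le> sqrt (\<Sum>(n, m)\<in>W \<times> W. d (n - m) * (cmod (f m))\<^sup>2)
       * sqrt (\<Sum>(n, m)\<in>W \<times> W. d (n - m) * (cmod (g n))\<^sup>2)"
    using Cauchy_Schwarz_sqrt[of "W \<times> W" "\<lambda>(n, m). d (n - m) * (cmod (f m))\<^sup>2" "\<lambda>(n, m). d (n - m) * (cmod (g n))\<^sup>2"] d0
    by (auto simp: case_prod_unfold)
  also have "\<dots> \<le> sqrt (S * (\<Sum>m\<in>W. (cmod (f m))\<^sup>2)) * sqrt (S * (\<Sum>n\<in>W. (cmod (g n))\<^sup>2))"
  proof (intro mult_mono real_sqrt_le_mono)
    have "(\<Sum>(n, m)\<in>W \<times> W. d (n - m) * (cmod (f m))\<^sup>2) = (\<Sum>m\<in>W. \<Sum>n\<in>W. d (n - m) * (cmod (f m))\<^sup>2)"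
      unfolding sum.cartesian_product[symmetric] by (rule sum.swap)
    also have "\<dots> = (\<Sum>m\<in>W. (\<Sum>n\<in>W. d (n - m)) * (cmod (f m))\<^sup>2)" by (simp add: sum_distrib_right)
    also have "\<dots> \<le> (\<Sum>m\<in>W. S * (cmod (f m))\<^sup>2)" by (intro sum_mono mult_right_mono row) auto
    finally show "(\<Sum>(n, m)\<in>W \<times> W. d (n - m) * (cmod (f m))\<^sup>2) \<le> S * (\<Sum>m\<in>W. (cmod (f m))\<^sup>2)"
      by (simp add: sum_distrib_left)
    have "(\<Sum>(n, m)\<in>W \<times> W. d (n - m) * (cmod (g n))\<^sup>2) = (\<Sum>n\<in>W. (\<Sum>m\<in>W. d (n - m)) * (cmod (g n))\<^sup>2)"
      unfolding sum.cartesian_product[symmetric] by (simp add: sum_distrib_right)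
    also have "\<dots> \<le> (\<Sum>n\<in>W. S * (cmod (g n))\<^sup>2)" by (intro sum_mono mult_right_mono row) auto
    finally show "(\<Sum>(n, m)\<in>W \<times> W. d (n - m) * (cmod (g n))\<^sup>2) \<le> S * (\<Sum>n\<in>W. (cmod (g n))\<^sup>2)"
      by (simp add: sum_distrib_left)
  qed (use d0 S0 in \<open>auto intro!: sum_nonneg mult_nonneg_nonneg\<close>)
  also have "\<dots> = S * sqrt (\<Sum>m\<in>W. (cmod (f m))\<^sup>2 * 1) * sqrt (\<Sum>n\<in>W. (cmod (g n))\<^sup>2 / 1)"
    using S0 by (simp add: real_sqrt_mult)
  finally show "cmod (\<Sum>n\<in>W. \<Sum>m\<in>W. k n m * f m * g n)
     \<le> S * sqrt (\<Sum>m\<in>W. (cmod (f m))\<^sup>2 * 1) * sqrt (\<Sum>n\<in>W. (cmod (g n))\<^sup>2 / 1)" .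
qed

section \<open>Weights with a power bump\<close>

text \<open>The \<open>A\<^sub>2\<close> condition for \<open>w\<^bsup>3/2\<^esup>\<close>, with constant \<open>C\<close>, on the intervals of \<open>\<int>\<close>.\<close>

definition bump :: "real \<Rightarrow> (int \<Rightarrow> real) \<Rightarrow> bool" where
  "bump C w \<longleftrightarrow> weight w \<and> (\<forall>a b. a < b \<longrightarrow>
     avg {a..<b} (\<lambda>x. w x powr (3/2)) * avg {a..<b} (\<lambda>x. w x powr (-3/2)) \<le> C)"

lemma pav_le_weighted:
  assumes I: "finite I" "I \<noteq> {}" and w: "weight w"
  shows "pav (9/8) I f \<le> avg I (\<lambda>x. ((cmod (f x))\<^sup>2 * w x) powr (9/10)) powr (5/9)
            * avg I (\<lambda>x. w x powr (-3/2)) powr (1/3)"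
proof -
  let ?a = "\<lambda>x. ((cmod (f x))\<^sup>2 * w x) powr (9/10)"
  let ?b = "\<lambda>x. w x powr (-3/2)"
  have L: "real (card I) > 0" using I by (simp add: card_gt_0_iff)
  have wp: "w x > 0" for x using w by (simp add: weight_def)
  have "(\<Sum>x\<in>I. cmod (f x) powr (9/8)) = (\<Sum>x\<in>I. ?a x powr (5/8) * ?b x powr (3/8))"
  proof (rule sum.cong)
    fix x assume "x \<in> I"
    show "cmod (f x) powr (9/8) = ?a x powr (5/8) * ?b x powr (3/8)"
    proof (cases "f x = 0")
      case False
      then have "cmod (f x) > 0" by simp
      then have "((cmod (f x))\<^sup>2) powr (9/16) = cmod (f x) powr (9/8)"
        by (simp add: powr_powr flip: powr_numeral)
      moreover have "w x powr (9/16) * w x powr (-9/16) = 1" using wp[of x] by (simp flip: powr_add)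
      ultimately show ?thesis using wp[of x] by (simp add: powr_powr powr_mult)
    qed simp
  qed simp
  also have "\<dots> \<le> (\<Sum>x\<in>I. ?a x) powr (5/8) * (\<Sum>x\<in>I. ?b x) powr (3/8)"
    using I by (intro Holder_sum) auto
  also have "\<dots> = (real (card I) * avg I ?a) powr (5/8) * (real (card I) * avg I ?b) powr (3/8)"
    using I by (simp add: sum_eq_card_avg)
  also have "\<dots> = real (card I) powr (5/8) * real (card I) powr (3/8)
       * (avg I ?a powr (5/8) * avg I ?b powr (3/8))"
    using L by (subst (1 2) powr_mult) (auto intro: avg_nonneg)
  also have "real (card I) powr (5/8) * real (card I) powr (3/8) = real (card I)"
    using L by (simp flip: powr_add)
  finally have "avg I (\<lambda>x. cmod (f x) powr (9/8)) \<le> avg I ?a powr (5/8) * avg I ?b powr (3/8)"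
    using L by (simp add: avg_def field_simps)
  then have "pav (9/8) I f \<le> (avg I ?a powr (5/8) * avg I ?b powr (3/8)) powr (1 / (9/8))"
    unfolding pav_def by (intro powr_mono2 avg_nonneg) auto
  also have "\<dots> = avg I ?a powr (5/9) * avg I ?b powr (1/3)"
    by (subst powr_mult) (auto simp: powr_powr)
  finally show ?thesis .
qed

text \<open>The exponents \<open>9/8\<close>, \<open>9/5\<close> and \<open>3\<close> satisfy Hoelder's relation, so the bump condition at
  power \<open>3/2\<close> absorbs the weight. What remains are averages with exponent \<open>9/5 < 2\<close>; the gap
  to \<open>2\<close> is what makes the maximal function applicable.\<close>

lemma pav_pav_le:
  assumes w: "bump C w" and ab: "a < b"
  shows "pav (9/8) {a..<b} f * pav (9/8) {a..<b} g
     \<le> C powr (1/3) * (avg {a..<b} (\<lambda>x. ((cmod (f x))\<^sup>2 * w x) powr (9/10)) powr (5/9)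
          * avg {a..<b} (\<lambda>x. ((cmod (g x))\<^sup>2 / w x) powr (9/10)) powr (5/9))"
proof -
  let ?I = "{a..<b}"
  have I: "finite ?I" "?I \<noteq> {}" using ab by auto
  have w0: "weight w" and w': "weight (\<lambda>x. 1 / w x)" using w by (auto simp: bump_def weight_def)
  have inv: "(1 / w x) powr (-3/2) = w x powr (3/2)" for x
    using w0 by (simp add: weight_def powr_divide powr_minus_divide)
  have g: "pav (9/8) ?I g \<le> avg ?I (\<lambda>x. ((cmod (g x))\<^sup>2 / w x) powr (9/10)) powr (5/9)
            * avg ?I (\<lambda>x. w x powr (3/2)) powr (1/3)"
    using pav_le_weighted[OF I w', of g] unfolding inv by simp
  have "(avg ?I (\<lambda>x. w x powr (3/2)) * avg ?I (\<lambda>x. w x powr (-3/2))) powr (1/3) \<le> C powr (1/3)"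
    using w ab by (intro powr_mono2 mult_nonneg_nonneg avg_nonneg) (auto simp: bump_def)
  then have C: "avg ?I (\<lambda>x. w x powr (3/2)) powr (1/3) * avg ?I (\<lambda>x. w x powr (-3/2)) powr (1/3) \<le> C powr (1/3)"
    by (subst (asm) powr_mult) (auto intro: avg_nonneg)
  let ?A = "avg ?I (\<lambda>x. ((cmod (f x))\<^sup>2 * w x) powr (9/10)) powr (5/9)"
  let ?B = "avg ?I (\<lambda>x. ((cmod (g x))\<^sup>2 / w x) powr (9/10)) powr (5/9)"
  have "pav (9/8) ?I f * pav (9/8) ?I g \<le> (?A * avg ?I (\<lambda>x. w x powr (-3/2)) powr (1/3))
     * (?B * avg ?I (\<lambda>x. w x powr (3/2)) powr (1/3))"
    using pav_le_weighted[OF I w0, of f] g by (intro mult_mono) auto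
  also have "\<dots> = (avg ?I (\<lambda>x. w x powr (3/2)) powr (1/3) * avg ?I (\<lambda>x. w x powr (-3/2)) powr (1/3)) * (?A * ?B)"
    by (simp add: mult_ac)
  also have "\<dots> \<le> C powr (1/3) * (?A * ?B)" using C by (intro mult_right_mono) auto
  finally show ?thesis .
qed

lemma avg_subpower_le:
  assumes "finite I" "\<And>x. x \<in> I \<Longrightarrow> a x \<ge> 0"
  shows "avg I (\<lambda>x. a x powr (9/10)) powr (5/9) \<le> sqrt (avg I a)"
proof -
  have "avg I (\<lambda>x. a x powr (9/10)) powr (10/9) \<le> avg I (\<lambda>x. (a x powr (9/10)) powr (10/9))"
    using assms by (intro avg_power_mean) auto
  also have "\<dots> = avg I a" unfolding avg_def using assms by (simp add: powr_powr cong: sum.cong)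
  finally have "(avg I (\<lambda>x. a x powr (9/10)) powr (10/9)) powr (1/2) \<le> avg I a powr (1/2)"
    by (intro powr_mono2) auto
  then show ?thesis using assms by (simp add: powr_powr powr_half_sqrt avg_nonneg)
qed

text \<open>A kernel living at one scale inherits, on \<open>\<ell>\<^sup>2(w)\<close>, a power of its unweighted norm.
  After localisation to intervals of length \<open>N\<close> this is the truncated pairing followed by
  the bump condition.\<close>

lemma single_scale:
  assumes w: "bump C w" and N: "N \<ge> (1::int)" and B: "B \<ge> 0" and e: "0 < \<epsilon>" "\<epsilon> \<le> 1"
    and k: "\<And>n m. cmod (k n m) \<le> B / real_of_int N"
    and k0: "\<And>n m. \<bar>n - m\<bar> > N \<Longrightarrow> k n m = 0"
    and l2: "form_bdd (\<lambda>_. 1) (B * \<epsilon>) k"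
  shows "form_bdd w (16 * C powr (1/3) * B * \<epsilon> powr (1/8)) k"
  unfolding form_bdd_def
proof (intro allI impI)
  fix W :: "int set" and f g :: "int \<Rightarrow> complex" assume W: "finite W"
  have w0: "w x > 0" for x using w by (auto simp: bump_def weight_def)
  define f' where "f' m = (if m \<in> W then f m else 0)" for m
  define gi where "gi i n = (if n \<in> W \<and> n div N = i then g n else 0)" for i n
  \<comment> \<open>A point of the block \<open>i\<close> of length \<open>N\<close> interacts only with this block and its two neighbours.\<close>
  define T where "T i = {(i - 1) * N..<(i + 2) * N}" for i
  define a where "a m = (cmod (f' m))\<^sup>2 * w m" for m
  define b where "b i n = (cmod (gi i n))\<^sup>2 / w n" for i n
  define J where "J = (\<lambda>n. n div N) ` W"
  have a0: "a m \<ge> 0" and b0: "b i n \<ge> 0" for m n i using w0[of m] w0[of n] by (auto simp: a_def b_def)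
  have J: "finite J" using W by (simp add: J_def)
  have Tf: "finite (T i)" "T i \<noteq> {}" for i using N by (auto simp: T_def)
  have cT: "real (card (T i)) = 3 * real_of_int N" for i using N by (simp add: T_def algebra_simps)
  have inT: "m \<in> T i" if "n div N = i" "\<bar>n - m\<bar> \<le> N" for n m i
  proof -
    have "n = i * N + n mod N" using that(1) div_mult_mod_eq[of n N] by simp
    moreover have "0 \<le> n mod N" "n mod N < N" using N by auto
    ultimately have "i * N \<le> n" "n < (i + 1) * N" by (auto simp: distrib_right)
    then show ?thesis using that by (auto simp: T_def algebra_simps)
  qed
  have loc: "(\<Sum>n\<in>{n\<in>W. n div N = i}. \<Sum>m\<in>W. k n m * f m * g n)
     = (\<Sum>n\<in>T i. \<Sum>m\<in>T i. k n m * f' m * gi i n)" for i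
  proof -
    have in1: "(\<Sum>m\<in>W. k n m * f m * g n) = (\<Sum>m\<in>T i. k n m * f' m * gi i n)" if n: "n \<in> W" "n div N = i" for n
    proof -
      have "(\<Sum>m\<in>W. k n m * f m * g n) = (\<Sum>m\<in>W \<union> T i. k n m * f' m * gi i n)"
        using W Tf n by (intro sum.mono_neutral_cong_left) (auto simp: f'_def gi_def)
      also have "\<dots> = (\<Sum>m\<in>T i. k n m * f' m * gi i n)"
        using W Tf n inT[OF n(2)] k0 by (intro sum.mono_neutral_right) (auto, meson not_le)
      finally show ?thesis .
    qed
    have "(\<Sum>n\<in>{n\<in>W. n div N = i}. \<Sum>m\<in>W. k n m * f m * g n)
        = (\<Sum>n\<in>{n\<in>W. n div N = i}. \<Sum>m\<in>T i. k n m * f' m * gi i n)"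
      by (intro sum.cong refl in1) auto
    also have "\<dots> = (\<Sum>n\<in>T i. \<Sum>m\<in>T i. k n m * f' m * gi i n)"
    proof (rule sum.mono_neutral_left)
      show "{n \<in> W. n div N = i} \<subseteq> T i" using inT[of _ i] N by auto
      show "\<forall>n\<in>T i - {n \<in> W. n div N = i}. (\<Sum>m\<in>T i. k n m * f' m * gi i n) = 0"
        by (auto simp: gi_def)
    qed (use Tf in auto)
    finally show ?thesis .
  qed
  define c where "c = C powr (1/3)"
  have c: "c \<ge> 0" by (simp add: c_def)
  have each: "cmod (\<Sum>n\<in>T i. \<Sum>m\<in>T i. k n m * f' m * gi i n)
      \<le> 9 * c * B * \<epsilon> powr (1/8) * (sqrt (\<Sum>m\<in>T i. a m) * sqrt (\<Sum>n\<in>T i. b i n))" for i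
  proof -
    have "cmod (\<Sum>n\<in>T i. \<Sum>m\<in>T i. k n m * f' m * gi i n)
      \<le> 3 * (3 * B) * real (card (T i)) * \<epsilon> powr (9/8 - 1) * pav (9/8) (T i) f' * pav (9/8) (T i) (gi i)"
    proof (rule truncated_pairing)
      fix u v :: "int \<Rightarrow> complex"
      have "cmod (\<Sum>x\<in>T i. \<Sum>y\<in>T i. k x y * u y * v x)
        \<le> B * \<epsilon> * sqrt (\<Sum>y\<in>T i. (cmod (u y))\<^sup>2) * sqrt (\<Sum>x\<in>T i. (cmod (v x))\<^sup>2)"
        using form_bddD[OF l2 Tf(1)[of i], of u v] by simp
      also have "\<dots> \<le> 3 * B * \<epsilon> * sqrt (\<Sum>y\<in>T i. (cmod (u y))\<^sup>2) * sqrt (\<Sum>x\<in>T i. (cmod (v x))\<^sup>2)"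
        using B e by (intro mult_right_mono real_sqrt_ge_zero sum_nonneg) auto
      finally show "cmod (\<Sum>x\<in>T i. \<Sum>y\<in>T i. k x y * u y * v x)
        \<le> 3 * B * \<epsilon> * sqrt (\<Sum>y\<in>T i. (cmod (u y))\<^sup>2) * sqrt (\<Sum>x\<in>T i. (cmod (v x))\<^sup>2)" .
    qed (use Tf B e k cT N in auto)
    also have "\<dots> = 27 * B * real_of_int N * \<epsilon> powr (1/8) * (pav (9/8) (T i) f' * pav (9/8) (T i) (gi i))"
      by (simp add: cT)
    also have "\<dots> \<le> 27 * B * real_of_int N * \<epsilon> powr (1/8) * (c * (sqrt (avg (T i) a) * sqrt (avg (T i) (b i))))"
    proof (intro mult_left_mono)
      have ab: "(i - 1) * N < (i + 2) * N" using N by simp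
      have "pav (9/8) (T i) f' * pav (9/8) (T i) (gi i)
        \<le> c * (avg (T i) (\<lambda>x. a x powr (9/10)) powr (5/9) * avg (T i) (\<lambda>x. b i x powr (9/10)) powr (5/9))"
        using pav_pav_le[OF w ab, of f' "gi i"] unfolding a_def b_def T_def c_def .
      also have "\<dots> \<le> c * (sqrt (avg (T i) a) * sqrt (avg (T i) (b i)))"
        using a0 b0 Tf by (intro mult_left_mono mult_mono avg_subpower_le c) (auto intro!: avg_nonneg)
      finally show "pav (9/8) (T i) f' * pav (9/8) (T i) (gi i) \<le> c * (sqrt (avg (T i) a) * sqrt (avg (T i) (b i)))" .
    qed (use B N in auto)
    also have "sqrt (avg (T i) a) = sqrt (\<Sum>m\<in>T i. a m) / sqrt (3 * N)"
      using Tf by (simp add: avg_def cT real_sqrt_divide)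
    also have "sqrt (avg (T i) (b i)) = sqrt (\<Sum>m\<in>T i. b i m) / sqrt (3 * N)"
      using Tf by (simp add: avg_def cT real_sqrt_divide)
    also have "27 * B * real_of_int N * \<epsilon> powr (1/8) * (c * (sqrt (\<Sum>m\<in>T i. a m) / sqrt (3 * N) * (sqrt (\<Sum>m\<in>T i. b i m) / sqrt (3 * N))))
       = 9 * c * B * \<epsilon> powr (1/8) * (sqrt (\<Sum>m\<in>T i. a m) * sqrt (\<Sum>n\<in>T i. b i n)) * (3 * N / (sqrt (3 * N) * sqrt (3 * N)))"
      by (simp add: field_simps)
    also have "3 * N / (sqrt (3 * N) * sqrt (3 * N)) = 1" using N by simp
    finally show ?thesis by simp
  qed
  have sa: "(\<Sum>i\<in>J. \<Sum>m\<in>T i. a m) \<le> 3 * (\<Sum>m\<in>W. (cmod (f m))\<^sup>2 * w m)"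
  proof -
    have "(\<Sum>i\<in>J. \<Sum>m\<in>T i. a m) = (\<Sum>i\<in>J. \<Sum>m\<in>W. if m \<in> T i then a m else 0)"
    proof (rule sum.cong)
      fix i assume "i \<in> J"
      have "(\<Sum>m\<in>T i. a m) = (\<Sum>m\<in>W \<inter> T i. a m)"
        using Tf by (intro sum.mono_neutral_right) (auto simp: a_def f'_def)
      also have "\<dots> = (\<Sum>m\<in>W. if m \<in> T i then a m else 0)" using W by (simp add: sum.inter_restrict)
      finally show "(\<Sum>m\<in>T i. a m) = (\<Sum>m\<in>W. if m \<in> T i then a m else 0)" .
    qed simp
    also have "\<dots> = (\<Sum>m\<in>W. \<Sum>i\<in>J. if m \<in> T i then a m else 0)" by (rule sum.swap)
    also have "\<dots> \<le> (\<Sum>m\<in>W. 3 * a m)"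
    proof (rule sum_mono)
      fix m assume "m \<in> W"
      have "(\<Sum>i\<in>J. if m \<in> T i then a m else 0) = (\<Sum>i\<in>{i\<in>J. m \<in> T i}. a m)"
        using J by (rule sum.inter_filter[symmetric])
      also have "\<dots> = real (card {i\<in>J. m \<in> T i}) * a m" by simp
      also have "\<dots> \<le> real (card {m div N - 1..m div N + 1}) * a m"
      proof (intro mult_right_mono a0 of_nat_mono card_mono)
        show "{i \<in> J. m \<in> T i} \<subseteq> {m div N - 1..m div N + 1}"
        proof clarify
          fix i assume "m \<in> T i"
          then have "(i - 1) * N \<le> m" "m < (i + 2) * N" by (auto simp: T_def)
          moreover have "m = (m div N) * N + m mod N" by simp
          moreover have "0 \<le> m mod N" "m mod N < N" using N by auto
          ultimately have "(i - 1) * N < (m div N + 1) * N" "(m div N) * N < (i + 2) * N"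
            unfolding distrib_right by linarith+
          then have "i - 1 < m div N + 1" "m div N < i + 2"
            using N by (simp_all add: mult_less_cancel_right)
          then show "i \<in> {m div N - 1..m div N + 1}" by auto
        qed
      qed auto
      finally show "(\<Sum>i\<in>J. if m \<in> T i then a m else 0) \<le> 3 * a m" by simp
    qed
    also have "\<dots> = 3 * (\<Sum>m\<in>W. (cmod (f m))\<^sup>2 * w m)" by (simp add: sum_distrib_left a_def f'_def)
    finally show ?thesis .
  qed
  have sb: "(\<Sum>i\<in>J. \<Sum>n\<in>T i. b i n) \<le> (\<Sum>n\<in>W. (cmod (g n))\<^sup>2 / w n)"
  proof -
    have "(\<Sum>i\<in>J. \<Sum>n\<in>T i. b i n) \<le> (\<Sum>i\<in>J. \<Sum>n\<in>{n\<in>W. n div N = i}. (cmod (g n))\<^sup>2 / w n)"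
    proof (rule sum_mono)
      fix i
      have "(\<Sum>n\<in>T i. b i n) = (\<Sum>n\<in>T i \<inter> {n\<in>W. n div N = i}. (cmod (g n))\<^sup>2 / w n)"
        using Tf by (intro sum.mono_neutral_cong_right) (auto simp: b_def gi_def)
      also have "\<dots> \<le> (\<Sum>n\<in>{n\<in>W. n div N = i}. (cmod (g n))\<^sup>2 / w n)"
        using W w0 by (intro sum_mono2) (auto intro!: divide_nonneg_nonneg less_imp_le[OF w0])
      finally show "(\<Sum>n\<in>T i. b i n) \<le> (\<Sum>n\<in>{n\<in>W. n div N = i}. (cmod (g n))\<^sup>2 / w n)" .
    qed
    also have "\<dots> = (\<Sum>n\<in>W. (cmod (g n))\<^sup>2 / w n)"
      using W J by (intro sum.group) (auto simp: J_def)
    finally show ?thesis .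
  qed
  define X where "X = (\<Sum>m\<in>W. (cmod (f m))\<^sup>2 * w m)"
  define Y where "Y = (\<Sum>n\<in>W. (cmod (g n))\<^sup>2 / w n)"
  have XY: "X \<ge> 0" "Y \<ge> 0" using less_imp_le[OF w0] by (auto simp: X_def Y_def intro!: sum_nonneg mult_nonneg_nonneg divide_nonneg_nonneg)
  have "(\<Sum>n\<in>W. \<Sum>m\<in>W. k n m * f m * g n)
     = (\<Sum>i\<in>J. \<Sum>n\<in>{n\<in>W. n div N = i}. \<Sum>m\<in>W. k n m * f m * g n)"
    using W J by (intro sum.group[symmetric]) (auto simp: J_def)
  also have "\<dots> = (\<Sum>i\<in>J. \<Sum>n\<in>T i. \<Sum>m\<in>T i. k n m * f' m * gi i n)" by (simp add: loc)
  finally have "cmod (\<Sum>n\<in>W. \<Sum>m\<in>W. k n m * f m * g n)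
     \<le> (\<Sum>i\<in>J. 9 * c * B * \<epsilon> powr (1/8) * (sqrt (\<Sum>m\<in>T i. a m) * sqrt (\<Sum>n\<in>T i. b i n)))"
    using each by (simp add: sum_norm_le)
  also have "\<dots> \<le> 9 * c * B * \<epsilon> powr (1/8) * (sqrt (\<Sum>i\<in>J. \<Sum>m\<in>T i. a m) * sqrt (\<Sum>i\<in>J. \<Sum>n\<in>T i. b i n))"
    unfolding sum_distrib_left[symmetric] using c B a0 b0
    by (intro mult_left_mono Cauchy_Schwarz_sqrt) (auto intro!: sum_nonneg)
  also have "\<dots> \<le> 9 * c * B * \<epsilon> powr (1/8) * (sqrt (3 * X) * sqrt Y)"
    using sa sb c B a0 b0 XY unfolding X_def[symmetric] Y_def[symmetric]
    by (intro mult_left_mono mult_mono real_sqrt_le_mono) (auto intro!: sum_nonneg)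
  also have "\<dots> = (9 * sqrt 3) * (c * B * \<epsilon> powr (1/8) * (sqrt X * sqrt Y))"
    by (simp add: real_sqrt_mult)
  also have "\<dots> \<le> 16 * (c * B * \<epsilon> powr (1/8) * (sqrt X * sqrt Y))"
  proof (rule mult_right_mono)
    have "sqrt 3 \<le> 16/9" by (rule real_le_lsqrt) (auto simp: power2_eq_square)
    then show "9 * sqrt 3 \<le> 16" by simp
  qed (use c B XY in auto)
  finally show "cmod (\<Sum>n\<in>W. \<Sum>m\<in>W. k n m * f m * g n)
     \<le> 16 * C powr (1/3) * B * \<epsilon> powr (1/8) * sqrt (\<Sum>m\<in>W. (cmod (f m))\<^sup>2 * w m) * sqrt (\<Sum>n\<in>W. (cmod (g n))\<^sup>2 / w n)"
    by (simp add: X_def Y_def c_def mult_ac)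
qed

section \<open>The maximal function\<close>

text \<open>A geometric series over an arbitrary set of exponents. It is used for the levels of the
  maximal function, and later for scales and for denominators.\<close>

lemma geometric_levels:
  fixes I :: "int set" and a \<gamma> :: real
  assumes "finite I" "\<gamma> > 0" "a \<ge> 0" "\<And>i. i \<in> I \<Longrightarrow> 2 powr i \<le> a"
  shows "(\<Sum>i\<in>I. 2 powr (\<gamma> * i)) \<le> a powr \<gamma> / (1 - 2 powr (-\<gamma>))"
proof -
  have r: "2 powr (-\<gamma>) < 1" using assms by (simp add: powr_less_one)
  show ?thesis
  proof (cases "I = {}")
    case True
    then show ?thesis using r by simp
  next
    case False
    define M where "M = Max I"
    have M: "M \<in> I" "\<And>i. i \<in> I \<Longrightarrow> i \<le> M" using False assms by (auto simp: M_def)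
    define \<rho> where "\<rho> = 2 powr (-\<gamma>)"
    have \<rho>: "0 < \<rho>" "\<rho> < 1" using r by (auto simp: \<rho>_def)
    have "(\<Sum>i\<in>I. 2 powr (\<gamma> * i)) = (\<Sum>i\<in>I. 2 powr (\<gamma> * M) * \<rho> ^ nat (M - i))"
    proof (rule sum.cong)
      fix i assume i: "i \<in> I"
      have "\<rho> ^ nat (M - i) = 2 powr (-\<gamma> * (M - i))"
        using M(2)[OF i] by (simp add: \<rho>_def powr_powr flip: powr_realpow)
      then have "2 powr (\<gamma> * M) * \<rho> ^ nat (M - i) = 2 powr (\<gamma> * M + -\<gamma> * (M - i))"
        by (simp only: powr_add)
      then show "2 powr (\<gamma> * i) = 2 powr (\<gamma> * M) * \<rho> ^ nat (M - i)" by (simp add: algebra_simps)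
    qed simp
    also have "\<dots> = 2 powr (\<gamma> * M) * (\<Sum>n\<in>(\<lambda>i. nat (M - i)) ` I. \<rho> ^ n)"
    proof (subst sum.reindex)
      show "inj_on (\<lambda>i. nat (M - i)) I" using M(2) by (auto simp: inj_on_def eq_nat_nat_iff)
    qed (simp add: sum_distrib_left)
    also have "\<dots> \<le> 2 powr (\<gamma> * M) * (1 / (1 - \<rho>))"
    proof (intro mult_left_mono)
      have "(\<Sum>n\<in>(\<lambda>i. nat (M - i)) ` I. \<rho> ^ n) \<le> (\<Sum>n. \<rho> ^ n)"
        using \<rho> assms by (intro sum_le_suminf) auto
      then show "(\<Sum>n\<in>(\<lambda>i. nat (M - i)) ` I. \<rho> ^ n) \<le> 1 / (1 - \<rho>)" using \<rho> by (simp add: suminf_geometric)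
    qed auto
    also have "\<dots> \<le> a powr \<gamma> * (1 / (1 - \<rho>))"
    proof (intro mult_right_mono)
      have "2 powr (\<gamma> * M) = (2 powr M) powr \<gamma>" by (simp add: powr_powr mult.commute)
      also have "\<dots> \<le> a powr \<gamma>" using assms(4)[OF M(1)] assms by (intro powr_mono2) auto
      finally show "2 powr (\<gamma> * M) \<le> a powr \<gamma>" .
    qed (use \<rho> in auto)
    finally show ?thesis by (simp add: \<rho>_def)
  qed
qed

text \<open>The one-sided weak type inequality needs no covering lemma: start at the leftmost point of
  \<open>E\<close>, discard the interval to its right that certifies it, and repeat. The intervals used in
  this way are disjoint.\<close>

lemma weak_type_right:
  fixes V :: "int \<Rightarrow> real"
  assumes W: "finite W" and V: "\<And>y. V y \<ge> 0" "\<And>y. y \<notin> W \<Longrightarrow> V y = 0" and l: "\<mu> > 0"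
    and E: "finite E" "\<And>x. x \<in> E \<Longrightarrow> \<exists>h\<ge>1. \<mu> * real_of_int h < (\<Sum>y\<in>{x..<x + h}. V y)"
      "\<And>x. x \<in> E \<Longrightarrow> a \<le> x"
  shows "\<mu> * real (card E) \<le> (\<Sum>y\<in>W \<inter> {a..}. V y)"
  using E
proof (induction "card E" arbitrary: E a rule: less_induct)
  case less
  show ?case
  proof (cases "E = {}")
    case True
    then show ?thesis using V by (auto intro: sum_nonneg)
  next
    case False
    define x where "x = Min E"
    have x: "x \<in> E" "\<And>y. y \<in> E \<Longrightarrow> x \<le> y" using False less.prems by (auto simp: x_def)
    obtain h where h: "h \<ge> 1" "\<mu> * real_of_int h < (\<Sum>y\<in>{x..<x + h}. V y)" using less.prems(2)[OF x(1)] by auto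
    define E' where "E' = {y\<in>E. x + h \<le> y}"
    have "x \<notin> E'" "E' \<subseteq> E" using h by (auto simp: E'_def)
    then have "E' \<subset> E" using x by blast
    then have cE: "card E' < card E" using less.prems by (simp add: psubset_card_mono)
    have IH: "\<mu> * real (card E') \<le> (\<Sum>y\<in>W \<inter> {x + h..}. V y)"
      using less.hyps[OF cE] less.prems by (auto simp: E'_def)
    have "E \<subseteq> E' \<union> {x..<x + h}" using x by (auto simp: E'_def)
    then have "card E \<le> card (E' \<union> {x..<x + h})" using less.prems by (intro card_mono) (auto simp: E'_def)
    also have "\<dots> \<le> card E' + card {x..<x + h}" by (rule card_Un_le)
    finally have "card E \<le> card E' + nat h" by simp
    then have "real (card E) \<le> real (card E') + real_of_int h" using h(1) by linarith
    then have "\<mu> * real (card E) \<le> \<mu> * (real (card E') + real_of_int h)" using l by simp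
    also have "\<dots> \<le> (\<Sum>y\<in>W \<inter> {x + h..}. V y) + (\<Sum>y\<in>{x..<x + h}. V y)"
      using IH h(2) by (simp add: distrib_left)
    also have "(\<Sum>y\<in>{x..<x + h}. V y) = (\<Sum>y\<in>W \<inter> {x..<x + h}. V y)"
      using V(2) by (intro sum.mono_neutral_right) auto
    also have "(\<Sum>y\<in>W \<inter> {x + h..}. V y) + \<dots> = (\<Sum>y\<in>(W \<inter> {x + h..}) \<union> (W \<inter> {x..<x + h}). V y)"
      using W by (intro sum.union_disjoint[symmetric]) auto
    also have "\<dots> \<le> (\<Sum>y\<in>W \<inter> {a..}. V y)"
      using W V(1) h(1) less.prems(3)[OF x(1)] by (intro sum_mono2) auto
    finally show ?thesis .
  qed
qed

lemma weak_type_left: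
  fixes V :: "int \<Rightarrow> real"
  assumes W: "finite W" and V: "\<And>y. V y \<ge> 0" "\<And>y. y \<notin> W \<Longrightarrow> V y = 0" and l: "\<mu> > 0"
    and E: "finite E" "\<And>x. x \<in> E \<Longrightarrow> \<exists>h\<ge>1. \<mu> * real_of_int h < (\<Sum>y\<in>{x - h<..x}. V y)"
  shows "\<mu> * real (card E) \<le> (\<Sum>y\<in>W. V y)"
proof -
  have refl: "(\<Sum>y\<in>{x - h<..x}. V y) = (\<Sum>y\<in>{-x..<-x + h}. V (-y))" for x h
    by (rule sum.reindex_bij_witness[of _ uminus uminus]) auto
  define m where "m = Min (insert 0 (uminus ` E))"
  have m: "\<And>x. x \<in> uminus ` E \<Longrightarrow> m \<le> x" using E(1) by (simp add: m_def)
  have "\<mu> * real (card (uminus ` E)) \<le> (\<Sum>y\<in>uminus ` W \<inter> {m..}. V (-y))"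
  proof (rule weak_type_right[OF _ _ _ l])
    fix x assume "x \<in> uminus ` E"
    then show "\<exists>h\<ge>1. \<mu> * real_of_int h < (\<Sum>y\<in>{x..<x + h}. V (-y))"
      using E(2)[of "-x"] refl[of "-x"] by auto
  next
    fix y assume "y \<notin> uminus ` W"
    then have "-y \<notin> W" by (metis image_eqI minus_minus)
    then show "V (-y) = 0" using V by auto
  qed (use W V E m in auto)
  also have "\<dots> \<le> (\<Sum>y\<in>uminus ` W. V (-y))" using W V by (intro sum_mono2) auto
  also have "\<dots> = (\<Sum>y\<in>W. V y)" by (subst sum.reindex) (auto simp: inj_on_def)
  also have "card (uminus ` E) = card E" by (intro card_image) (auto simp: inj_on_def)
  finally show ?thesis .
qed

text \<open>If the average over an interval around \<open>x\<close> is large, then so is the average over the part on one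
  side of \<open>x\<close>, up to a factor two.\<close>

lemma weak_type:
  fixes V :: "int \<Rightarrow> real"
  assumes W: "finite W" and V: "\<And>y. V y \<ge> 0" "\<And>y. y \<notin> W \<Longrightarrow> V y = 0" and l: "\<mu> > 0"
    and E: "finite E" "\<And>x. x \<in> E \<Longrightarrow> \<exists>a b. a \<le> x \<and> x < b \<and> \<mu> < avg {a..<b} V"
  shows "\<mu> * real (card E) \<le> 4 * (\<Sum>y\<in>W. V y)"
proof -
  define E1 where "E1 = {x\<in>E. \<exists>h\<ge>1. \<mu> / 2 * real_of_int h < (\<Sum>y\<in>{x..<x + h}. V y)}"
  define E2 where "E2 = {x\<in>E. \<exists>h\<ge>1. \<mu> / 2 * real_of_int h < (\<Sum>y\<in>{x - h<..x}. V y)}"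
  have sub: "E \<subseteq> E1 \<union> E2"
  proof
    fix x assume x: "x \<in> E"
    then obtain a b where ab: "a \<le> x" "x < b" "\<mu> < avg {a..<b} V" using E(2) by blast
    then have s: "\<mu> * real_of_int (b - a) < (\<Sum>y\<in>{a..<b}. V y)"
      by (simp add: avg_def field_simps)
    have "(\<Sum>y\<in>{a..<b}. V y) \<le> (\<Sum>y\<in>{x..<b}. V y) + (\<Sum>y\<in>{a..x}. V y)"
    proof -
      have "{a..<b} = {x..<b} \<union> {a..<x}" using ab by auto
      then have "(\<Sum>y\<in>{a..<b}. V y) = (\<Sum>y\<in>{x..<b}. V y) + (\<Sum>y\<in>{a..<x}. V y)"
        by (simp add: sum.union_disjoint)
      also have "(\<Sum>y\<in>{a..<x}. V y) \<le> (\<Sum>y\<in>{a..x}. V y)" using V by (intro sum_mono2) auto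
      finally show ?thesis by simp
    qed
    moreover have "(\<Sum>y\<in>{x - (x - a + 1)<..x}. V y) = (\<Sum>y\<in>{a..x}. V y)"
      "(\<Sum>y\<in>{x..<x + (b - x)}. V y) = (\<Sum>y\<in>{x..<b}. V y)"
      by (intro sum.cong; auto)+
    ultimately have "\<mu> * real_of_int (b - a) < (\<Sum>y\<in>{x..<x + (b - x)}. V y) + (\<Sum>y\<in>{x - (x - a + 1)<..x}. V y)"
      using s by linarith
    moreover have "\<mu> / 2 * real_of_int (b - x) + \<mu> / 2 * real_of_int (x - a + 1) \<le> \<mu> * real_of_int (b - a)"
    proof -
      have "real_of_int (b - x) + real_of_int (x - a + 1) \<le> 2 * real_of_int (b - a)"
      proof -
        have "(b - x) + (x - a + 1) \<le> 2 * (b - a)" using ab(1,2) by (simp add: algebra_simps)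
        then show ?thesis by linarith
      qed
      then have "\<mu> / 2 * (real_of_int (b - x) + real_of_int (x - a + 1)) \<le> \<mu> / 2 * (2 * real_of_int (b - a))"
        using l by (intro mult_left_mono) auto
      moreover have "\<mu> / 2 * (2 * real_of_int (b - a)) = \<mu> * real_of_int (b - a)" by simp
      ultimately show ?thesis by (simp only: distrib_left)
    qed
    ultimately consider "\<mu> / 2 * real_of_int (b - x) < (\<Sum>y\<in>{x..<x + (b - x)}. V y)"
      | "\<mu> / 2 * real_of_int (x - a + 1) < (\<Sum>y\<in>{x - (x - a + 1)<..x}. V y)" by linarith
    then show "x \<in> E1 \<union> E2"
    proof cases
      case 1
      then have "x \<in> E1" using x ab unfolding E1_def by (auto intro!: exI[of _ "b - x"])
      then show ?thesis by simp
    next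
      case 2
      then have "x \<in> E2" using x ab unfolding E2_def by (auto intro!: exI[of _ "x - a + 1"])
      then show ?thesis by simp
    qed
  qed
  have f: "finite E1" "finite E2" using E by (auto simp: E1_def E2_def)
  have "card E \<le> card E1 + card E2" using sub f by (meson card_Un_le card_mono finite_UnI le_trans)
  then have "\<mu> * real (card E) \<le> \<mu> * (real (card E1) + real (card E2))" using l by simp
  moreover define m where "m = Min (insert 0 E1)"
  have m: "\<And>x. x \<in> E1 \<Longrightarrow> m \<le> x" using f(1) by (simp add: m_def)
  have "\<mu> / 2 * real (card E1) \<le> (\<Sum>y\<in>W \<inter> {m..}. V y)"
    by (rule weak_type_right[OF W V]) (use l f m in \<open>auto simp: E1_def\<close>)
  moreover have "(\<Sum>y\<in>W \<inter> {m..}. V y) \<le> (\<Sum>y\<in>W. V y)" using W V by (intro sum_mono2) auto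
  moreover have "\<mu> / 2 * real (card E2) \<le> (\<Sum>y\<in>W. V y)"
    by (rule weak_type_left[OF W V]) (use l f in \<open>auto simp: E2_def\<close>)
  ultimately show ?thesis by (simp add: distrib_left)
qed

definition max_const :: "real \<Rightarrow> real" where
  "max_const s = 8 * 2 powr s * 2 powr (s - 1) / (1 - 2 powr (1 - s))"

lemma max_const_nonneg: "s > 1 \<Longrightarrow> max_const s \<ge> 0"
  by (simp add: max_const_def powr_less_one less_imp_le)

text \<open>The uncentred maximal function over intervals of \<open>\<int>\<close>. The supremum is that of a bounded set
  if \<open>V\<close> is nonnegative with finite support.\<close>

definition maxfn :: "(int \<Rightarrow> real) \<Rightarrow> int \<Rightarrow> real" where
  "maxfn V x = (SUP (a, b)\<in>{(a, b). a \<le> x \<and> x < b}. avg {a..<b} V)"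

context
  fixes V :: "int \<Rightarrow> real" and W :: "int set"
  assumes W: "finite W" and V: "\<And>y. V y \<ge> 0" "\<And>y. y \<notin> W \<Longrightarrow> V y = 0"
begin

lemma avg_le_sum: "a < b \<Longrightarrow> avg {a..<b} V \<le> (\<Sum>y\<in>W. V y)"
proof -
  assume ab: "a < b"
  have "(\<Sum>y\<in>{a..<b}. V y) = (\<Sum>y\<in>{a..<b} \<inter> W. V y)" using V(2) by (intro sum.mono_neutral_right) auto
  also have "\<dots> \<le> (\<Sum>y\<in>W. V y)" using W V(1) by (intro sum_mono2) auto
  finally have "(\<Sum>y\<in>{a..<b}. V y) \<le> (\<Sum>y\<in>W. V y)" .
  moreover have "avg {a..<b} V \<le> (\<Sum>y\<in>{a..<b}. V y)"
  proof -
    have "1 / real (card {a..<b}) \<le> 1" using ab by auto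
    then show ?thesis unfolding avg_def using V(1) by (intro mult_left_le_one_le sum_nonneg) auto
  qed
  ultimately show ?thesis by linarith
qed

lemma maxfn_bdd: "bdd_above ((\<lambda>(a, b). avg {a..<b} V) ` {(a, b). a \<le> x \<and> x < b})"
  by (rule bdd_aboveI2[of _ _ "\<Sum>y\<in>W. V y"]) (use avg_le_sum in auto)

lemma avg_le_maxfn: "a \<le> x \<Longrightarrow> x < b \<Longrightarrow> avg {a..<b} V \<le> maxfn V x"
  unfolding maxfn_def using cSUP_upper[OF _ maxfn_bdd, of "(a, b)" x] by auto

lemma maxfn_nonneg: "maxfn V x \<ge> 0"
  using avg_le_maxfn[of x x "x + 1"] avg_nonneg[of "{x..<x + 1}" V] V by force

lemma less_maxfnD: "\<mu> < maxfn V x \<Longrightarrow> \<exists>a b. a \<le> x \<and> x < b \<and> \<mu> < avg {a..<b} V"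
proof -
  assume less: "\<mu> < maxfn V x"
  have ne: "(x, x + 1) \<in> {(a, b). a \<le> x \<and> x < b}" by auto
  show ?thesis
  proof (rule ccontr)
    assume "\<not> ?thesis"
    then have "(case p of (a, b) \<Rightarrow> avg {a..<b} V) \<le> \<mu>" if "p \<in> {(a, b). a \<le> x \<and> x < b}" for p
      using that by (cases p) (simp, metis not_le)
    then have "maxfn V x \<le> \<mu>" unfolding maxfn_def using ne by (intro cSUP_least) blast+
    with less show False by simp
  qed
qed

text \<open>Only the part of \<open>V\<close> above half the level contributes to a level set; this improves the
  weak type inequality enough to be summed over dyadic levels.\<close>

lemma weak_type_truncated:
  assumes l: "\<mu> > 0" and E: "finite E" "\<And>x. x \<in> E \<Longrightarrow> \<mu> < maxfn V x"
  shows "\<mu> * real (card E) \<le> 8 * (\<Sum>y\<in>{y\<in>W. \<mu> / 2 < V y}. V y)"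
proof -
  define V2 where "V2 y = (if \<mu> / 2 < V y then V y else 0)" for y
  have "\<mu> / 2 * real (card E) \<le> 4 * (\<Sum>y\<in>W. V2 y)"
  proof (rule weak_type[OF W _ _ _ E(1)])
    fix x assume x: "x \<in> E"
    obtain a b where ab: "a \<le> x" "x < b" "\<mu> < avg {a..<b} V" using less_maxfnD[OF E(2)[OF x]] by blast
    have "(\<Sum>y\<in>{a..<b}. V y) \<le> (\<Sum>y\<in>{a..<b}. V2 y + \<mu> / 2)"
      using l by (intro sum_mono) (auto simp: V2_def)
    then have "avg {a..<b} V \<le> avg {a..<b} (\<lambda>y. V2 y + \<mu> / 2)"
      unfolding avg_def by (intro mult_left_mono) auto
    also have "\<dots> = avg {a..<b} V2 + \<mu> / 2"
    proof -
      have "real (card {a..<b}) > 0" "a < b" using ab(1,2) by auto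
      then show ?thesis unfolding avg_def sum.distrib
        by (simp add: distrib_left del: card_atLeastLessThan_int)
    qed
    finally have "avg {a..<b} V \<le> avg {a..<b} V2 + \<mu> / 2" .
    then have "\<mu> / 2 < avg {a..<b} V2" using ab by linarith
    then show "\<exists>a b. a \<le> x \<and> x < b \<and> \<mu> / 2 < avg {a..<b} V2" using ab by blast
  qed (use V l in \<open>auto simp: V2_def\<close>)
  also have "(\<Sum>y\<in>W. V2 y) = (\<Sum>y\<in>{y\<in>W. \<mu> / 2 < V y}. V y)"
    unfolding V2_def using W by (rule sum.inter_filter[symmetric])
  finally show ?thesis by simp
qed

lemma maximal_strong_type:
  assumes s: "s > 1" and Y: "finite Y"
  shows "(\<Sum>x\<in>Y. maxfn V x powr s) \<le> max_const s * (\<Sum>y\<in>W. V y powr s)"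
proof -
  define Y' where "Y' = {x\<in>Y. maxfn V x > 0}"
  \<comment> \<open>The dyadic level of the maximal function at \<open>x\<close>. Choosing it for each \<open>x\<close> makes the set of levels finite.\<close>
  define lv where "lv x = \<lceil>log 2 (maxfn V x)\<rceil> - 1" for x
  have Y': "finite Y'" using Y by (simp add: Y'_def)
  have lv: "2 powr (lv x) < maxfn V x" "maxfn V x \<le> 2 powr (lv x + 1)" if "x \<in> Y'" for x
  proof -
    have p: "maxfn V x > 0" using that by (simp add: Y'_def)
    have "real_of_int (lv x) < log 2 (maxfn V x)" unfolding lv_def by linarith
    then show "2 powr (lv x) < maxfn V x" using p by (simp add: less_log_iff)
    have "log 2 (maxfn V x) \<le> real_of_int (lv x + 1)" unfolding lv_def by linarith
    then show "maxfn V x \<le> 2 powr (lv x + 1)" using p by (simp add: log_le_iff)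
  qed
  define I where "I = lv ` Y'"
  have I: "finite I" using Y' by (simp add: I_def)
  define q where "q i = (\<Sum>y\<in>{y\<in>W. 2 powr (real_of_int i) / 2 < V y}. V y)" for i :: int
  have "(\<Sum>x\<in>Y. maxfn V x powr s) = (\<Sum>x\<in>Y'. maxfn V x powr s)"
    using Y maxfn_nonneg by (intro sum.mono_neutral_right) (auto simp: Y'_def order.order_iff_strict)
  also have "\<dots> \<le> (\<Sum>x\<in>Y'. 2 powr ((real_of_int (lv x) + 1) * s))"
  proof (rule sum_mono)
    fix x assume "x \<in> Y'"
    then have "maxfn V x powr s \<le> (2 powr (lv x + 1)) powr s"
      using s lv(2)[of x] maxfn_nonneg by (intro powr_mono2) auto
    then show "maxfn V x powr s \<le> 2 powr ((real_of_int (lv x) + 1) * s)" by (simp add: powr_powr)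
  qed
  also have "\<dots> = (\<Sum>i\<in>I. \<Sum>x\<in>{x\<in>Y'. lv x = i}. 2 powr ((real_of_int (lv x) + 1) * s))"
    using Y' I by (intro sum.group[symmetric]) (auto simp: I_def)
  also have "\<dots> = (\<Sum>i\<in>I. real (card {x\<in>Y'. lv x = i}) * 2 powr ((real_of_int i + 1) * s))"
    by (intro sum.cong) auto
  also have "\<dots> \<le> (\<Sum>i\<in>I. 8 * 2 powr (- real_of_int i) * q i * 2 powr ((real_of_int i + 1) * s))"
  proof (intro sum_mono mult_right_mono)
    fix i assume "i \<in> I"
    have "2 powr (real_of_int i) * real (card {x\<in>Y'. lv x = i}) \<le> 8 * q i"
      unfolding q_def using Y' lv by (intro weak_type_truncated) auto
    then have "2 powr (- real_of_int i) * (2 powr (real_of_int i) * real (card {x\<in>Y'. lv x = i})) \<le> 2 powr (- real_of_int i) * (8 * q i)"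
      by (intro mult_left_mono) auto
    moreover have "2 powr (- real_of_int i) * (2 powr (real_of_int i) * z) = z" for z
      by (simp add: powr_minus)
    ultimately show "real (card {x\<in>Y'. lv x = i}) \<le> 8 * 2 powr (- real_of_int i) * q i" by simp
  qed auto
  also have "\<dots> = (\<Sum>i\<in>I. \<Sum>y\<in>W. 8 * 2 powr s * (if 2 powr (real_of_int i) / 2 < V y then V y * 2 powr ((s - 1) * real_of_int i) else 0))"
  proof (rule sum.cong)
    fix i
    have e: "2 powr (- real_of_int i) * 2 powr ((real_of_int i + 1) * s) = 2 powr s * 2 powr ((s - 1) * real_of_int i)"
      unfolding powr_add[symmetric] by (simp add: algebra_simps)
    have "8 * 2 powr (- real_of_int i) * q i * 2 powr ((real_of_int i + 1) * s) = 8 * (2 powr (- real_of_int i) * 2 powr ((real_of_int i + 1) * s)) * q i"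
      by simp
    also have "\<dots> = (\<Sum>y\<in>{y\<in>W. 2 powr (real_of_int i) / 2 < V y}. 8 * 2 powr s * (V y * 2 powr ((s - 1) * real_of_int i)))"
      unfolding e q_def by (simp add: sum_distrib_left mult_ac)
    also have "\<dots> = (\<Sum>y\<in>W. if 2 powr (real_of_int i) / 2 < V y then 8 * 2 powr s * (V y * 2 powr ((s - 1) * real_of_int i)) else 0)"
      using W by (rule sum.inter_filter)
    finally show "8 * 2 powr (- real_of_int i) * q i * 2 powr ((real_of_int i + 1) * s)
      = (\<Sum>y\<in>W. 8 * 2 powr s * (if 2 powr (real_of_int i) / 2 < V y then V y * 2 powr ((s - 1) * real_of_int i) else 0))"
      by (simp add: if_distrib cong: if_cong)
  qed simp
  also have "\<dots> = (\<Sum>y\<in>W. \<Sum>i\<in>I. 8 * 2 powr s * (if 2 powr (real_of_int i) / 2 < V y then V y * 2 powr ((s - 1) * real_of_int i) else 0))"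
    by (rule sum.swap)
  also have "\<dots> \<le> (\<Sum>y\<in>W. 8 * 2 powr s * 2 powr (s - 1) / (1 - 2 powr (1 - s)) * V y powr s)"
  proof (rule sum_mono)
    fix y
    have "(\<Sum>i\<in>I. if 2 powr (real_of_int i) / 2 < V y then V y * 2 powr ((s - 1) * real_of_int i) else 0)
       = V y * (\<Sum>i\<in>{i\<in>I. 2 powr (real_of_int i) / 2 < V y}. 2 powr ((s - 1) * real_of_int i))"
      unfolding sum_distrib_left using I by (rule sum.inter_filter[symmetric])
    also have "\<dots> \<le> V y * ((2 * V y) powr (s - 1) / (1 - 2 powr (-(s - 1))))"
      using I s V(1)[of y] by (intro mult_left_mono geometric_levels) auto
    also have "\<dots> = 2 powr (s - 1) / (1 - 2 powr (1 - s)) * (V y * V y powr (s - 1))"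
      using V(1)[of y] by (simp add: powr_mult)
    also have "V y * V y powr (s - 1) = V y powr s"
      using V(1)[of y] by (cases "V y = 0") (auto simp: powr_diff)
    finally have "8 * 2 powr s * (\<Sum>i\<in>I. if 2 powr (real_of_int i) / 2 < V y then V y * 2 powr ((s - 1) * real_of_int i) else 0)
       \<le> 8 * 2 powr s * (2 powr (s - 1) / (1 - 2 powr (1 - s)) * V y powr s)" by (intro mult_left_mono) auto
    then show "(\<Sum>i\<in>I. 8 * 2 powr s * (if 2 powr (real_of_int i) / 2 < V y then V y * 2 powr ((s - 1) * real_of_int i) else 0))
       \<le> 8 * 2 powr s * 2 powr (s - 1) / (1 - 2 powr (1 - s)) * V y powr s"
      by (simp add: sum_distrib_left)
  qed
  finally show ?thesis by (simp only: sum_distrib_left max_const_def)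
qed

end

section \<open>A stopping-time argument for Calderon-Zygmund kernels\<close>

text \<open>The maximal dyadic descendants of \<open>{c..<c + 2 ^ k}\<close> in which \<open>E\<close> has density above
  \<open>1/4\<close>, each given by its left end and the exponent of its length.\<close>

fun stopping :: "int set \<Rightarrow> nat \<Rightarrow> int \<Rightarrow> (int \<times> nat) set" where
  "stopping E 0 c = (if c \<in> E then {(c, 0)} else {})"
| "stopping E (Suc k) c = (if 4 * card (E \<inter> {c..<c + 2 ^ Suc k}) > 2 ^ Suc k then {(c, Suc k)}
     else stopping E k c \<union> stopping E k (c + 2 ^ k))"

lemma finite_stopping: "finite (stopping E k c)"
  by (induction k arbitrary: c) auto

lemma stopping_range:
  "(c', k') \<in> stopping E k c \<Longrightarrow> k' \<le> k \<and> c \<le> c' \<and> c' + 2 ^ k' \<le> c + 2 ^ k"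
proof (induction k arbitrary: c)
  case (Suc k)
  have pw: "(2::int) ^ Suc k = 2 ^ k + 2 ^ k" "(0::int) < 2 ^ k" by auto
  show ?case
  proof (cases "4 * card (E \<inter> {c..<c + 2 ^ Suc k}) > 2 ^ Suc k")
    case False
    then consider "(c', k') \<in> stopping E k c" | "(c', k') \<in> stopping E k (c + 2 ^ k)" using Suc.prems by auto
    then show ?thesis using Suc.IH pw by cases (smt (verit) le_Suc_eq)+
  qed (use Suc.prems in auto)
qed (auto split: if_splits)

lemma stopping_covers: "E \<inter> {c..<c + 2 ^ k} \<subseteq> (\<Union>(c', k')\<in>stopping E k c. {c'..<c' + 2 ^ k'})"
proof (induction k arbitrary: c)
  case (Suc k)
  have "{c..<c + 2 ^ Suc k} = {c..<c + 2 ^ k} \<union> {c + 2 ^ k..<(c + 2 ^ k) + 2 ^ k}" by auto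
  then show ?case using Suc[of c] Suc[of "c + 2 ^ k"] by auto
qed auto

lemma stopping_disjoint:
  "disjoint_family_on (\<lambda>(c', k'). {c'..<c' + 2 ^ k'}) (stopping E k c)"
proof (induction k arbitrary: c)
  case (Suc k)
  show ?case
  proof (cases "4 * card (E \<inter> {c..<c + 2 ^ Suc k}) > 2 ^ Suc k")
    case False
    have l: "x \<in> stopping E k c \<Longrightarrow> (case x of (c', k') \<Rightarrow> {c'..<c' + 2 ^ k'}) \<subseteq> {c..<c + 2 ^ k}" for x c
      using stopping_range[of "fst x" "snd x" E k c] by (cases x) auto
    have d: "{c..<c + 2 ^ k} \<inter> {c + 2 ^ k..<(c + 2 ^ k) + 2 ^ k} = {}" by auto
    have st: "stopping E (Suc k) c = stopping E k c \<union> stopping E k (c + 2 ^ k)" using False by simp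
    show ?thesis unfolding st disjoint_family_on_def
    proof (intro ballI impI)
      fix x y assume xy: "x \<in> stopping E k c \<union> stopping E k (c + 2 ^ k)" "y \<in> stopping E k c \<union> stopping E k (c + 2 ^ k)" "x \<noteq> y"
      let ?f = "\<lambda>(c', k'). {c'..<c' + 2 ^ k'} :: int set"
      consider "x \<in> stopping E k c" "y \<in> stopping E k c"
        | "x \<in> stopping E k (c + 2 ^ k)" "y \<in> stopping E k (c + 2 ^ k)"
        | "x \<in> stopping E k c" "y \<in> stopping E k (c + 2 ^ k)"
        | "y \<in> stopping E k c" "x \<in> stopping E k (c + 2 ^ k)" using xy by blast
      then show "?f x \<inter> ?f y = {}"
      proof cases
        case 1 then show ?thesis using Suc[of c] xy(3) unfolding disjoint_family_on_def by blast
      next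
        case 2 then show ?thesis using Suc[of "c + 2 ^ k"] xy(3) unfolding disjoint_family_on_def by blast
      next
        case 3 then show ?thesis using l[of x c] l[of y "c + 2 ^ k"] d by blast
      next
        case 4 then show ?thesis using l[of y c] l[of x "c + 2 ^ k"] d by blast
      qed
    qed
  qed (simp add: disjoint_family_on_def)
qed (simp add: disjoint_family_on_def)

lemma stopping_dense: "(c', k') \<in> stopping E k c \<Longrightarrow> 2 ^ k' \<le> 4 * card (E \<inter> {c'..<c' + 2 ^ k'})"
proof (induction k arbitrary: c)
  case 0
  then have "c \<in> E" "c' = c" "k' = 0" by (auto split: if_splits)
  moreover have "E \<inter> {c..<c + 1} = {c}" using \<open>c \<in> E\<close> by auto
  ultimately show ?case by simp
next
  case (Suc k)
  then show ?case by (cases "4 * card (E \<inter> {c..<c + 2 ^ Suc k}) > 2 ^ Suc k") auto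
qed

text \<open>If the top interval is not selected, then every selected one has a parent of density at most
  \<open>1/4\<close>, so it cannot be contained in \<open>E\<close>.\<close>

lemma stopping_sparse:
  assumes "4 * card (E \<inter> {c..<c + 2 ^ k}) \<le> 2 ^ k" "(c', k') \<in> stopping E k c"
  shows "k' < k \<and> 2 * card (E \<inter> {c'..<c' + 2 ^ k'}) \<le> 2 ^ k'"
  using assms
proof (induction k arbitrary: c)
  case 0
  then have "c \<in> E" by (auto split: if_splits)
  then have "E \<inter> {c..<c + 1} = {c}" by auto
  then show ?case using 0 by simp
next
  case (Suc k)
  have half: "2 * card (E \<inter> {d..<d + 2 ^ k}) \<le> 2 ^ k" if "d = c \<or> d = c + 2 ^ k" for d
  proof -
    have "card (E \<inter> {d..<d + 2 ^ k}) \<le> card (E \<inter> {c..<c + 2 ^ Suc k})"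
      using that by (intro card_mono) auto
    then show ?thesis using Suc.prems(1) by simp
  qed
  have "(c', k') \<in> stopping E k c \<union> stopping E k (c + 2 ^ k)" using Suc.prems by (simp split: if_splits)
  then obtain d where d: "d = c \<or> d = c + 2 ^ k" "(c', k') \<in> stopping E k d" by auto
  show ?case
  proof (cases "4 * card (E \<inter> {d..<d + 2 ^ k}) \<le> 2 ^ k")
    case True
    then show ?thesis using Suc.IH[OF True d(2)] by simp
  next
    case False
    then have "stopping E k d = {(d, k)}" 
    proof (cases k)
      case 0
      then have "E \<inter> {d..<d + 1} \<noteq> {}" using False by (auto simp: card_eq_0_iff)
      then have "d \<in> E" by auto
      then show ?thesis using 0 by simp
    qed auto
    then show ?thesis using d half[OF d(1)] by simp
  qed
qed

lemma stopping_total_length: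
  assumes "finite E"
  shows "(\<Sum>(c', k')\<in>stopping E k c. 2 ^ k') \<le> 4 * card E"
proof -
  have "(\<Sum>(c', k')\<in>stopping E k c. 2 ^ k') \<le> (\<Sum>(c', k')\<in>stopping E k c. 4 * card (E \<inter> {c'..<c' + 2 ^ k'}))"
    using stopping_dense by (intro sum_mono) auto
  also have "\<dots> = 4 * (\<Sum>i\<in>stopping E k c. card (case i of (c', k') \<Rightarrow> E \<inter> {c'..<c' + 2 ^ k'}))"
    by (simp add: sum_distrib_left case_prod_unfold)
  also have "(\<Sum>i\<in>stopping E k c. card (case i of (c', k') \<Rightarrow> E \<inter> {c'..<c' + 2 ^ k'}))
     = card (\<Union>i\<in>stopping E k c. case i of (c', k') \<Rightarrow> E \<inter> {c'..<c' + 2 ^ k'})"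
    using stopping_disjoint[of E k c] finite_stopping[of E k c]
    by (intro card_UN_disjoint[symmetric]) (fastforce simp: disjoint_family_on_def)+
  also have "\<dots> \<le> card E" using assms by (intro card_mono) auto
  finally show ?thesis by simp
qed

text \<open>The tail \<open>L / d\<^sup>2\<close> is a convergent sum, over the dyadic sizes of \<open>d\<close>, of multiples of
  normalised indicators of intervals around \<open>{c..<c + L}\<close>.\<close>

lemma tail_average:
  fixes V :: "int \<Rightarrow> real" and d :: "int \<Rightarrow> int"
  assumes Z: "finite Z" and L: "L \<ge> 1" and V: "\<And>m. V m \<ge> 0" and \<mu>: "\<mu> \<ge> 0"
    and d: "\<And>m. m \<in> Z \<Longrightarrow> L < d m"
    and dR: "\<And>m R. m \<in> Z \<Longrightarrow> d m \<le> R \<Longrightarrow> m \<in> {c - R..<c + L + R}"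
    and avg: "\<And>R. R \<ge> 0 \<Longrightarrow> avg {c - R..<c + L + R} V \<le> \<mu>"
  shows "(\<Sum>m\<in>Z. real_of_int L / (real_of_int (d m))\<^sup>2 * V m) \<le> 12 * \<mu>"
proof -
  define n where "n = nat (Max (insert 1 (d ` Z)))"
  have dn: "d m \<le> 2 ^ n * L" if "m \<in> Z" for m
  proof -
    have "d m \<le> int n" using Z that by (auto simp: n_def intro!: Max_ge_iff[THEN iffD2])
    also have "int n \<le> 2 ^ n" by (metis of_nat_le_iff of_nat_numeral of_nat_power less_exp less_imp_le)
    also have "\<dots> \<le> 2 ^ n * L" using L by simp
    finally show ?thesis .
  qed
  define S where "S i = {c - 2 ^ (i + 1) * L..<c + L + 2 ^ (i + 1) * L}" for i :: nat
  have pt: "real_of_int L / (real_of_int (d m))\<^sup>2 \<le> (\<Sum>i<n. if m \<in> S i then 1 / (4 ^ i * real_of_int L) else 0)"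
    if m: "m \<in> Z" for m
  proof -
    define i where "i = (LEAST i. d m \<le> 2 ^ i * L)"
    have i1: "d m \<le> 2 ^ i * L" unfolding i_def using dn[OF m] by (rule LeastI)
    have "i \<noteq> 0" using i1 d[OF m] by (metis mult_1 not_less power_0)
    then obtain i' where i': "i = Suc i'" by (cases i) auto
    have "\<not> d m \<le> 2 ^ i' * L" using i' not_less_Least[of i' "\<lambda>i. d m \<le> 2 ^ i * L"] unfolding i_def by auto
    then have lo: "2 ^ i' * L < d m" by simp
    have "i \<le> n" unfolding i_def using dn[OF m] by (rule Least_le)
    then have "i' < n" using i' by simp
    have mS: "m \<in> S i'" using dR[OF m, of "2 ^ (i' + 1) * L"] i1 by (simp add: S_def i')
    have dp: "real_of_int (d m) > 0" using d[OF m] L by simp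
    have "2 ^ i' * real_of_int L \<le> real_of_int (d m)" using lo by (metis less_imp_le of_int_le_iff of_int_mult of_int_numeral of_int_power)
    then have "(2 ^ i' * real_of_int L)\<^sup>2 \<le> (real_of_int (d m))\<^sup>2" using L by (intro power_mono) auto
    then have "real_of_int L / (real_of_int (d m))\<^sup>2 \<le> real_of_int L / (2 ^ i' * real_of_int L)\<^sup>2"
      using L dp by (intro divide_left_mono mult_pos_pos) auto
    also have "\<dots> = 1 / (4 ^ i' * real_of_int L)"
      using L by (simp add: power2_eq_square field_simps power_mult_distrib[symmetric])
    also have "\<dots> = (\<Sum>i\<in>{i'}. if m \<in> S i then 1 / (4 ^ i * real_of_int L) else 0)" using mS by simp
    also have "\<dots> \<le> (\<Sum>i<n. if m \<in> S i then 1 / (4 ^ i * real_of_int L) else 0)"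
      using \<open>i' < n\<close> L by (intro sum_mono2) auto
    finally show ?thesis .
  qed
  have "(\<Sum>m\<in>Z. real_of_int L / (real_of_int (d m))\<^sup>2 * V m)
     \<le> (\<Sum>m\<in>Z. (\<Sum>i<n. if m \<in> S i then 1 / (4 ^ i * real_of_int L) else 0) * V m)"
    by (intro sum_mono mult_right_mono pt V)
  also have "\<dots> = (\<Sum>i<n. \<Sum>m\<in>Z. (if m \<in> S i then 1 / (4 ^ i * real_of_int L) * V m else 0))"
    unfolding sum_distrib_right by (subst sum.swap) (intro sum.cong refl, auto)
  also have "\<dots> \<le> (\<Sum>i<n. 6 * \<mu> * (1/2) ^ i)"
  proof (rule sum_mono)
    fix i
    have len: "real (card (S i)) \<le> 6 * 2 ^ i * real_of_int L"
    proof -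
      have "int (card (S i)) = L + 2 * (2 ^ (i + 1) * L)" using L by (simp add: S_def)
      also have "\<dots> \<le> 2 ^ (i + 1) * L + 2 * (2 ^ (i + 1) * L)"
        using L one_le_power[of "2::int" "i + 1"] mult_right_mono[of 1 "2 ^ (i + 1)" L] by linarith
      also have "\<dots> = 6 * 2 ^ i * L" by simp
      finally have "real_of_int (int (card (S i))) \<le> real_of_int (6 * 2 ^ i * L)" by (simp only: of_int_le_iff)
      then show ?thesis by simp
    qed
    have Sne: "finite (S i)" "S i \<noteq> {}" using L by (auto simp: S_def intro: add_pos_nonneg)
    have "(\<Sum>m\<in>Z. (if m \<in> S i then 1 / (4 ^ i * real_of_int L) * V m else 0))
       = (\<Sum>m\<in>{m\<in>Z. m \<in> S i}. 1 / (4 ^ i * real_of_int L) * V m)"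
      using Z by (rule sum.inter_filter[symmetric])
    also have "\<dots> = 1 / (4 ^ i * real_of_int L) * (\<Sum>m\<in>{m\<in>Z. m \<in> S i}. V m)"
      by (rule sum_distrib_left[symmetric])
    also have "\<dots> \<le> 1 / (4 ^ i * real_of_int L) * (\<Sum>m\<in>S i. V m)"
      using L V Sne by (intro mult_left_mono sum_mono2) auto
    also have "(\<Sum>m\<in>S i. V m) = real (card (S i)) * avg (S i) V" using Sne by (rule sum_eq_card_avg)
    also have "1 / (4 ^ i * real_of_int L) * (real (card (S i)) * avg (S i) V)
       \<le> 1 / (4 ^ i * real_of_int L) * ((6 * 2 ^ i * real_of_int L) * \<mu>)"
      using len avg[of "2 ^ (i + 1) * L"] \<mu> L V
      by (intro mult_left_mono mult_mono) (auto simp: S_def intro!: avg_nonneg)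
    also have "\<dots> = 6 * \<mu> * (1/2) ^ i"
    proof -
      have "(4::real) ^ i = 2 ^ i * 2 ^ i" by (simp flip: power_mult_distrib)
      then show ?thesis using L by (simp add: field_simps power_divide)
    qed
    finally show "(\<Sum>m\<in>Z. (if m \<in> S i then 1 / (4 ^ i * real_of_int L) * V m else 0)) \<le> 6 * \<mu> * (1/2) ^ i" .
  qed
  also have "\<dots> = 6 * \<mu> * (\<Sum>i<n. (1/2) ^ i)" by (simp add: sum_distrib_left)
  also have "\<dots> \<le> 6 * \<mu> * 2"
  proof (intro mult_left_mono)
    have "(\<Sum>i<n. (1/2::real) ^ i) \<le> (\<Sum>i. (1/2) ^ i)" by (intro sum_le_suminf) auto
    then show "(\<Sum>i<n. (1/2::real) ^ i) \<le> 2" by (simp add: suminf_geometric)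
  qed (use \<mu> in auto)
  finally show ?thesis by simp
qed

lemma powr_add3_le:
  fixes a b c :: real
  assumes "a \<ge> 0" "b \<ge> 0" "c \<ge> 0" "p > 0"
  shows "(a + b + c) powr p \<le> 3 powr p * (a powr p + b powr p + c powr p)"
proof -
  define M where "M = max a (max b c)"
  have "(a + b + c) powr p \<le> (3 * M) powr p" using assms by (intro powr_mono2) (auto simp: M_def)
  also have "\<dots> = 3 powr p * M powr p" using assms by (intro powr_mult) 
  also have "M powr p \<le> a powr p + b powr p + c powr p"
    unfolding M_def max_def by auto
  finally show ?thesis by simp
qed

text \<open>The constant of the stopping-time bound below, for a kernel with regularity constant \<open>D\<close> whose
  operator on \<open>\<ell>\<^sup>p\<close> has a norm with \<open>p\<close>-th power at most \<open>A\<close>. The factors come from the far part on the stopping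
  intervals and from the height of the stopping condition.\<close>

definition cz_const :: "real \<Rightarrow> real \<Rightarrow> real \<Rightarrow> real" where
  "cz_const p A D = 2 * (3 powr p * ((12 * D) powr p + 1 + 3 * A) * (96 * (1 + A))) powr (1 / p)"

context
  fixes \<kappa> :: "int \<Rightarrow> complex" and p A D :: real
  assumes p: "p > 1" and A: "A \<ge> 0" and D: "D \<ge> 0"
    and bdd: "\<And>W Y f. finite W \<Longrightarrow> finite Y \<Longrightarrow>
      (\<Sum>l\<in>Y. cmod (\<Sum>m\<in>W. \<kappa> (l - m) * f m) powr p) \<le> A * (\<Sum>m\<in>W. cmod (f m) powr p)"
    and reg: "\<And>l l'. l * l' > 0 \<Longrightarrow>
      cmod (\<kappa> l - \<kappa> l') \<le> D * \<bar>real_of_int (l - l')\<bar> / real_of_int (l * l')"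
begin

context
  fixes S :: "'i set" and F :: "int \<Rightarrow> 'i \<Rightarrow> complex" and V :: "int \<Rightarrow> real"
  assumes S: "finite S"
  defines "V \<equiv> (\<lambda>m. \<Sum>x\<in>S. cmod (F m x) powr p)"
begin

lemma V_nonneg: "V m \<ge> 0" unfolding V_def by (intro sum_nonneg) auto

lemma bdd_vector:
  assumes "finite W" "finite Y"
  shows "(\<Sum>l\<in>Y. \<Sum>x\<in>S. cmod (\<Sum>m\<in>W. \<kappa> (l - m) * F m x) powr p) \<le> A * (\<Sum>m\<in>W. V m)"
proof -
  have "(\<Sum>l\<in>Y. \<Sum>x\<in>S. cmod (\<Sum>m\<in>W. \<kappa> (l - m) * F m x) powr p)
      = (\<Sum>x\<in>S. \<Sum>l\<in>Y. cmod (\<Sum>m\<in>W. \<kappa> (l - m) * F m x) powr p)" by (rule sum.swap)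
  also have "\<dots> \<le> (\<Sum>x\<in>S. A * (\<Sum>m\<in>W. cmod (F m x) powr p))"
    using assms by (intro sum_mono bdd) auto
  also have "\<dots> = A * (\<Sum>m\<in>W. V m)"
    unfolding V_def sum_distrib_left[symmetric] by (simp add: sum.swap[of _ S W])
  finally show ?thesis .
qed

text \<open>On a stopping interval, the part of the operator coming from outside its triple is almost
  constant by the regularity of the kernel, and at a suitable point it is controlled by the two
  \<open>\<ell>\<^sup>p\<close> averages that the stopping condition bounds.\<close>

lemma far_part_bound:
  assumes W: "finite W" and L: "L \<ge> (1::int)" and \<mu>: "\<mu> \<ge> 0"
    and PW: "{c - L..<c + 2 * L} \<subseteq> W"
    and avgV: "\<And>a b. a \<le> z \<Longrightarrow> z < b \<Longrightarrow> avg {a..<b} (\<lambda>m. if m \<in> W then V m else 0) \<le> \<mu>"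
    and avgT: "avg {c..<c + L} (\<lambda>l. \<Sum>x\<in>S. cmod (\<Sum>m\<in>W. \<kappa> (l - m) * F m x) powr p) \<le> \<mu>"
    and z: "z \<in> {c..<c + L}" and \<xi>: "\<xi> \<in> {c..<c + L}"
  shows "(\<Sum>x\<in>S. cmod (\<Sum>m\<in>W - {c - L..<c + 2 * L}. \<kappa> (\<xi> - m) * F m x) powr p)
      \<le> 3 powr p * ((12 * D) powr p + 1 + 3 * A) * \<mu>"
proof -
  let ?P = "{c..<c + L}" and ?P3 = "{c - L..<c + 2 * L}"
  define Z where "Z = W - ?P3"
  have Z: "finite Z" using W by (simp add: Z_def)
  define T where "T l x = (\<Sum>m\<in>W. \<kappa> (l - m) * F m x)" for l x
  define N where "N l x = (\<Sum>m\<in>?P3. \<kappa> (l - m) * F m x)" for l x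
  define h where "h l x = (\<Sum>m\<in>Z. \<kappa> (l - m) * F m x)" for l x
  have hTN: "h l x = T l x - N l x" for l x
  proof -
    have "T l x = h l x + N l x"
      unfolding T_def N_def h_def Z_def using W PW by (intro sum.subset_diff) auto
    then show ?thesis by simp
  qed
  have V3: "(\<Sum>m\<in>?P3. V m) \<le> 3 * real_of_int L * \<mu>"
  proof -
    have "avg ?P3 (\<lambda>m. if m \<in> W then V m else 0) \<le> \<mu>" using z L by (intro avgV) auto
    then have "(\<Sum>m\<in>?P3. if m \<in> W then V m else 0) \<le> 3 * real_of_int L * \<mu>"
      using L by (simp add: avg_def field_simps)
    moreover have "(\<Sum>m\<in>?P3. if m \<in> W then V m else 0) = (\<Sum>m\<in>?P3. V m)"
      using PW by (intro sum.cong) auto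
    ultimately show ?thesis by simp
  qed
  obtain \<eta> where \<eta>: "\<eta> \<in> ?P"
    and \<eta>b: "(\<Sum>x\<in>S. cmod (T \<eta> x) powr p) + (\<Sum>x\<in>S. cmod (N \<eta> x) powr p) \<le> (1 + 3 * A) * \<mu>"
  proof -
    have "(\<Sum>l\<in>?P. (\<Sum>x\<in>S. cmod (T l x) powr p) + (\<Sum>x\<in>S. cmod (N l x) powr p)) \<le> (\<Sum>l\<in>?P. (1 + 3 * A) * \<mu>)"
    proof -
      have "(\<Sum>l\<in>?P. \<Sum>x\<in>S. cmod (T l x) powr p) \<le> real_of_int L * \<mu>"
        using avgT L by (simp add: avg_def T_def field_simps)
      moreover have "(\<Sum>l\<in>?P. \<Sum>x\<in>S. cmod (N l x) powr p) \<le> A * (3 * real_of_int L * \<mu>)"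
        unfolding N_def using A V3 by (intro order_trans[OF bdd_vector] mult_left_mono) auto
      moreover have "(\<Sum>l\<in>?P. (1 + 3 * A) * \<mu>) = real_of_int L * \<mu> + A * (3 * real_of_int L * \<mu>)"
        using L by (simp add: algebra_simps)
      ultimately show ?thesis unfolding sum.distrib by linarith
    qed
    then have "\<exists>l\<in>?P. (\<Sum>x\<in>S. cmod (T l x) powr p) + (\<Sum>x\<in>S. cmod (N l x) powr p) \<le> (1 + 3 * A) * \<mu>"
    proof (rule contrapos_pp)
      assume "\<not> ?thesis"
      then show "\<not> (\<Sum>l\<in>?P. (\<Sum>x\<in>S. cmod (T l x) powr p) + (\<Sum>x\<in>S. cmod (N l x) powr p)) \<le> (\<Sum>l\<in>?P. (1 + 3 * A) * \<mu>)"
        unfolding not_le using z by (intro sum_strict_mono) (auto simp: not_le)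
    qed
    then show ?thesis using that by blast
  qed
  define \<delta> where "\<delta> m = cmod (\<kappa> (\<xi> - m) - \<kappa> (\<eta> - m))" for m
  define d where "d m = (if m < c then c - m else m - (c + L) + 1)" for m
  have \<delta>d: "\<delta> m \<le> D * (real_of_int L / (real_of_int (d m))\<^sup>2)" if m: "m \<in> Z" for m
  proof -
    have out: "m < c - L \<or> c + 2 * L \<le> m" using m by (auto simp: Z_def)
    have dd: "d m > 0" using out L by (auto simp: d_def)
    have ab: "d m \<le> \<bar>\<xi> - m\<bar>" "d m \<le> \<bar>\<eta> - m\<bar>" using out \<xi> \<eta> L by (auto simp: d_def)
    have sgn: "(\<xi> - m) * (\<eta> - m) > 0" using out \<xi> \<eta> L by (auto simp: zero_less_mult_iff)
    have "(\<xi> - m) * (\<eta> - m) = \<bar>\<xi> - m\<bar> * \<bar>\<eta> - m\<bar>" using sgn by (simp flip: abs_mult)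
    also have "\<dots> \<ge> d m * d m" using ab dd by (intro mult_mono) auto
    finally have prod: "real_of_int (d m * d m) \<le> real_of_int ((\<xi> - m) * (\<eta> - m))" by (simp only: of_int_le_iff)
    have "\<delta> m \<le> D * \<bar>real_of_int ((\<xi> - m) - (\<eta> - m))\<bar> / real_of_int ((\<xi> - m) * (\<eta> - m))"
      unfolding \<delta>_def by (rule reg[OF sgn])
    also have "\<dots> \<le> D * real_of_int L / real_of_int (d m * d m)"
    proof (rule frac_le)
      have "\<bar>(\<xi> - m) - (\<eta> - m)\<bar> \<le> L" using \<xi> \<eta> by auto
      then have "\<bar>real_of_int ((\<xi> - m) - (\<eta> - m))\<bar> \<le> real_of_int L" by linarith
      then show "D * \<bar>real_of_int ((\<xi> - m) - (\<eta> - m))\<bar> \<le> D * real_of_int L" using D by (rule mult_left_mono)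
    qed (use prod dd D L in \<open>auto simp: mult_pos_pos\<close>)
    also have "\<dots> = D * (real_of_int L / (real_of_int (d m))\<^sup>2)" by (simp add: power2_eq_square)
    finally show ?thesis .
  qed
  have dZ: "L < d m" if "m \<in> Z" for m using that L by (auto simp: Z_def d_def)
  have dR: "m \<in> {c - R..<c + L + R}" if "m \<in> Z" "d m \<le> R" for m R
    using that L by (auto simp: Z_def d_def split: if_splits)
  have \<delta>V: "(\<Sum>m\<in>Z. \<delta> m * V m) \<le> D * 12 * \<mu>"
  proof -
    have "(\<Sum>m\<in>Z. \<delta> m * V m) \<le> (\<Sum>m\<in>Z. D * (real_of_int L / (real_of_int (d m))\<^sup>2) * V m)"
      by (intro sum_mono mult_right_mono \<delta>d V_nonneg)
    also have "\<dots> = D * (\<Sum>m\<in>Z. real_of_int L / (real_of_int (d m))\<^sup>2 * (if m \<in> W then V m else 0))"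
      unfolding sum_distrib_left by (intro sum.cong) (auto simp: Z_def)
    also have "\<dots> \<le> D * (12 * \<mu>)"
    proof (intro mult_left_mono D tail_average[OF Z L _ \<mu>, where c = c])
      show "avg {c - R..<c + L + R} (\<lambda>m. if m \<in> W then V m else 0) \<le> \<mu>" if "R \<ge> 0" for R
        using z that by (intro avgV) auto
    qed (use dZ dR V_nonneg in auto)
    finally show ?thesis by simp
  qed
  have \<delta>1: "(\<Sum>m\<in>Z. \<delta> m) \<le> D * 12"
  proof -
    have "(\<Sum>m\<in>Z. \<delta> m) \<le> (\<Sum>m\<in>Z. D * (real_of_int L / (real_of_int (d m))\<^sup>2))"
      by (intro sum_mono \<delta>d)
    also have "\<dots> = D * (\<Sum>m\<in>Z. real_of_int L / (real_of_int (d m))\<^sup>2 * 1)"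
      unfolding sum_distrib_left by simp
    also have "\<dots> \<le> D * (12 * 1)"
    proof (intro mult_left_mono D tail_average[OF Z L, where c = c])
      show "avg {c - R..<c + L + R} (\<lambda>m. 1) \<le> 1" for R by (simp add: avg_def)
    qed (use dZ dR in auto)
    finally show ?thesis by simp
  qed
  have osc: "(\<Sum>x\<in>S. cmod (h \<xi> x - h \<eta> x) powr p) \<le> (12 * D) powr p * \<mu>"
  proof -
    have "(\<Sum>x\<in>S. cmod (h \<xi> x - h \<eta> x) powr p) \<le> (\<Sum>x\<in>S. (\<Sum>m\<in>Z. \<delta> m) powr (p - 1) * (\<Sum>m\<in>Z. \<delta> m * cmod (F m x) powr p))"
    proof (rule sum_mono)
      fix x
      have "h \<xi> x - h \<eta> x = (\<Sum>m\<in>Z. (\<kappa> (\<xi> - m) - \<kappa> (\<eta> - m)) * F m x)"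
        by (simp add: h_def sum_subtractf left_diff_distrib)
      then have "cmod (h \<xi> x - h \<eta> x) \<le> (\<Sum>m\<in>Z. \<delta> m * cmod (F m x))"
        unfolding \<delta>_def by (simp add: norm_mult[symmetric] norm_sum)
      then have "cmod (h \<xi> x - h \<eta> x) powr p \<le> (\<Sum>m\<in>Z. \<delta> m * cmod (F m x)) powr p"
        using p by (intro powr_mono2) auto
      also have "\<dots> \<le> (\<Sum>m\<in>Z. \<delta> m) powr (p - 1) * (\<Sum>m\<in>Z. \<delta> m * cmod (F m x) powr p)"
        using Z p by (intro weighted_power_mean) (auto simp: \<delta>_def)
      finally show "cmod (h \<xi> x - h \<eta> x) powr p \<le> (\<Sum>m\<in>Z. \<delta> m) powr (p - 1) * (\<Sum>m\<in>Z. \<delta> m * cmod (F m x) powr p)" .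
    qed
    also have "\<dots> = (\<Sum>m\<in>Z. \<delta> m) powr (p - 1) * (\<Sum>m\<in>Z. \<delta> m * V m)"
      unfolding V_def sum_distrib_left[symmetric] by (subst sum.swap) (simp add: sum_distrib_left)
    also have "\<dots> \<le> (D * 12) powr (p - 1) * (D * 12 * \<mu>)"
      using \<delta>1 \<delta>V p V_nonneg by (intro mult_mono powr_mono2) (auto intro!: sum_nonneg simp: \<delta>_def)
    also have "\<dots> = ((12 * D) powr (p - 1) * (12 * D) powr 1) * \<mu>" using D by (simp add: mult_ac)
    also have "(12 * D) powr (p - 1) * (12 * D) powr 1 = (12 * D) powr p"
      unfolding powr_add[symmetric] by simp
    finally show ?thesis .
  qed
  have "(\<Sum>x\<in>S. cmod (h \<xi> x) powr p) \<le> (\<Sum>x\<in>S. 3 powr p * (cmod (h \<xi> x - h \<eta> x) powr p + cmod (T \<eta> x) powr p + cmod (N \<eta> x) powr p))"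
  proof (rule sum_mono)
    fix x
    have "h \<xi> x = (h \<xi> x - h \<eta> x) + T \<eta> x + (- N \<eta> x)" using hTN[of \<eta> x] by simp
    then have "cmod (h \<xi> x) \<le> cmod (h \<xi> x - h \<eta> x) + cmod (T \<eta> x) + cmod (- N \<eta> x)"
      by (metis norm_triangle_le norm_triangle_ineq add_mono order_refl)
    then have "cmod (h \<xi> x) powr p \<le> (cmod (h \<xi> x - h \<eta> x) + cmod (T \<eta> x) + cmod (N \<eta> x)) powr p"
      using p by (intro powr_mono2) auto
    also have "\<dots> \<le> 3 powr p * (cmod (h \<xi> x - h \<eta> x) powr p + cmod (T \<eta> x) powr p + cmod (N \<eta> x) powr p)"
      using p by (intro powr_add3_le) auto
    finally show "cmod (h \<xi> x) powr p \<le> 3 powr p * (cmod (h \<xi> x - h \<eta> x) powr p + cmod (T \<eta> x) powr p + cmod (N \<eta> x) powr p)" .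
  qed
  also have "\<dots> = 3 powr p * ((\<Sum>x\<in>S. cmod (h \<xi> x - h \<eta> x) powr p) + ((\<Sum>x\<in>S. cmod (T \<eta> x) powr p) + (\<Sum>x\<in>S. cmod (N \<eta> x) powr p)))"
    by (simp add: sum.distrib flip: sum_distrib_left)
  also have "\<dots> \<le> 3 powr p * ((12 * D) powr p * \<mu> + (1 + 3 * A) * \<mu>)"
    using osc \<eta>b by (intro mult_left_mono add_mono) auto
  also have "\<dots> = 3 powr p * ((12 * D) powr p + 1 + 3 * A) * \<mu>" by (simp add: algebra_simps)
  finally show ?thesis by (simp add: h_def Z_def)
qed

text \<open>The conclusion replaces a sparse domination. Instead of recording the selected intervals, the
  induction charges each of them to a function \<open>\<Phi>\<close> that dominates the product of averages at every
  point of the interval: half of an interval is left over when its stopping intervals are removed,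
  and the leftover sets of all generations are disjoint.\<close>

theorem stopping_time_bound:
  assumes G: "\<And>l. G l \<ge> 0"
    and B: "\<And>l h. cmod (\<Sum>x\<in>S. B l x * h x) \<le> G l * (\<Sum>x\<in>S. cmod (h x) powr p) powr (1 / p)"
    and \<Phi>: "\<And>c k l. l \<in> {c..<c + 2 ^ k} \<Longrightarrow>
        avg {c - 2 ^ k..<c + 2 * 2 ^ k} V powr (1 / p) * avg {c..<c + 2 ^ k} G \<le> \<Phi> l"
  shows "cmod (\<Sum>l\<in>{c..<c + 2 ^ k}. \<Sum>x\<in>S. B l x * (\<Sum>m\<in>{c - 2 ^ k..<c + 2 * 2 ^ k}. \<kappa> (l - m) * F m x))
     \<le> cz_const p A D * (\<Sum>l\<in>{c..<c + 2 ^ k}. \<Phi> l)"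
proof (induction k arbitrary: c rule: less_induct)
  case (less k)
  define L :: int where "L = 2 ^ k"
  have L: "L \<ge> 1" by (simp add: L_def)
  define Q where "Q = {c..<c + L}"
  define Q3 where "Q3 = {c - L..<c + 2 * L}"
  have fin: "finite Q" "finite Q3" "Q \<noteq> {}" "Q3 \<noteq> {}" using L by (auto simp: Q_def Q3_def)
  have cQ: "real (card Q) = real_of_int L" "real (card Q3) = 3 * real_of_int L" using L by (auto simp: Q_def Q3_def)
  define v where "v = avg Q3 V"
  have v: "v \<ge> 0" unfolding v_def by (intro avg_nonneg V_nonneg)
  have \<Phi>0: "\<Phi> l \<ge> 0" for l
  proof -
    have "0 \<le> avg {l - 2 ^ 0..<l + 2 * 2 ^ 0} V powr (1 / p) * avg {l..<l + 2 ^ 0} G"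
      by (intro mult_nonneg_nonneg avg_nonneg G) auto
    also have "\<dots> \<le> \<Phi> l" by (rule \<Phi>) auto
    finally show ?thesis .
  qed
  define C' where "C' = 3 powr p * ((12 * D) powr p + 1 + 3 * A)"
  have C': "C' \<ge> 1"
  proof -
    have "1 * 1 \<le> C'" unfolding C'_def using p A by (intro mult_mono ge_one_powr_ge_zero) auto
    then show ?thesis by simp
  qed
  define cz where "cz = cz_const p A D"
  have cz: "cz \<ge> 0" by (simp add: cz_def cz_const_def)
  define T where "T l x = (\<Sum>m\<in>Q3. \<kappa> (l - m) * F m x)" for l x
  have goal: "cmod (\<Sum>l\<in>Q. \<Sum>x\<in>S. B l x * T l x) \<le> cz * (\<Sum>l\<in>Q. \<Phi> l)"
  proof (cases "v = 0")
    case True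
    then have "(\<Sum>m\<in>Q3. V m) = 0" using fin by (simp add: v_def sum_eq_card_avg)
    then have "V m = 0" if "m \<in> Q3" for m using that fin V_nonneg by (simp add: sum_nonneg_eq_0_iff)
    then have "F m x = 0" if "m \<in> Q3" "x \<in> S" for m x
      using that S by (auto simp: V_def sum_nonneg_eq_0_iff)
    then have "(\<Sum>l\<in>Q. \<Sum>x\<in>S. B l x * T l x) = 0" by (simp add: T_def)
    then show ?thesis using cz \<Phi>0 by (auto intro!: mult_nonneg_nonneg sum_nonneg)
  next
    case False
    with v have vp: "v > 0" by simp
    \<comment> \<open>At this height the weak type inequality leaves at most one eighth of \<open>Q\<close> in the exceptional set.\<close>
    define \<mu> where "\<mu> = 96 * (1 + A) * v"
    have \<mu>: "\<mu> > 0" using A vp by (simp add: \<mu>_def)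
    define TV where "TV l = (\<Sum>x\<in>S. cmod (T l x) powr p)" for l
    define V0 where "V0 m = (if m \<in> Q3 then V m else 0)" for m
    define T0 where "T0 m = (if m \<in> Q then TV m else 0)" for m
    have TV0: "TV l \<ge> 0" for l unfolding TV_def by (intro sum_nonneg) auto
    have V0: "\<And>m. V0 m \<ge> 0" "\<And>m. m \<notin> Q3 \<Longrightarrow> V0 m = 0"
      and T0: "\<And>m. T0 m \<ge> 0" "\<And>m. m \<notin> Q \<Longrightarrow> T0 m = 0"
      using V_nonneg TV0 by (auto simp: V0_def T0_def)
    define E1 where "E1 = {x\<in>Q. \<exists>a b. a \<le> x \<and> x < b \<and> \<mu> < avg {a..<b} V0}"
    define E2 where "E2 = {x\<in>Q. \<exists>a b. a \<le> x \<and> x < b \<and> \<mu> < avg {a..<b} T0}"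
    define E where "E = E1 \<union> E2"
    have E: "finite E" "E \<subseteq> Q" using fin by (auto simp: E_def E1_def E2_def)
    have sV: "(\<Sum>m\<in>Q3. V0 m) = 3 * real_of_int L * v"
      using fin cQ by (simp add: V0_def v_def sum_eq_card_avg cong: sum.cong)
    have "\<mu> * real (card E1) \<le> 4 * (\<Sum>m\<in>Q3. V0 m)"
      by (rule weak_type[OF fin(2) V0 \<mu>]) (use fin in \<open>auto simp: E1_def\<close>)
    moreover have "\<mu> * real (card E2) \<le> 4 * (\<Sum>m\<in>Q. T0 m)"
      by (rule weak_type[OF fin(1) T0 \<mu>]) (use fin in \<open>auto simp: E2_def\<close>)
    moreover have "(\<Sum>m\<in>Q. T0 m) \<le> A * (\<Sum>m\<in>Q3. V m)"
      using bdd_vector[OF fin(2,1)] by (simp add: T0_def TV_def T_def)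
    moreover have "(\<Sum>m\<in>Q3. V m) = 3 * real_of_int L * v"
      using fin cQ by (simp add: v_def sum_eq_card_avg)
    moreover have "\<mu> * real (card E) \<le> \<mu> * (real (card E1) + real (card E2))"
      using \<mu> card_Un_le[of E1 E2] by (simp add: E_def)
    ultimately have "\<mu> * real (card E) \<le> 4 * (3 * real_of_int L * v) + 4 * (A * (3 * real_of_int L * v))"
      using sV by (simp add: distrib_left)
    also have "\<dots> = \<mu> * (real_of_int L / 8)" by (simp add: \<mu>_def algebra_simps)
    finally have "8 * real (card E) \<le> real_of_int L" using \<mu> by simp
    then have "real (8 * card E) \<le> real (2 ^ k)" by (simp add: L_def)
    then have cE: "8 * card E \<le> 2 ^ k" by (simp only: of_nat_le_iff)
    define st where "st = stopping E k c"
    define blk where "blk = (\<lambda>(c', k'). {c'..<c' + 2 ^ k'} :: int set)"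
    define U where "U = (\<Union>i\<in>st. blk i)"
    have EQ: "E \<inter> {c..<c + 2 ^ k} = E" using E by (auto simp: Q_def L_def)
    have fst': "finite st" by (simp add: st_def finite_stopping)
    have fb: "finite (blk i)" for i by (simp add: blk_def case_prod_unfold)
    have EU: "E \<subseteq> U" using stopping_covers[of E c k] EQ by (auto simp: U_def st_def blk_def)
    have bQ: "blk i \<subseteq> Q" "snd i < k" "2 * card (E \<inter> blk i) \<le> 2 ^ snd i" if i: "i \<in> st" for i
    proof -
      obtain c' k' where [simp]: "i = (c', k')" by (cases i)
      show "blk i \<subseteq> Q" using stopping_range[of c' k' E k c] i by (auto simp: st_def blk_def Q_def L_def)
      have "4 * card (E \<inter> {c..<c + 2 ^ k}) \<le> 2 ^ k" using cE unfolding EQ by simp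
      from stopping_sparse[OF this, of c' k'] i
      show "snd i < k" "2 * card (E \<inter> blk i) \<le> 2 ^ snd i" by (auto simp: st_def blk_def)
    qed
    have UQ: "U \<subseteq> Q" using bQ by (auto simp: U_def)
    have disj: "\<forall>i\<in>st. \<forall>j\<in>st. i \<noteq> j \<longrightarrow> blk i \<inter> blk j = {}"
      using stopping_disjoint[of E k c] by (auto simp: disjoint_family_on_def st_def blk_def)
    have sumU: "(\<Sum>l\<in>U. z l) = (\<Sum>i\<in>st. \<Sum>l\<in>blk i. z l)" for z :: "int \<Rightarrow> 'z::comm_monoid_add"
      unfolding U_def using fst' fb disj by (intro sum.UNION_disjoint) auto
    have "card U = (\<Sum>i\<in>st. card (blk i))"
      unfolding U_def using fst' fb disj by (intro card_UN_disjoint) auto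
    also have "\<dots> = (\<Sum>(c', k')\<in>st. 2 ^ k')" by (intro sum.cong) (auto simp: blk_def nat_power_eq)
    also have "\<dots> \<le> 4 * card E" unfolding st_def using E by (intro stopping_total_length)
    finally have "2 * card U \<le> 2 ^ k" using cE by simp
    then have "2 * real (card U) \<le> real_of_int L"
      unfolding L_def by (metis of_int_numeral of_int_power of_nat_le_iff of_nat_mult of_nat_numeral of_nat_power)
    moreover have "real (card (Q - U)) = real (card Q) - real (card U)"
      using UQ fin by (simp add: card_Diff_subset finite_subset of_nat_diff card_mono)
    ultimately have cR: "real_of_int L \<le> 2 * real (card (Q - U))" using cQ by simp
    \<comment> \<open>On a stopping interval the contribution of its triple is left to the induction hypothesis.\<close>
    define far where "far i l x = (\<Sum>m\<in>Q3 - {fst i - 2 ^ snd i..<fst i + 2 * 2 ^ snd i}. \<kappa> (l - m) * F m x)" for i :: "int \<times> nat" and l x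
    define near where "near i l x = (\<Sum>m\<in>{fst i - 2 ^ snd i..<fst i + 2 * 2 ^ snd i}. \<kappa> (l - m) * F m x)" for i :: "int \<times> nat" and l x
    have Tsplit: "T l x = far i l x + near i l x" if i: "i \<in> st" for i l x
    proof -
      obtain c' k' where [simp]: "i = (c', k')" by (cases i)
      have "c \<le> c'" "c' + 2 ^ k' \<le> c + L" "(2::int) ^ k' > 0"
        using stopping_range[of c' k' E k c] i by (auto simp: st_def L_def)
      then have "{c' - 2 ^ k'..<c' + 2 * 2 ^ k'} \<subseteq> Q3" unfolding Q3_def by auto
      then show ?thesis unfolding T_def far_def near_def using fin by (simp add: sum.subset_diff)
    qed
    have good: "avg {a..<b} V0 \<le> \<mu>" "avg {a..<b} T0 \<le> \<mu>" if "z \<in> Q" "z \<notin> E" "a \<le> z" "z < b" for z a b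
    proof -
      have "z \<notin> E1" "z \<notin> E2" using that by (auto simp: E_def)
      then show "avg {a..<b} V0 \<le> \<mu>" "avg {a..<b} T0 \<le> \<mu>"
        using that unfolding E1_def E2_def not_less[symmetric] by blast+
    qed
    have notE: "TV l \<le> \<mu>" if "l \<in> Q" "l \<notin> E" for l
    proof -
      have "avg {l..<l + 1} T0 \<le> \<mu>" using that by (intro good) auto
      moreover have "{l..<l + 1} = {l}" by auto
      ultimately show ?thesis using that by (simp add: avg_def T0_def)
    qed
    have far_le: "(\<Sum>x\<in>S. cmod (far i l x) powr p) \<le> C' * \<mu>" if i: "i \<in> st" and l: "l \<in> blk i" for i l
    proof -
      obtain c' k' where ik [simp]: "i = (c', k')" by (cases i)
      define L' :: int where "L' = 2 ^ k'"
      have L': "L' \<ge> 1" by (simp add: L'_def)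
      have rng: "c \<le> c'" "c' + L' \<le> c + L" "{c'..<c' + L'} \<subseteq> Q"
        using stopping_range[of c' k' E k c] i by (auto simp: st_def L_def L'_def Q_def)
      have "\<not> {c'..<c' + L'} \<subseteq> E"
      proof
        assume "{c'..<c' + L'} \<subseteq> E"
        then have "E \<inter> blk i = {c'..<c' + L'}" by (auto simp: blk_def L'_def)
        then have "card (E \<inter> blk i) = 2 ^ k'" by (simp add: L'_def nat_power_eq)
        then show False using bQ(3)[OF i] by simp
      qed
      then obtain z where z: "z \<in> {c'..<c' + L'}" "z \<notin> E" by blast
      have zQ: "z \<in> Q" using z rng by auto
      have z1: "avg {a..<b} V0 \<le> \<mu>" "avg {a..<b} T0 \<le> \<mu>" if "a \<le> z" "z < b" for a b
        using good[OF zQ z(2) that] by auto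
      show ?thesis unfolding far_def C'_def ik fst_conv snd_conv L'_def[symmetric]
      proof (rule far_part_bound)
        show "{c' - L'..<c' + 2 * L'} \<subseteq> Q3" using rng L' unfolding Q3_def by auto
        show "avg {a..<b} (\<lambda>m. if m \<in> Q3 then V m else 0) \<le> \<mu>" if "a \<le> z" "z < b" for a b
          using z1(1)[OF that] unfolding V0_def .
        have "avg {c'..<c' + L'} T0 \<le> \<mu>" using z by (intro z1) auto
        moreover have "avg {c'..<c' + L'} T0 = avg {c'..<c' + L'} TV"
          unfolding avg_def T0_def using rng(3) by (intro arg_cong2[where f = "(*)"] sum.cong) auto
        ultimately show "avg {c'..<c' + L'} (\<lambda>l. \<Sum>x\<in>S. cmod (\<Sum>m\<in>Q3. \<kappa> (l - m) * F m x) powr p) \<le> \<mu>"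
          unfolding TV_def T_def by simp
        show "l \<in> {c'..<c' + L'}" using l by (simp add: blk_def L'_def)
      qed (use fin L' \<mu> z in auto)
    qed
    define M where "M = (C' * \<mu>) powr (1 / p)"
    have b1: "cmod (\<Sum>x\<in>S. B l x * T l x) \<le> G l * M" if "l \<in> Q - U" for l
    proof -
      have "TV l \<le> \<mu>" using that EU by (intro notE) auto
      also have "\<mu> \<le> C' * \<mu>" using C' \<mu> by simp
      finally have "TV l powr (1 / p) \<le> M" unfolding M_def using TV0 p by (intro powr_mono2) auto
      then have "G l * TV l powr (1 / p) \<le> G l * M" using G by (intro mult_left_mono)
      moreover have "cmod (\<Sum>x\<in>S. B l x * T l x) \<le> G l * TV l powr (1 / p)" unfolding TV_def by (rule B)
      ultimately show ?thesis by linarith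
    qed
    have b2: "cmod (\<Sum>x\<in>S. B l x * far i l x) \<le> G l * M" if "i \<in> st" "l \<in> blk i" for i l
    proof -
      have "(\<Sum>x\<in>S. cmod (far i l x) powr p) powr (1 / p) \<le> M"
        unfolding M_def using far_le[OF that] p by (intro powr_mono2) (auto intro: sum_nonneg)
      then have "G l * (\<Sum>x\<in>S. cmod (far i l x) powr p) powr (1 / p) \<le> G l * M" using G by (intro mult_left_mono)
      with B[of l "far i l"] show ?thesis by linarith
    qed
    have IH: "cmod (\<Sum>l\<in>blk i. \<Sum>x\<in>S. B l x * near i l x) \<le> cz * (\<Sum>l\<in>blk i. \<Phi> l)" if "i \<in> st" for i
      using less.IH[OF bQ(2)[OF that], of "fst i"] unfolding near_def blk_def cz_def
      by (simp add: case_prod_unfold)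
    have "(\<Sum>l\<in>Q. \<Sum>x\<in>S. B l x * T l x) = (\<Sum>l\<in>Q - U. \<Sum>x\<in>S. B l x * T l x) + (\<Sum>l\<in>U. \<Sum>x\<in>S. B l x * T l x)"
      using fin UQ by (intro sum.subset_diff) auto
    also have "(\<Sum>l\<in>U. \<Sum>x\<in>S. B l x * T l x) = (\<Sum>i\<in>st. \<Sum>l\<in>blk i. \<Sum>x\<in>S. B l x * T l x)" by (rule sumU)
    also have "\<dots> = (\<Sum>i\<in>st. (\<Sum>l\<in>blk i. \<Sum>x\<in>S. B l x * far i l x) + (\<Sum>l\<in>blk i. \<Sum>x\<in>S. B l x * near i l x))"
      unfolding sum.distrib[symmetric] by (intro sum.cong refl) (simp add: Tsplit distrib_left)
    finally have "cmod (\<Sum>l\<in>Q. \<Sum>x\<in>S. B l x * T l x) \<le> cmod (\<Sum>l\<in>Q - U. \<Sum>x\<in>S. B l x * T l x)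
       + (\<Sum>i\<in>st. cmod (\<Sum>l\<in>blk i. \<Sum>x\<in>S. B l x * far i l x) + cmod (\<Sum>l\<in>blk i. \<Sum>x\<in>S. B l x * near i l x))"
      by (simp only:) (intro order_trans[OF norm_triangle_ineq] add_mono order_refl order_trans[OF norm_sum] sum_mono norm_triangle_ineq)
    also have "\<dots> \<le> (\<Sum>l\<in>Q - U. G l * M) + (\<Sum>i\<in>st. (\<Sum>l\<in>blk i. G l * M) + cz * (\<Sum>l\<in>blk i. \<Phi> l))"
      by (intro add_mono sum_mono order_trans[OF norm_sum] b1 b2 IH)
    also have "\<dots> = ((\<Sum>l\<in>Q - U. G l * M) + (\<Sum>l\<in>U. G l * M)) + cz * (\<Sum>l\<in>U. \<Phi> l)"
      unfolding sumU sum.distrib by (simp add: sum_distrib_left)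
    also have "(\<Sum>l\<in>Q - U. G l * M) + (\<Sum>l\<in>U. G l * M) = (\<Sum>l\<in>Q. G l * M)"
      using fin UQ by (intro sum.subset_diff[symmetric]) auto
    also have "\<dots> \<le> cz * (\<Sum>l\<in>Q - U. \<Phi> l)"
    proof -
      define t where "t = v powr (1 / p) * avg Q G"
      have t: "t \<ge> 0" unfolding t_def using G by (intro mult_nonneg_nonneg avg_nonneg) auto
      have "M = cz / 2 * v powr (1 / p)"
        unfolding M_def cz_def cz_const_def C'_def \<mu>_def using A vp D
        by (simp add: powr_mult[symmetric] mult_ac)
      then have "(\<Sum>l\<in>Q. G l * M) = cz / 2 * (real_of_int L * t)"
        using fin cQ by (simp add: t_def sum_eq_card_avg flip: sum_distrib_right)
      also have "\<dots> \<le> cz / 2 * (2 * real (card (Q - U)) * t)"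
        using cR cz t by (intro mult_left_mono mult_right_mono) auto
      also have "\<dots> = cz * (\<Sum>l\<in>Q - U. t)" by simp
      also have "\<dots> \<le> cz * (\<Sum>l\<in>Q - U. \<Phi> l)"
        using \<Phi>[of _ c k] cz unfolding t_def v_def Q_def Q3_def L_def by (intro mult_left_mono sum_mono) auto
      finally show ?thesis .
    qed
    also have "cz * (\<Sum>l\<in>Q - U. \<Phi> l) + cz * (\<Sum>l\<in>U. \<Phi> l) = cz * (\<Sum>l\<in>Q. \<Phi> l)"
      unfolding distrib_left[symmetric] using fin UQ by (simp add: sum.subset_diff[of U Q \<Phi>])
    finally show ?thesis by simp
  qed
  then show ?case by (simp only: Q_def Q3_def T_def L_def cz_def)
qed

end

end

section \<open>Odd Calderon-Zygmund kernels on the integers\<close>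

text \<open>The standard character of \<open>\<real>/\<int>\<close>.\<close>

definition ee :: "real \<Rightarrow> complex" where "ee x = cis (2 * pi * x)"

lemma ee_add: "ee (x + y) = ee x * ee y"
  by (simp add: ee_def cis_mult algebra_simps)

lemma norm_ee [simp]: "cmod (ee x) = 1" by (simp add: ee_def)

lemma ee_0 [simp]: "ee 0 = 1" by (simp add: ee_def)

lemma ee_minus: "ee (-x) = cnj (ee x)" by (simp add: ee_def cis_cnj)

lemma cnj_ee: "cnj (ee x) = ee (-x)" by (simp add: ee_minus)

lemma ee_of_int [simp]: "ee (of_int k) = 1"
proof -
  have "cis (2 * pi * real_of_int k) = 1"
    by (subst cis_multiple_2pi) auto
  then show ?thesis by (simp add: ee_def)
qed

lemma ee_eq_1_iff: "ee x = 1 \<longleftrightarrow> x \<in> \<int>"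
proof
  assume "ee x = 1"
  then have "cos (2 * pi * x) = 1" by (simp add: ee_def complex_eq_iff)
  then obtain n :: int where "2 * pi * x = real_of_int n * 2 * pi" by (auto simp: cos_one_2pi_int)
  then have "x = real_of_int n" by simp
  then show "x \<in> \<int>" by simp
qed (auto elim!: Ints_cases)

lemma norm_ee_multiple_diff: "cmod (ee (real n * x) - 1) \<le> real n * cmod (ee x - 1)"
proof (induction n)
  case (Suc n)
  have "ee (real (Suc n) * x) - 1 = ee x * (ee (real n * x) - 1) + (ee x - 1)"
    by (simp add: ee_add algebra_simps)
  then have "cmod (ee (real (Suc n) * x) - 1) \<le> cmod (ee (real n * x) - 1) + cmod (ee x - 1)"
    by (metis norm_triangle_ineq norm_mult norm_ee mult_1)
  then show ?case using Suc by (simp add: distrib_right)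
qed simp

lemma norm_ee_diff_le: "cmod (ee x - ee y) \<le> 2 * pi * \<bar>x - y\<bar>"
proof -
  have "ee x - ee y = ee y * (ee (x - y) - 1)" using ee_add[of y "x - y"] by (simp add: algebra_simps)
  then have "cmod (ee x - ee y) = cmod (ee (x - y) - 1)" by (simp add: norm_mult)
  also have "\<dots> = 2 * \<bar>sin (2 * pi * (x - y) / 2)\<bar>"
    using dist_exp_i_1[of "2 * pi * (x - y)"] by (simp add: ee_def cis_conv_exp)
  also have "\<dots> \<le> 2 * \<bar>2 * pi * (x - y) / 2\<bar>" by (intro mult_left_mono abs_sin_x_le_abs_x) auto
  finally show ?thesis by (simp add: abs_mult)
qed

lemma norm_1_minus_ee_uminus: "cmod (1 - ee (-x)) = cmod (1 - ee x)"
proof -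
  have "1 - ee (-x) = cnj (1 - ee x)" by (simp add: ee_minus)
  then show ?thesis by (metis complex_mod_cnj)
qed

lemma summation_by_parts_bound:
  fixes a :: "int \<Rightarrow> complex"
  assumes "\<And>m. m \<notin> {A..<B} \<Longrightarrow> a m = 0"
  shows "cmod (1 - ee x) * cmod (\<Sum>m\<in>{A..<B}. a m * ee (of_int m * x)) \<le> (\<Sum>m\<in>{A..B}. cmod (a m - a (m - 1)))"
proof -
  have "(\<Sum>m\<in>{A..B}. (a m - a (m - 1)) * ee (of_int m * x))
     = (\<Sum>m\<in>{A..B}. a m * ee (of_int m * x)) - (\<Sum>m\<in>{A..B}. a (m - 1) * ee (of_int m * x))"
    by (simp add: left_diff_distrib sum_subtractf)
  also have "(\<Sum>m\<in>{A..B}. a m * ee (of_int m * x)) = (\<Sum>m\<in>{A..<B}. a m * ee (of_int m * x))"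
    using assms by (intro sum.mono_neutral_right) auto
  also have "(\<Sum>m\<in>{A..B}. a (m - 1) * ee (of_int m * x)) = (\<Sum>m\<in>{A-1..B-1}. a m * ee (of_int (m + 1) * x))"
    by (rule sum.reindex_bij_witness[of _ "\<lambda>m. m + 1" "\<lambda>m. m - 1"]) auto
  also have "\<dots> = (\<Sum>m\<in>{A..<B}. a m * ee (of_int (m + 1) * x))"
    using assms by (intro sum.mono_neutral_right) auto
  also have "\<dots> = ee x * (\<Sum>m\<in>{A..<B}. a m * ee (of_int m * x))"
  proof -
    have "ee (of_int (m + 1) * x) = ee x * ee (of_int m * x)" for m
    proof -
      have "of_int (m + 1) * x = x + of_int m * x" by (simp add: algebra_simps)
      then show ?thesis by (simp only: ee_add)
    qed
    then show ?thesis by (simp add: sum_distrib_left mult_ac)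
  qed
  finally have "(1 - ee x) * (\<Sum>m\<in>{A..<B}. a m * ee (of_int m * x)) = (\<Sum>m\<in>{A..B}. (a m - a (m - 1)) * ee (of_int m * x))"
    by (simp add: algebra_simps)
  then have "cmod (1 - ee x) * cmod (\<Sum>m\<in>{A..<B}. a m * ee (of_int m * x)) = cmod (\<Sum>m\<in>{A..B}. (a m - a (m - 1)) * ee (of_int m * x))"
    by (metis norm_mult)
  also have "\<dots> \<le> (\<Sum>m\<in>{A..B}. cmod (a m - a (m - 1)))"
    by (intro order_trans[OF norm_sum] sum_mono) (simp add: norm_mult)
  finally show ?thesis .
qed

lemma sum_characters:
  fixes d :: int and M :: nat
  assumes "M > 0"
  shows "(\<Sum>k<M. ee (real k * (of_int d / real M))) = (if int M dvd d then of_nat M else 0)"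
proof (cases "int M dvd d")
  case True
  then obtain j where "d = int M * j" by (elim dvdE)
  then have "of_int d / real M = of_int j" using assms by simp
  then have "ee (real k * (of_int d / real M)) = 1" for k
    by (metis ee_of_int of_int_mult of_int_of_nat_eq)
  then show ?thesis using True by simp
next
  case False
  define z where "z = ee (of_int d / real M)"
  have pw': "ee (real k * y) = ee y ^ k" for k y
    by (induction k) (auto simp: ee_add distrib_right)
  have pw: "ee (real k * (of_int d / real M)) = z ^ k" for k unfolding z_def by (rule pw')
  have "z \<noteq> 1"
  proof
    assume "z = 1"
    then obtain j where "real_of_int d / real M = of_int j" by (auto simp: z_def ee_eq_1_iff elim: Ints_cases)
    then have "real_of_int d = real_of_int (j * int M)" using assms by (simp add: field_simps)
    then have "d = j * int M" by (simp only: of_int_eq_iff)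
    then show False using False by simp
  qed
  moreover have "z ^ M = 1"
  proof -
    have "real M * (of_int d / real M) = of_int d" using assms by simp
    then show ?thesis using pw[of M] by (metis ee_of_int)
  qed
  ultimately show ?thesis using False unfolding pw by (simp add: geometric_sum)
qed

text \<open>Parseval's identity in the cyclic group of order \<open>M\<close>, into which \<open>W\<close> embeds.\<close>

lemma Parseval_finite:
  fixes f :: "int \<Rightarrow> complex"
  assumes M: "M > 0" and W: "W \<subseteq> {A..<A + int M}"
  shows "(\<Sum>k<M. (cmod (\<Sum>m\<in>W. f m * ee (of_int m * (- real k / real M))))\<^sup>2) = real M * (\<Sum>m\<in>W. (cmod (f m))\<^sup>2)"
proof -
  have fW: "finite W" using W finite_subset by blast
  have "complex_of_real (\<Sum>k<M. (cmod (\<Sum>m\<in>W. f m * ee (of_int m * (- real k / real M))))\<^sup>2)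
    = (\<Sum>k<M. \<Sum>m\<in>W. \<Sum>m'\<in>W. f m * cnj (f m') * ee (real k * (of_int (m' - m) / real M)))"
  proof -
    have "complex_of_real ((cmod (\<Sum>m\<in>W. f m * ee (of_int m * (- real k / real M))))\<^sup>2)
      = (\<Sum>m\<in>W. \<Sum>m'\<in>W. f m * cnj (f m') * ee (real k * (of_int (m' - m) / real M)))" for k
    proof -
      have "complex_of_real ((cmod (\<Sum>m\<in>W. f m * ee (of_int m * (- real k / real M))))\<^sup>2)
        = (\<Sum>m\<in>W. f m * ee (of_int m * (- real k / real M))) * (\<Sum>m'\<in>W. cnj (f m') * cnj (ee (of_int m' * (- real k / real M))))"
        by (simp only: complex_norm_square cnj_sum complex_cnj_mult)
      also have "\<dots> = (\<Sum>m\<in>W. \<Sum>m'\<in>W. f m * cnj (f m') * (ee (of_int m * (- real k / real M)) * ee (- (of_int m' * (- real k / real M)))))"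
        unfolding sum_product cnj_ee by (intro sum.cong refl) (simp add: mult_ac)
      also have "\<dots> = (\<Sum>m\<in>W. \<Sum>m'\<in>W. f m * cnj (f m') * ee (real k * (of_int (m' - m) / real M)))"
        unfolding ee_add[symmetric]
        by (intro sum.cong refl arg_cong2[where f = "(*)"] arg_cong[where f = ee]) (simp add: diff_divide_distrib algebra_simps)
      finally show ?thesis .
    qed
    then show ?thesis by simp
  qed
  also have "\<dots> = (\<Sum>m\<in>W. \<Sum>m'\<in>W. \<Sum>k<M. f m * cnj (f m') * ee (real k * (of_int (m' - m) / real M)))"
    by (subst sum.swap, intro sum.cong refl, subst sum.swap, rule refl)
  also have "\<dots> = (\<Sum>m\<in>W. \<Sum>m'\<in>W. if m = m' then of_nat M * complex_of_real ((cmod (f m))\<^sup>2) else 0)"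
  proof (intro sum.cong refl)
    fix m m' assume m: "m \<in> W" "m' \<in> W"
    have "int M dvd m' - m \<longleftrightarrow> m = m'"
    proof
      assume d: "int M dvd m' - m"
      have "\<bar>m' - m\<bar> < int M" using m W by (auto simp: subset_iff) (smt (verit) atLeastLessThan_iff)
      then show "m = m'" using d dvd_imp_le_int[of "m' - m" "int M"] by fastforce
    qed simp
    then show "(\<Sum>k<M. f m * cnj (f m') * ee (real k * (of_int (m' - m) / real M)))
       = (if m = m' then of_nat M * complex_of_real ((cmod (f m))\<^sup>2) else 0)"
      unfolding sum_distrib_left[symmetric] sum_characters[OF M] complex_norm_square by simp
  qed
  also have "\<dots> = complex_of_real (real M * (\<Sum>m\<in>W. (cmod (f m))\<^sup>2))"
    using fW by (simp add: sum_distrib_left)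
  finally show ?thesis by (simp only: of_real_eq_iff)
qed

text \<open>The Fourier transform is sampled at the multiples of \<open>1 / M\<close>, with \<open>M\<close> so large that the function and its
  image are supported in one period. Parseval's identity then applies to both.\<close>

lemma multiplier_bound:
  fixes \<kappa> :: "int \<Rightarrow> complex"
  assumes sup: "\<And>l. \<bar>l\<bar> > R \<Longrightarrow> \<kappa> l = 0" and S: "\<And>x. cmod (\<Sum>l\<in>{-R..R}. \<kappa> l * ee (of_int l * x)) \<le> S"
    and W: "finite W" and Y: "finite Y"
  shows "(\<Sum>l\<in>Y. (cmod (\<Sum>m\<in>W. \<kappa> (l - m) * f m))\<^sup>2) \<le> S\<^sup>2 * (\<Sum>m\<in>W. (cmod (f m))\<^sup>2)"
proof -
  define K where "K = Max (insert 1 (abs ` (W \<union> Y))) + \<bar>R\<bar> + 1"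
  have K: "K > 0" "\<And>m. m \<in> W \<union> Y \<Longrightarrow> \<bar>m\<bar> + \<bar>R\<bar> < K"
  proof -
    have "1 \<le> Max (insert 1 (abs ` (W \<union> Y)))" using W Y by (intro Max_ge) auto
    then show "K > 0" by (simp add: K_def)
    fix m assume "m \<in> W \<union> Y"
    then have "\<bar>m\<bar> \<le> Max (insert 1 (abs ` (W \<union> Y)))" using W Y by (intro Max_ge) auto
    then show "\<bar>m\<bar> + \<bar>R\<bar> < K" by (simp add: K_def)
  qed
  define X where "X = {-K..<K}"
  define M where "M = nat (2 * K)"
  have M: "M > 0" using K by (simp add: M_def)
  have XM: "X \<subseteq> {-K..<-K + int M}" using K by (simp add: X_def M_def)
  have sub: "W \<subseteq> X" "Y \<subseteq> X" using K(2) by (force simp: X_def)+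
  define T where "T l = (\<Sum>m\<in>W. \<kappa> (l - m) * f m)" for l
  have hat: "(\<Sum>l\<in>X. T l * ee (of_int l * x)) = (\<Sum>l\<in>{-R..R}. \<kappa> l * ee (of_int l * x)) * (\<Sum>m\<in>W. f m * ee (of_int m * x))" for x
  proof -
    have "(\<Sum>l\<in>X. T l * ee (of_int l * x)) = (\<Sum>m\<in>W. \<Sum>l\<in>X. \<kappa> (l - m) * f m * ee (of_int l * x))"
      unfolding T_def sum_distrib_right by (rule sum.swap)
    also have "\<dots> = (\<Sum>m\<in>W. (\<Sum>l\<in>{-R..R}. \<kappa> l * ee (of_int l * x)) * (f m * ee (of_int m * x)))"
    proof (rule sum.cong)
      fix m assume m: "m \<in> W"
      have "(\<Sum>l\<in>X. \<kappa> (l - m) * f m * ee (of_int l * x)) = (\<Sum>l\<in>{m-R..m+R}. \<kappa> (l - m) * f m * ee (of_int l * x))"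
      proof (rule sum.mono_neutral_right)
        show "{m-R..m+R} \<subseteq> X" using K(2)[of m] m by (auto simp: X_def)
        show "\<forall>i\<in>X - {m-R..m+R}. \<kappa> (i - m) * f m * ee (of_int i * x) = 0" using sup by auto
      qed (simp add: X_def)
      also have "\<dots> = (\<Sum>l\<in>{-R..R}. \<kappa> l * f m * ee (of_int (l + m) * x))"
        by (rule sum.reindex_bij_witness[of _ "\<lambda>l. l + m" "\<lambda>l. l - m"]) auto
      also have "\<dots> = (\<Sum>l\<in>{-R..R}. \<kappa> l * ee (of_int l * x)) * (f m * ee (of_int m * x))"
        unfolding sum_distrib_right by (intro sum.cong refl) (simp add: ee_add distrib_right)
      finally show "(\<Sum>l\<in>X. \<kappa> (l - m) * f m * ee (of_int l * x)) = (\<Sum>l\<in>{-R..R}. \<kappa> l * ee (of_int l * x)) * (f m * ee (of_int m * x))" .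
    qed simp
    finally show ?thesis by (simp add: sum_distrib_left)
  qed
  have "real M * (\<Sum>l\<in>X. (cmod (T l))\<^sup>2) = (\<Sum>k<M. (cmod (\<Sum>l\<in>X. T l * ee (of_int l * (- real k / real M))))\<^sup>2)"
    by (rule Parseval_finite[OF M XM, symmetric])
  also have "\<dots> \<le> (\<Sum>k<M. S\<^sup>2 * (cmod (\<Sum>m\<in>W. f m * ee (of_int m * (- real k / real M))))\<^sup>2)"
    unfolding hat norm_mult power_mult_distrib by (intro sum_mono mult_right_mono power_mono S) auto
  also have "\<dots> = real M * (S\<^sup>2 * (\<Sum>m\<in>W. (cmod (f m))\<^sup>2))"
    using Parseval_finite[OF M, of W "-K" f] sub XM by (simp flip: sum_distrib_left)
  finally have "(\<Sum>l\<in>X. (cmod (T l))\<^sup>2) \<le> S\<^sup>2 * (\<Sum>m\<in>W. (cmod (f m))\<^sup>2)" using M by simp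
  moreover have "(\<Sum>l\<in>Y. (cmod (T l))\<^sup>2) \<le> (\<Sum>l\<in>X. (cmod (T l))\<^sup>2)"
    using sub by (intro sum_mono2) (auto simp: X_def)
  ultimately show ?thesis by (simp add: T_def)
qed

text \<open>Size and regularity of the truncations of \<open>1 / l\<close>. Regularity is demanded on each half line only, in
  the exact form that \<open>1 / l\<close> itself satisfies.\<close>

definition odd_cz :: "real \<Rightarrow> (int \<Rightarrow> complex) \<Rightarrow> bool" where
  "odd_cz D \<kappa> \<longleftrightarrow> D \<ge> 0 \<and> finite {l. \<kappa> l \<noteq> 0} \<and> (\<forall>l. \<kappa> (-l) = - \<kappa> l) \<and> (\<forall>l. cmod (\<kappa> l) * \<bar>real_of_int l\<bar> \<le> D) \<and>
     (\<forall>l l'. l * l' > 0 \<longrightarrow> cmod (\<kappa> l - \<kappa> l') \<le> D * \<bar>real_of_int (l - l')\<bar> / real_of_int (l * l'))"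

lemma odd_cz_tail:
  assumes \<kappa>: "odd_cz D \<kappa>" and sup: "\<And>l. \<bar>l\<bar> > R \<Longrightarrow> \<kappa> l = 0" and n: "n \<ge> 1"
  shows "cmod (1 - ee x) * cmod (\<Sum>l\<in>{n..R}. \<kappa> l * ee (of_int l * x)) \<le> 2 * D / of_int n"
proof -
  have D: "D \<ge> 0" using \<kappa> by (simp add: odd_cz_def)
  define a where "a l = (if n \<le> l then \<kappa> l else 0)" for l
  show ?thesis
  proof (cases "n \<le> R")
    case False
    then show ?thesis using D n by simp
  next
    case True
    have "(\<Sum>l\<in>{n..R}. \<kappa> l * ee (of_int l * x)) = (\<Sum>l\<in>{n..<R + 1}. a l * ee (of_int l * x))"
      by (intro sum.cong) (auto simp: a_def)
    then have "cmod (1 - ee x) * cmod (\<Sum>l\<in>{n..R}. \<kappa> l * ee (of_int l * x)) \<le> (\<Sum>m\<in>{n..R + 1}. cmod (a m - a (m - 1)))"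
      using sup n by (simp only:) (intro summation_by_parts_bound, auto simp: a_def)
    also have "\<dots> = cmod (\<kappa> n) + (\<Sum>m\<in>{n + 1..R + 1}. cmod (\<kappa> m - \<kappa> (m - 1)))"
    proof -
      have "{n..R + 1} = insert n {n + 1..R + 1}" using True by auto
      then have "(\<Sum>m\<in>{n..R + 1}. cmod (a m - a (m - 1))) = cmod (a n - a (n - 1)) + (\<Sum>m\<in>{n + 1..R + 1}. cmod (a m - a (m - 1)))" by simp
      then show ?thesis by (simp add: a_def)
    qed
    also have "cmod (\<kappa> n) \<le> D / of_int n"
      using \<kappa> n by (auto simp: odd_cz_def field_simps) (metis abs_of_pos mult.commute of_int_0_less_iff zero_less_one_class.zero_less_one order_less_le_trans)
    also have "(\<Sum>m\<in>{n + 1..R + 1}. cmod (\<kappa> m - \<kappa> (m - 1))) \<le> (\<Sum>m\<in>{n + 1..R + 1}. D * (1 / of_int (m - 1) - 1 / of_int m))"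
    proof (rule sum_mono)
      fix m assume m: "m \<in> {n + 1..R + 1}"
      then have "m * (m - 1) > 0" using n by auto
      then have "cmod (\<kappa> m - \<kappa> (m - 1)) \<le> D * \<bar>real_of_int (m - (m - 1))\<bar> / real_of_int (m * (m - 1))"
        using \<kappa> unfolding odd_cz_def by blast
      also have "\<dots> = D * (1 / of_int (m - 1) - 1 / of_int m)"
      proof -
        have "real_of_int m \<noteq> 0" "real_of_int (m - 1) \<noteq> 0" using m n by auto
        then show ?thesis by (simp add: field_simps)
      qed
      finally show "cmod (\<kappa> m - \<kappa> (m - 1)) \<le> D * (1 / of_int (m - 1) - 1 / of_int m)" .
    qed
    also have "\<dots> = D * (\<Sum>m\<in>{n + 1..R + 1}. 1 / of_int (m - 1) - 1 / of_int m)" by (simp add: sum_distrib_left)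
    also have "\<dots> \<le> D * (1 / of_int n)"
    proof (intro mult_left_mono D)
      have tel: "(\<Sum>m\<in>{n + 1..n + int k}. 1 / real_of_int (m - 1) - 1 / of_int m) = 1 / of_int n - 1 / of_int (n + int k)" for k
      proof (induction k)
        case (Suc k)
        have "{n + 1..n + int (Suc k)} = insert (n + int (Suc k)) {n + 1..n + int k}" by auto
        then show ?case using Suc by simp
      qed simp
      have "R + 1 = n + int (nat (R + 1 - n))" using True by simp
      then have "(\<Sum>m\<in>{n + 1..R + 1}. 1 / real_of_int (m - 1) - 1 / of_int m) = 1 / of_int n - 1 / of_int (R + 1)"
        using tel[of "nat (R + 1 - n)"] by simp
      then show "(\<Sum>m\<in>{n + 1..R + 1}. 1 / real_of_int (m - 1) - 1 / of_int m) \<le> 1 / of_int n"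
        using True n by simp
    qed
    finally show ?thesis by simp
  qed
qed

text \<open>The symbol of an odd kernel is a sine series. Below the reciprocal of the frequency the
  sine cancels the singularity of the kernel, and above it the sum converges by summation by parts.\<close>

lemma odd_cz_symbol_bound:
  assumes \<kappa>: "odd_cz D \<kappa>" and sup: "\<And>l. \<bar>l\<bar> > R \<Longrightarrow> \<kappa> l = 0"
  shows "cmod (\<Sum>l\<in>{-R..R}. \<kappa> l * ee (of_int l * x)) \<le> 10 * D"
proof -
  have D: "D \<ge> 0" using \<kappa> by (simp add: odd_cz_def)
  have odd: "\<kappa> (-l) = - \<kappa> l" for l using \<kappa> by (simp add: odd_cz_def)
  have k0: "\<kappa> 0 = 0" using odd[of 0] by simp
  have "(\<Sum>l\<in>{-R..R}. \<kappa> l * ee (of_int l * x)) = (\<Sum>l\<in>{1..R}. \<kappa> l * ee (of_int l * x)) + (\<Sum>l\<in>{-R..-1}. \<kappa> l * ee (of_int l * x))"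
  proof -
    have "(\<Sum>l\<in>{-R..R}. \<kappa> l * ee (of_int l * x)) = (\<Sum>l\<in>{1..R} \<union> {-R..-1}. \<kappa> l * ee (of_int l * x))"
      using k0 by (intro sum.mono_neutral_right) (auto, metis linorder_neqE_linordered_idom not_le zle_iff_zadd int_one_le_iff_zero_less zle_diff1_eq diff_0)
    then show ?thesis by (simp add: sum.union_disjoint)
  qed
  also have "(\<Sum>l\<in>{-R..-1}. \<kappa> l * ee (of_int l * x)) = (\<Sum>l\<in>{1..R}. - \<kappa> l * ee (of_int l * (-x)))"
    by (rule sum.reindex_bij_witness[of _ uminus uminus]) (auto simp: odd)
  finally have split: "(\<Sum>l\<in>{-R..R}. \<kappa> l * ee (of_int l * x)) = (\<Sum>l\<in>{1..R}. \<kappa> l * (ee (of_int l * x) - ee (of_int l * (-x))))"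
    by (simp add: sum_negf sum_subtractf right_diff_distrib)
  define \<delta> where "\<delta> = cmod (1 - ee x)"
  have \<delta>2: "\<delta> \<le> 2" unfolding \<delta>_def using norm_triangle_ineq4[of 1 "ee x"] by simp
  have \<delta>': "cmod (1 - ee (-x)) = \<delta>" unfolding \<delta>_def by (rule norm_1_minus_ee_uminus)
  have small: "cmod (ee (of_int l * x) - ee (of_int l * (-x))) \<le> 2 * of_int l * \<delta>" if "l \<ge> 1" for l :: int
  proof -
    have l: "real_of_int l = real (nat l)" using that by simp
    have "cmod (ee (of_int l * x) - 1) \<le> of_int l * \<delta>"
      using norm_ee_multiple_diff[of "nat l" x] that by (simp add: \<delta>_def norm_minus_commute)
    moreover have "cmod (ee (of_int l * (-x)) - 1) \<le> of_int l * \<delta>"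
      using norm_ee_multiple_diff[of "nat l" "-x"] that \<delta>' by (simp add: norm_minus_commute)
    ultimately show ?thesis
      using norm_triangle_ineq4[of "ee (of_int l * x) - 1" "ee (of_int l * (-x)) - 1"] by simp
  qed
  show ?thesis
  proof (cases "\<delta> = 0")
    case True
    have "\<kappa> l * (ee (of_int l * x) - ee (of_int l * (-x))) = 0" if "l \<in> {1..R}" for l
    proof -
      have "cmod (ee (of_int l * x) - ee (of_int l * (-x))) \<le> 0" using small[of l] that True by simp
      then show ?thesis by simp
    qed
    then have "(\<Sum>l\<in>{-R..R}. \<kappa> l * ee (of_int l * x)) = 0" unfolding split by (intro sum.neutral) blast
    then show ?thesis using D by simp
  next
    case False
    then have \<delta>: "\<delta> > 0" by (simp add: \<delta>_def)
    define n where "n = \<lceil>1 / \<delta>\<rceil>"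
    have n: "1 / \<delta> \<le> of_int n" "of_int n \<le> 1 / \<delta> + 1" "n \<ge> 1"
      using \<delta> by (auto simp: n_def)
    have sp: "(\<Sum>l\<in>{1..R}. z l) = (\<Sum>l\<in>{1..R} \<inter> {..n}. z l) + (\<Sum>l\<in>{n + 1..R}. z l)" for z :: "int \<Rightarrow> complex"
    proof -
      have "{1..R} = ({1..R} \<inter> {..n}) \<union> {n + 1..R}" using n(3) by auto
      moreover have "({1..R} \<inter> {..n}) \<inter> {n + 1..R} = {}" by auto
      ultimately show ?thesis by (metis finite_Int finite_atLeastAtMost_int sum.union_disjoint)
    qed
    have "cmod (\<Sum>l\<in>{1..R} \<inter> {..n}. \<kappa> l * (ee (of_int l * x) - ee (of_int l * (-x)))) \<le> (\<Sum>l\<in>{1..R} \<inter> {..n}. 2 * D * \<delta>)"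
    proof (intro order_trans[OF norm_sum] sum_mono)
      fix l assume l: "l \<in> {1..R} \<inter> {..n}"
      have "cmod (\<kappa> l * (ee (of_int l * x) - ee (of_int l * (-x)))) \<le> cmod (\<kappa> l) * (2 * of_int l * \<delta>)"
        unfolding norm_mult using small[of l] l by (intro mult_left_mono) auto
      also have "\<dots> = (cmod (\<kappa> l) * \<bar>of_int l\<bar>) * (2 * \<delta>)" using l by simp
      also have "\<dots> \<le> D * (2 * \<delta>)" using \<kappa> \<delta> by (intro mult_right_mono) (auto simp: odd_cz_def)
      finally show "cmod (\<kappa> l * (ee (of_int l * x) - ee (of_int l * (-x)))) \<le> 2 * D * \<delta>" by simp
    qed
    also have "\<dots> = real (card ({1..R} \<inter> {..n})) * (2 * D * \<delta>)" by simp
    also have "\<dots> \<le> of_int n * (2 * D * \<delta>)"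
    proof (intro mult_right_mono)
      have "card ({1..R} \<inter> {..n}) \<le> card {1..n}" by (intro card_mono) auto
      then show "real (card ({1..R} \<inter> {..n})) \<le> of_int n" using n(3) by simp
    qed (use D \<delta> in auto)
    also have "\<dots> \<le> (1 / \<delta> + 1) * (2 * D * \<delta>)" using n D \<delta> by (intro mult_right_mono) auto
    also have "\<dots> = 2 * D * (1 + \<delta>)" using \<delta> by (simp add: field_simps)
    also have "\<dots> \<le> 2 * D * 3" using \<delta>2 D by (intro mult_left_mono) auto
    finally have p1: "cmod (\<Sum>l\<in>{1..R} \<inter> {..n}. \<kappa> l * (ee (of_int l * x) - ee (of_int l * (-x)))) \<le> 6 * D" by simp
    have tail: "cmod (\<Sum>l\<in>{n + 1..R}. \<kappa> l * ee (of_int l * y)) \<le> 2 * D" if "cmod (1 - ee y) = \<delta>" for y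
    proof -
      have "\<delta> * cmod (\<Sum>l\<in>{n + 1..R}. \<kappa> l * ee (of_int l * y)) \<le> 2 * D / of_int (n + 1)"
        using odd_cz_tail[OF \<kappa> sup, where n = "n + 1" and x = y] n(3) that by simp
      also have "\<dots> \<le> 2 * D / (1 / \<delta>)" using n D \<delta> by (intro divide_left_mono) auto
      also have "\<dots> = \<delta> * (2 * D)" by simp
      finally show ?thesis using \<delta> by simp
    qed
    define z where "z l = \<kappa> l * (ee (of_int l * x) - ee (of_int l * (-x)))" for l
    have "(\<Sum>l\<in>{n + 1..R}. z l) = (\<Sum>l\<in>{n + 1..R}. \<kappa> l * ee (of_int l * x)) - (\<Sum>l\<in>{n + 1..R}. \<kappa> l * ee (of_int l * (-x)))"
      by (simp add: z_def right_diff_distrib sum_subtractf)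
    also have "cmod \<dots> \<le> cmod (\<Sum>l\<in>{n + 1..R}. \<kappa> l * ee (of_int l * x)) + cmod (\<Sum>l\<in>{n + 1..R}. \<kappa> l * ee (of_int l * (-x)))"
      by (rule norm_triangle_ineq4)
    also have "\<dots> \<le> 2 * D + 2 * D" by (intro add_mono tail \<delta>') (simp add: \<delta>_def)
    finally have p2: "cmod (\<Sum>l\<in>{n + 1..R}. z l) \<le> 4 * D" by simp
    have "(\<Sum>l\<in>{-R..R}. \<kappa> l * ee (of_int l * x)) = (\<Sum>l\<in>{1..R} \<inter> {..n}. z l) + (\<Sum>l\<in>{n + 1..R}. z l)"
      unfolding split z_def by (rule sp)
    also have "cmod \<dots> \<le> cmod (\<Sum>l\<in>{1..R} \<inter> {..n}. z l) + cmod (\<Sum>l\<in>{n + 1..R}. z l)"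
      by (rule norm_triangle_ineq)
    also have "\<dots> \<le> 6 * D + 4 * D" using p1 p2 unfolding z_def by (intro add_mono)
    finally show ?thesis by simp
  qed
qed

lemma odd_cz_l2:
  assumes \<kappa>: "odd_cz D \<kappa>" and "finite W" "finite Y"
  shows "(\<Sum>l\<in>Y. (cmod (\<Sum>m\<in>W. \<kappa> (l - m) * f m))\<^sup>2) \<le> (10 * D)\<^sup>2 * (\<Sum>m\<in>W. (cmod (f m))\<^sup>2)"
proof -
  define R where "R = Max (insert 0 (abs ` {l. \<kappa> l \<noteq> 0}))"
  have fin: "finite {l. \<kappa> l \<noteq> 0}" using \<kappa> by (simp add: odd_cz_def)
  have "\<kappa> l = 0" if "\<bar>l\<bar> > R" for l
  proof (rule ccontr)
    assume "\<kappa> l \<noteq> 0"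
    then have "\<bar>l\<bar> \<le> R" unfolding R_def using fin by (intro Max_ge) auto
    with that show False by simp
  qed
  then show ?thesis using odd_cz_symbol_bound[OF \<kappa>, of R] assms by (intro multiplier_bound) auto
qed

definition pairing_const :: "real \<Rightarrow> real" where
  "pairing_const D = cz_const 2 ((10 * D)\<^sup>2) D * (max_const (9/2) powr (1/9) * max_const (9/8) powr (8/9))"

lemma pairing_const_nonneg: "pairing_const D \<ge> 0"
  by (simp add: pairing_const_def cz_const_def)

text \<open>With \<open>p = 2\<close> the stopping-time bound controls the form by the square function average of
  one argument and the plain average of the other. This gives \<open>\<ell>\<^sup>9\<close> from \<open>\<ell>\<^sup>2\<close>.\<close>

lemma odd_cz_pairing:
  assumes \<kappa>: "odd_cz D \<kappa>" and W: "finite W" and Y: "finite Y"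
  shows "cmod (\<Sum>l\<in>Y. g l * (\<Sum>m\<in>W. \<kappa> (l - m) * f m))
     \<le> pairing_const D * ((\<Sum>m\<in>W. cmod (f m) powr 9) powr (1/9) * (\<Sum>l\<in>Y. cmod (g l) powr (9/8)) powr (8/9))"
proof -
  have D: "D \<ge> 0" using \<kappa> by (simp add: odd_cz_def)
  define F where "F m u = (if m \<in> W then f m else 0)" for m and u :: unit
  define B where "B l u = (if l \<in> Y then g l else 0)" for l and u :: unit
  define V1 where "V1 m = cmod (F m ()) powr 2" for m
  define V2 where "V2 l = cmod (B l ())" for l
  define k where "k = nat (Max (insert 1 (abs ` (W \<union> Y)))) + 1"
  have kb: "\<bar>m\<bar> < 2 ^ k" if "m \<in> W \<union> Y" for m
  proof -
    have "\<bar>m\<bar> \<le> Max (insert 1 (abs ` (W \<union> Y)))" using W Y that by (intro Max_ge) auto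
    then have "\<bar>m\<bar> < int k" unfolding k_def by linarith
    also have "int k < 2 ^ k" by (rule of_nat_less_two_power)
    finally show ?thesis .
  qed
  define c :: int where "c = - (2 ^ k)"
  define Q where "Q = {c..<c + 2 ^ Suc k}"
  define Q3 where "Q3 = {c - 2 ^ Suc k..<c + 2 * 2 ^ Suc k}"
  have sub: "Y \<subseteq> Q" "W \<subseteq> Q3" "finite Q" "finite Q3" using kb by (force simp: Q_def Q3_def c_def)+
  have mx1: "\<And>m. V1 m \<ge> 0" "\<And>m. m \<notin> W \<Longrightarrow> V1 m = 0" by (auto simp: V1_def F_def)
  have mx2: "\<And>m. V2 m \<ge> 0" "\<And>m. m \<notin> Y \<Longrightarrow> V2 m = 0" by (auto simp: V2_def B_def)
  define \<Phi> where "\<Phi> l = maxfn V1 l powr (1/2) * maxfn V2 l" for l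
  have "cmod (\<Sum>l\<in>Q. \<Sum>x\<in>{()}. B l x * (\<Sum>m\<in>Q3. \<kappa> (l - m) * F m x)) \<le> cz_const 2 ((10 * D)\<^sup>2) D * (\<Sum>l\<in>Q. \<Phi> l)"
    unfolding Q_def Q3_def
  proof (rule stopping_time_bound[where G = V2])
    show "(\<Sum>l\<in>Y. cmod (\<Sum>m\<in>W. \<kappa> (l - m) * h m) powr 2) \<le> (10 * D)\<^sup>2 * (\<Sum>m\<in>W. cmod (h m) powr 2)"
      if "finite W" "finite Y" for W Y h
      using odd_cz_l2[OF \<kappa> that] by simp
    show "cmod (\<kappa> l - \<kappa> l') \<le> D * \<bar>real_of_int (l - l')\<bar> / real_of_int (l * l')" if "l * l' > 0" for l l'
      using \<kappa> that by (simp add: odd_cz_def)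
    show "avg {c - 2 ^ k..<c + 2 * 2 ^ k} (\<lambda>m. \<Sum>x\<in>{()}. cmod (F m x) powr 2) powr (1 / 2) * avg {c..<c + 2 ^ k} V2 \<le> \<Phi> l"
      if l: "l \<in> {c..<c + 2 ^ k}" for c k l
    proof -
      have p2: "(2::int) ^ k > 0" by simp
      have r: "c - 2 ^ k \<le> l" "l < c + 2 * 2 ^ k" using l p2 by (auto intro: less_trans)
      have "avg {c - 2 ^ k..<c + 2 * 2 ^ k} V1 \<le> maxfn V1 l"
        using r by (intro avg_le_maxfn[OF W mx1])
      moreover have "avg {c..<c + 2 ^ k} V2 \<le> maxfn V2 l"
        using l by (intro avg_le_maxfn[OF Y mx2]) auto
      ultimately have "avg {c - 2 ^ k..<c + 2 * 2 ^ k} V1 powr (1/2) * avg {c..<c + 2 ^ k} V2 \<le> \<Phi> l"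
        unfolding \<Phi>_def using mx1 mx2 by (intro mult_mono powr_mono2 avg_nonneg) auto
      then show ?thesis unfolding V1_def by simp
    qed
  qed (use D in \<open>auto simp: V2_def norm_mult powr_powr\<close>)
  also have "(\<Sum>l\<in>Q. \<Sum>x\<in>{()}. B l x * (\<Sum>m\<in>Q3. \<kappa> (l - m) * F m x)) = (\<Sum>l\<in>Y. g l * (\<Sum>m\<in>W. \<kappa> (l - m) * f m))"
  proof -
    have "(\<Sum>m\<in>Q3. \<kappa> (l - m) * F m ()) = (\<Sum>m\<in>W. \<kappa> (l - m) * f m)" for l
      using sub by (intro sum.mono_neutral_cong_right) (auto simp: F_def)
    then show ?thesis using sub by (intro sum.mono_neutral_cong_right) (auto simp: B_def)
  qed
  also have "(\<Sum>l\<in>Q. \<Phi> l) \<le> max_const (9/2) powr (1/9) * max_const (9/8) powr (8/9)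
      * ((\<Sum>m\<in>W. cmod (f m) powr 9) powr (1/9) * (\<Sum>l\<in>Y. cmod (g l) powr (9/8)) powr (8/9))"
  proof -
    have "(\<Sum>l\<in>Q. \<Phi> l) = (\<Sum>l\<in>Q. (maxfn V1 l powr (9/2)) powr (1/9) * (maxfn V2 l powr (9/8)) powr (8/9))"
      unfolding \<Phi>_def using maxfn_nonneg[OF Y mx2] by (simp add: powr_powr)
    also have "\<dots> \<le> (\<Sum>l\<in>Q. maxfn V1 l powr (9/2)) powr (1/9) * (\<Sum>l\<in>Q. maxfn V2 l powr (9/8)) powr (8/9)"
      using sub by (intro Holder_sum) auto
    also have "\<dots> \<le> (max_const (9/2) * (\<Sum>m\<in>W. V1 m powr (9/2))) powr (1/9) * (max_const (9/8) * (\<Sum>l\<in>Y. V2 l powr (9/8))) powr (8/9)"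
      using maximal_strong_type[OF W mx1, where s = "9/2" and Y = Q] maximal_strong_type[OF Y mx2, where s = "9/8" and Y = Q] sub
      by (intro mult_mono powr_mono2) (auto intro: sum_nonneg)
    also have "(\<Sum>m\<in>W. V1 m powr (9/2)) = (\<Sum>m\<in>W. cmod (f m) powr 9)"
      by (intro sum.cong refl) (simp add: V1_def F_def powr_powr del: powr_numeral)
    also have "(\<Sum>l\<in>Y. V2 l powr (9/8)) = (\<Sum>l\<in>Y. cmod (g l) powr (9/8))"
      by (simp add: V2_def B_def)
    finally show ?thesis
      using max_const_nonneg[of "9/2"] max_const_nonneg[of "9/8"]
      by (simp add: powr_mult sum_nonneg mult_ac)
  qed
  finally show ?thesis by (simp add: pairing_const_def mult_left_mono cz_const_def mult.assoc)
qed

text \<open>Since the kernel is odd, the transposed operator is the negative of the operator itself, so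
  the \<open>\<ell>\<^sup>9\<close> bound dualises to the conjugate exponent \<open>9/8\<close>.\<close>

lemma odd_cz_lp:
  assumes \<kappa>: "odd_cz D \<kappa>" and W: "finite W" and Y: "finite Y"
  shows "(\<Sum>l\<in>Y. cmod (\<Sum>m\<in>W. \<kappa> (l - m) * g m) powr (9/8)) \<le> pairing_const D powr (9/8) * (\<Sum>m\<in>W. cmod (g m) powr (9/8))"
proof -
  define u where "u l = (\<Sum>m\<in>W. \<kappa> (l - m) * g m)" for l
  define X where "X = (\<Sum>l\<in>Y. cmod (u l) powr (9/8))"
  \<comment> \<open>The function that is extremal for the duality between the exponents \<open>9/8\<close> and \<open>9\<close>.\<close>
  define f where "f l = cnj (u l) * complex_of_real (cmod (u l) powr (-7/8))" for l
  have X0: "X \<ge> 0" by (simp add: X_def sum_nonneg)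
  define GG where "GG = (\<Sum>m\<in>W. cmod (g m) powr (9/8))"
  have GG: "GG \<ge> 0" by (simp add: GG_def sum_nonneg)
  have fu: "f l * u l = complex_of_real (cmod (u l) powr (9/8))" for l
  proof (cases "u l = 0")
    case False
    have "f l * u l = (u l * cnj (u l)) * complex_of_real (cmod (u l) powr (-7/8))" by (simp add: f_def)
    also have "u l * cnj (u l) = complex_of_real (cmod (u l) powr 2)"
      by (simp only: complex_norm_square[symmetric]) simp
    finally have "f l * u l = complex_of_real (cmod (u l) powr 2 * cmod (u l) powr (-7/8))" by simp
    then show ?thesis unfolding powr_add[symmetric] by simp
  qed (simp add: f_def)
  have nf: "cmod (f l) powr 9 = cmod (u l) powr (9/8)" for l
  proof (cases "u l = 0")
    case False
    then have "cmod (f l) = cmod (u l) powr 1 * cmod (u l) powr (-7/8)" by (simp add: f_def norm_mult)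
    also have "\<dots> = cmod (u l) powr (1/8)" unfolding powr_add[symmetric] by simp
    finally show ?thesis by (simp add: powr_powr)
  qed (simp add: f_def)
  have odd: "\<kappa> (l - m) = - \<kappa> (m - l)" for l m
  proof -
    have "\<kappa> (- (m - l)) = - \<kappa> (m - l)" using \<kappa> unfolding odd_cz_def by blast
    then show ?thesis by simp
  qed
  have "complex_of_real X = (\<Sum>l\<in>Y. f l * u l)" by (simp add: X_def fu)
  also have "\<dots> = (\<Sum>l\<in>Y. \<Sum>m\<in>W. f l * (\<kappa> (l - m) * g m))" by (simp add: u_def sum_distrib_left)
  also have "\<dots> = (\<Sum>m\<in>W. \<Sum>l\<in>Y. f l * (\<kappa> (l - m) * g m))" by (rule sum.swap)
  also have "\<dots> = - (\<Sum>m\<in>W. g m * (\<Sum>l\<in>Y. \<kappa> (m - l) * f l))"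
  proof -
    have "f l * (\<kappa> (l - m) * g m) = - (g m * (\<kappa> (m - l) * f l))" for l m
      unfolding odd[of l m] by simp
    then show ?thesis by (simp only: sum_negf sum_distrib_left)
  qed
  finally have "cmod (complex_of_real X) = cmod (\<Sum>m\<in>W. g m * (\<Sum>l\<in>Y. \<kappa> (m - l) * f l))"
    by (simp only: norm_minus_cancel)
  then have "X = cmod (\<Sum>m\<in>W. g m * (\<Sum>l\<in>Y. \<kappa> (m - l) * f l))"
    using X0 by (simp only: norm_of_real abs_of_nonneg)
  also have "\<dots> \<le> pairing_const D * (X powr (1/9) * GG powr (8/9))"
    using odd_cz_pairing[OF \<kappa> Y W, of g f] unfolding nf X_def GG_def .
  finally have le: "X \<le> pairing_const D * (X powr (1/9) * GG powr (8/9))" .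
  have "X \<le> pairing_const D powr (9/8) * GG"
  proof (cases "X = 0")
    case True
    then show ?thesis using GG by simp
  next
    case False
    then have Xp: "X > 0" using X0 by simp
    have "X powr (8/9) * X powr (1/9) = X" unfolding powr_add[symmetric] using Xp by simp
    then have "X powr (8/9) * X powr (1/9) \<le> (pairing_const D * GG powr (8/9)) * X powr (1/9)" using le by (simp add: mult_ac)
    then have "X powr (8/9) \<le> pairing_const D * GG powr (8/9)" using Xp by simp
    then have "(X powr (8/9)) powr (9/8) \<le> (pairing_const D * GG powr (8/9)) powr (9/8)" by (intro powr_mono2) auto
    then show ?thesis using Xp GG pairing_const_nonneg by (simp add: powr_powr powr_mult)
  qed
  then show ?thesis by (simp add: X_def GG_def u_def)
qed

section \<open>Diophantine sums\<close>

lemma norm_1_minus_ee_ge: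
  assumes "\<bar>x\<bar> \<le> 1/2"
  shows "cmod (1 - ee x) \<ge> 2 * \<bar>x\<bar>"
proof -
  have pos: "cmod (1 - ee y) \<ge> 2 * y" if y: "0 < y" "y \<le> 1/2" for y
  proof -
    \<comment> \<open>Some multiple of \<open>y\<close> lies in the half circle where \<open>1 - ee z\<close> has norm at least one.\<close>
    define n where "n = nat \<lfloor>1 / (2 * y)\<rfloor>"
    have n1: "real n \<le> 1 / (2 * y)" "1 / (2 * y) < real n + 1"
      using y unfolding n_def by (simp_all add: of_nat_floor)
    have "1 \<le> 1 / (2 * y)" using y by (simp add: field_simps)
    then have "1 \<le> \<lfloor>1 / (2 * y)\<rfloor>" by (simp add: le_floor_iff)
    then have n0: "n \<ge> 1" unfolding n_def by linarith
    have up: "real n * y \<le> 1/2" using n1 y by (simp add: field_simps)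
    have lo: "1/4 \<le> real n * y"
    proof (cases "y \<le> 1/4")
      case True
      have "1/2 < (real n + 1) * y" using n1(2) y by (simp add: field_simps)
      then show ?thesis using True by (simp add: distrib_right)
    next
      case False
      then have "1/4 \<le> 1 * y" by simp
      also have "\<dots> \<le> real n * y" using n0 y by (intro mult_right_mono) auto
      finally show ?thesis .
    qed
    have "cos (2 * pi * (real n * y)) \<le> cos (pi / 2)"
    proof (rule cos_monotone_0_pi_le)
      have "2 * pi * (1/4) \<le> 2 * pi * (real n * y)" using lo by (intro mult_left_mono) auto
      then show "pi / 2 \<le> 2 * pi * (real n * y)" by simp
      have "2 * pi * (real n * y) \<le> 2 * pi * (1/2)" using up by (intro mult_left_mono) auto
      then show "2 * pi * (real n * y) \<le> pi" by simp
    qed auto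
    then have "Re (ee (real n * y)) \<le> 0" by (simp add: ee_def)
    then have "1 \<le> \<bar>Re (ee (real n * y) - 1)\<bar>" by simp
    also have "\<dots> \<le> cmod (ee (real n * y) - 1)" by (rule abs_Re_le_cmod)
    also have "\<dots> \<le> real n * cmod (ee y - 1)" by (rule norm_ee_multiple_diff)
    also have "\<dots> \<le> 1 / (2 * y) * cmod (ee y - 1)" using n1 by (intro mult_right_mono) auto
    finally show ?thesis using y by (simp add: field_simps norm_minus_commute)
  qed
  consider "x = 0" | "0 < x" | "x < 0" by linarith
  then show ?thesis using pos[of x] pos[of "-x"] assms norm_1_minus_ee_uminus[of x] by cases auto
qed

text \<open>A bound for \<open>min 1 (1 / x)\<close>. Giving up half of the decay keeps logarithms out of
  the sums below.\<close>

definition damp :: "real \<Rightarrow> real" where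
  "damp x = (if x \<le> 1 then 1 else x powr (-1/2))"

lemma damp_bounds: "0 \<le> damp x" "damp x \<le> 1"
proof -
  have "x powr (-1/2) \<le> 1 powr (-1/2)" if "1 < x" using that by (intro powr_mono2') auto
  then show "0 \<le> damp x" "damp x \<le> 1" by (auto simp: damp_def)
qed

lemma damp_le:
  assumes "0 < y" "y \<le> x"
  shows "damp x \<le> y powr (-1/2)"
proof (cases "x \<le> 1")
  case True
  then have "1 powr (-1/2) \<le> y powr (-1/2)" using assms by (intro powr_mono2') auto
  then show ?thesis using True by (simp add: damp_def)
next
  case False
  then show ?thesis using assms by (simp add: damp_def powr_mono2')
qed

lemma min_le_damp:
  assumes "x \<ge> 0" "z \<le> 1" "z * x \<le> 1"
  shows "z \<le> damp x"
proof (cases "x \<le> 1")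
  case False
  then have "z \<le> 1 / x" using assms by (simp add: field_simps)
  also have "\<dots> = x powr (-1)" using False by (simp add: powr_minus_divide)
  also have "\<dots> \<le> x powr (-1/2)" using False by (intro powr_mono) auto
  finally show ?thesis using False by (simp add: damp_def)
qed (use assms in \<open>simp add: damp_def\<close>)

lemma sum_inv_sqrt: "(\<Sum>t\<in>{1..int n}. real_of_int t powr (-1/2)) \<le> 2 * sqrt (real n)"
proof (induction n)
  case (Suc n)
  have "{1..int (Suc n)} = insert (int (Suc n)) {1..int n}" by auto
  then have "(\<Sum>t\<in>{1..int (Suc n)}. real_of_int t powr (-1/2)) = real (Suc n) powr (-1/2) + (\<Sum>t\<in>{1..int n}. real_of_int t powr (-1/2))"
    by simp
  also have "\<dots> \<le> 1 / sqrt (real (Suc n)) + 2 * sqrt (real n)"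
    using Suc by (simp add: powr_minus_divide powr_half_sqrt)
  also have "\<dots> \<le> 2 * sqrt (real (Suc n))"
  proof -
    define s t where "s = sqrt (real (Suc n))" and "t = sqrt (real n)"
    have st: "s > 0" "t \<ge> 0" "s\<^sup>2 = t\<^sup>2 + 1" by (auto simp: s_def t_def)
    have "0 \<le> (s - t)\<^sup>2" by simp
    then have "0 \<le> s\<^sup>2 + t\<^sup>2 - 2 * s * t" by (simp only: power2_diff)
    moreover have "2 * t * s = 2 * s * t" by simp
    ultimately have "1 + 2 * t * s \<le> 2 * s\<^sup>2" using st(3) by linarith
    then have "(1 + 2 * t * s) / s \<le> 2 * s\<^sup>2 / s" using st by (intro divide_right_mono) auto
    then show ?thesis using st unfolding s_def[symmetric] t_def[symmetric]
      by (simp add: add_divide_distrib power2_eq_square)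
  qed
  finally show ?case .
qed simp

context
  fixes N q b :: int and \<beta> \<theta> :: real
  assumes N: "N \<ge> 1" and q: "1 \<le> q" "q \<le> 8 * N" and bq: "coprime b q"
    and \<theta>: "\<theta> = \<beta> - of_int b / of_int q" "\<bar>\<theta>\<bar> \<le> 1 / (8 * of_int N * of_int q)"
begin

lemma \<theta>h_small: "\<bar>h\<bar> \<le> 4 * N \<Longrightarrow> \<bar>\<theta> * of_int h\<bar> \<le> 1 / (2 * of_int q)"
proof -
  assume "\<bar>h\<bar> \<le> 4 * N"
  then have "real_of_int \<bar>h\<bar> \<le> real_of_int (4 * N)" by (simp only: of_int_le_iff)
  then have "\<bar>\<theta> * of_int h\<bar> \<le> 1 / (8 * of_int N * of_int q) * (4 * of_int N)"
    unfolding abs_mult using \<theta>(2) N q by (intro mult_mono) auto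
  also have "\<dots> = 1 / (2 * of_int q)" using N q by (simp add: field_simps)
  finally show ?thesis .
qed

text \<open>For a multiple \<open>h\<close> of \<open>q\<close> the number \<open>\<beta> h\<close> differs from an integer by \<open>\<theta> h\<close>.\<close>

lemma multiples_of_denominator:
  "(\<Sum>h\<in>{h\<in>{-4*N..4*N}. q dvd h \<and> h \<noteq> 0}. damp (of_int N * cmod (1 - ee (\<beta> * of_int h))))
     \<le> 8 * (of_int N / of_int q) * damp ((of_int N)\<^sup>2 * \<bar>\<theta>\<bar>)"
proof -
  define n where "n = nat (4 * N div q)"
  have n: "real n \<le> 4 * of_int N / of_int q"
  proof -
    have "real n = of_int (4 * N div q)" using N q by (simp add: n_def pos_imp_zdiv_nonneg_iff)
    also have "\<dots> \<le> of_int (4 * N) / of_int q" by (rule real_of_int_div4)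
    finally show ?thesis by simp
  qed
  define T where "T = {1..int n}"
  have fT: "finite T" by (simp add: T_def)
  define g where "g h = damp (of_int N * cmod (1 - ee (\<beta> * of_int h)))" for h :: int
  have g_even: "g (-h) = g h" for h by (simp add: g_def norm_1_minus_ee_uminus)
  have g0: "g h \<ge> 0" for h by (simp add: g_def damp_bounds)
  have sub: "{h\<in>{-4*N..4*N}. q dvd h \<and> h \<noteq> 0} \<subseteq> (\<lambda>t. q * t) ` T \<union> (\<lambda>t. q * (-t)) ` T"
  proof
    fix h assume "h \<in> {h\<in>{-4*N..4*N}. q dvd h \<and> h \<noteq> 0}"
    then have h: "-4*N \<le> h" "h \<le> 4*N" "h \<noteq> 0" and "q dvd h" by auto
    then obtain t where t: "h = q * t" by (elim dvdE)
    have "q * \<bar>t\<bar> \<le> 4 * N" using h q unfolding t by (auto simp: abs_if algebra_simps)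
    then have "\<bar>t\<bar> \<le> 4 * N div q" using q by (metis mult.commute pos_imp_zdiv_pos_iff zdiv_mono1 nonzero_mult_div_cancel_right not_one_le_zero less_le_trans zero_less_one)
    then have "\<bar>t\<bar> \<in> T" using h t N q by (auto simp: T_def n_def)
    then show "h \<in> (\<lambda>t. q * t) ` T \<union> (\<lambda>t. q * (-t)) ` T"
      unfolding t by (cases "t \<ge> 0") (auto intro!: image_eqI[of _ _ "\<bar>t\<bar>"])
  qed
  have fin: "finite ((\<lambda>t. q * t) ` T)" "finite ((\<lambda>t. q * (-t)) ` T)" using fT by auto
  have "(\<Sum>h\<in>{h\<in>{-4*N..4*N}. q dvd h \<and> h \<noteq> 0}. g h) \<le> (\<Sum>h\<in>(\<lambda>t. q * t) ` T \<union> (\<lambda>t. q * (-t)) ` T. g h)"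
    using sub fin g0 by (intro sum_mono2) auto
  also have "\<dots> \<le> (\<Sum>h\<in>(\<lambda>t. q * t) ` T. g h) + (\<Sum>h\<in>(\<lambda>t. q * (-t)) ` T. g h)"
    using fin g0 by (subst sum.union_inter[symmetric]) (auto intro: sum_nonneg)
  also have "\<dots> = (\<Sum>t\<in>T. g (q * t)) + (\<Sum>t\<in>T. g (q * (-t)))"
    using q by (subst (1 2) sum.reindex) (auto simp: inj_on_def)
  also have "\<dots> = 2 * (\<Sum>t\<in>T. g (q * t))" using g_even[of "q * _"] by simp
  finally have le: "(\<Sum>h\<in>{h\<in>{-4*N..4*N}. q dvd h \<and> h \<noteq> 0}. g h) \<le> 2 * (\<Sum>t\<in>T. g (q * t))" .
  have Np: "real_of_int N > 0" "real_of_int q > 0" using N q by auto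
  have "(\<Sum>t\<in>T. g (q * t)) \<le> 4 * (of_int N / of_int q) * damp ((of_int N)\<^sup>2 * \<bar>\<theta>\<bar>)"
  proof (cases "(of_int N)\<^sup>2 * \<bar>\<theta>\<bar> \<le> 1")
    case True
    have "(\<Sum>t\<in>T. g (q * t)) \<le> (\<Sum>t\<in>T. 1)" unfolding g_def by (intro sum_mono damp_bounds)
    also have "\<dots> \<le> 4 * (of_int N / of_int q)" using n by (simp add: T_def)
    finally show ?thesis using True by (simp add: damp_def)
  next
    case False
    then have tp: "\<bar>\<theta>\<bar> > 0" by auto
    have each: "g (q * t) \<le> (2 * of_int N * \<bar>\<theta>\<bar> * of_int q) powr (-1/2) * real_of_int t powr (-1/2)" if t: "t \<in> T" for t
    proof -
      have "\<bar>q * t\<bar> \<le> 4 * N"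
      proof -
        have "0 \<le> 4 * N div q" using N q by (simp add: pos_imp_zdiv_nonneg_iff)
        then have "t \<le> 4 * N div q" using t by (auto simp: T_def n_def)
        then have "q * t \<le> q * (4 * N div q)" using q by (intro mult_left_mono) auto
        also have "\<dots> \<le> 4 * N" using q by (simp add: minus_mod_eq_mult_div[symmetric])
        finally show ?thesis using t q by (simp add: T_def)
      qed
      then have sm: "\<bar>\<theta> * of_int (q * t)\<bar> \<le> 1 / (2 * of_int q)" by (rule \<theta>h_small)
      also have "\<dots> \<le> 1 / 2" using q by (simp add: field_simps)
      finally have half: "\<bar>\<theta> * of_int (q * t)\<bar> \<le> 1/2" .
      have "\<beta> * of_int (q * t) = of_int (b * t) + \<theta> * of_int (q * t)" using Np by (simp add: \<theta>(1) field_simps)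
      then have "ee (\<beta> * of_int (q * t)) = ee (\<theta> * of_int (q * t))" by (simp only: ee_add ee_of_int mult_1)
      then have "cmod (1 - ee (\<beta> * of_int (q * t))) \<ge> 2 * \<bar>\<theta> * of_int (q * t)\<bar>"
        using norm_1_minus_ee_ge[OF half] by simp
      then have "of_int N * (2 * \<bar>\<theta> * of_int (q * t)\<bar>) \<le> of_int N * cmod (1 - ee (\<beta> * of_int (q * t)))"
        using Np by (intro mult_left_mono) auto
      moreover have "of_int N * (2 * \<bar>\<theta> * of_int (q * t)\<bar>) = 2 * of_int N * \<bar>\<theta>\<bar> * of_int q * of_int t"
        using t q by (simp add: abs_mult T_def)
      ultimately have "g (q * t) \<le> (2 * of_int N * \<bar>\<theta>\<bar> * of_int q * of_int t) powr (-1/2)"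
        unfolding g_def using t tp Np by (intro damp_le) (auto simp: T_def)
      also have "\<dots> = (2 * of_int N * \<bar>\<theta>\<bar> * of_int q) powr (-1/2) * real_of_int t powr (-1/2)"
        using t Np by (intro powr_mult)
      finally show ?thesis .
    qed
    have "(\<Sum>t\<in>T. g (q * t)) \<le> (2 * of_int N * \<bar>\<theta>\<bar> * of_int q) powr (-1/2) * (\<Sum>t\<in>T. real_of_int t powr (-1/2))"
      unfolding sum_distrib_left by (intro sum_mono each)
    also have "\<dots> \<le> (2 * of_int N * \<bar>\<theta>\<bar> * of_int q) powr (-1/2) * (2 * sqrt (4 * of_int N / of_int q))"
      using sum_inv_sqrt[of n] n unfolding T_def
      by (intro mult_left_mono order_trans[OF sum_inv_sqrt]) auto
    also have "\<dots> = 4 * (sqrt (of_int N / of_int q) / sqrt (2 * of_int N * \<bar>\<theta>\<bar> * of_int q))"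
      using Np by (simp add: powr_minus_divide powr_half_sqrt real_sqrt_mult real_sqrt_divide)
    also have "\<dots> = 4 * sqrt ((of_int N / of_int q) / (2 * of_int N * \<bar>\<theta>\<bar> * of_int q))"
      by (simp only: real_sqrt_divide)
    also have "\<dots> \<le> 4 * sqrt ((of_int N / of_int q)\<^sup>2 / ((of_int N)\<^sup>2 * \<bar>\<theta>\<bar>))"
      using Np tp by (intro mult_left_mono real_sqrt_le_mono) (auto simp: field_simps power2_eq_square)
    also have "\<dots> = 4 * (of_int N / of_int q) * ((of_int N)\<^sup>2 * \<bar>\<theta>\<bar>) powr (-1/2)"
      using Np tp by (simp add: real_sqrt_divide powr_minus_divide powr_half_sqrt)
    finally show ?thesis using False by (simp add: damp_def)
  qed
  then show ?thesis using le unfolding g_def by simp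
qed

text \<open>For the other \<open>h\<close>, \<open>\<beta> h\<close> is, modulo one, within \<open>1 / (2 q)\<close> of the nonzero fraction
  \<open>\<rho> / q\<close>, where \<open>\<rho>\<close> is the residue of \<open>b h\<close>. Over a period of \<open>h\<close> every residue occurs at most once.\<close>

lemma nonmultiples_of_denominator:
  "(\<Sum>h\<in>{h\<in>{-4*N..4*N}. \<not> q dvd h}. damp (of_int N * cmod (1 - ee (\<beta> * of_int h)))) \<le> 96 * sqrt (of_int N)"
proof -
  have Np: "real_of_int N > 0" "real_of_int q > 0" using N q by auto
  define u where "u \<rho> = (real_of_int N / real_of_int q) powr (-1/2) * (real_of_int \<rho> powr (-1/2) + real_of_int (q - \<rho>) powr (-1/2))" for \<rho> :: int
  have u0: "u \<rho> \<ge> 0" for \<rho> by (simp add: u_def)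
  have each: "damp (of_int N * cmod (1 - ee (\<beta> * of_int h))) \<le> u (b * h mod q)" if h: "h \<in> {-4*N..4*N}" "\<not> q dvd h" for h
  proof -
    define \<rho> where "\<rho> = b * h mod q"
    have "\<not> q dvd b * h" using h bq by (simp add: coprime_dvd_mult_right_iff coprime_commute)
    then have "\<rho> \<noteq> 0" by (auto simp: \<rho>_def dvd_eq_mod_eq_0)
    moreover have "0 \<le> \<rho>" "\<rho> < q" using q by (auto simp: \<rho>_def)
    ultimately have \<rho>: "1 \<le> \<rho>" "\<rho> \<le> q - 1" by auto
    define y where "y = of_int \<rho> / of_int q + \<theta> * of_int h"
    define d where "d = min (real_of_int \<rho>) (of_int (q - \<rho>))"
    have d: "d \<ge> 1" using \<rho> by (simp add: d_def)
    have th: "\<bar>\<theta> * of_int h\<bar> \<le> 1 / (2 * of_int q)" using h by (intro \<theta>h_small) auto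
    have th': "\<bar>\<theta> * of_int h\<bar> \<le> d / (2 * of_int q)"
    proof -
      have "1 / (2 * real_of_int q) \<le> d / (2 * of_int q)" using d Np by (intro divide_right_mono) auto
      with th show ?thesis by linarith
    qed
    have "of_int (b * h) = of_int ((b * h) div q) * of_int q + real_of_int \<rho>"
      unfolding \<rho>_def by (metis div_mult_mod_eq of_int_add of_int_mult)
    then have "\<beta> * of_int h = of_int ((b * h) div q) + y"
      using Np by (simp add: \<theta>(1) y_def field_simps)
    then have ey: "ee (\<beta> * of_int h) = ee y" by (simp only: ee_add ee_of_int mult_1)
    have dq: "d / of_int q - d / (2 * of_int q) = d / (2 * of_int q)" by (simp add: field_simps)
    have d1: "d / of_int q \<le> of_int \<rho> / of_int q" "d / of_int q \<le> of_int (q - \<rho>) / of_int q"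
      using Np by (auto simp: d_def intro: divide_right_mono)
    have ylo: "d / (2 * of_int q) \<le> y" using d1(1) th' dq unfolding y_def by linarith
    have "1 - y = of_int (q - \<rho>) / of_int q - \<theta> * of_int h" using Np by (simp add: y_def field_simps)
    then have yhi: "d / (2 * of_int q) \<le> 1 - y" using d1(2) th' dq by linarith
    have dpos: "d / (2 * of_int q) > 0" using d Np by simp
    have "2 * (d / (2 * of_int q)) \<le> cmod (1 - ee y)"
    proof (cases "y \<le> 1/2")
      case True
      then have "2 * \<bar>y\<bar> \<le> cmod (1 - ee y)" using ylo dpos by (intro norm_1_minus_ee_ge) auto
      moreover have "2 * (d / (2 * of_int q)) \<le> 2 * \<bar>y\<bar>" using ylo by (intro mult_left_mono) auto
      ultimately show ?thesis by (rule order_trans[rotated])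
    next
      case False
      then have "2 * \<bar>1 - y\<bar> \<le> cmod (1 - ee (1 - y))" using yhi dpos by (intro norm_1_minus_ee_ge) auto
      also have "ee (1 - y) = ee (-y)" using ee_add[of 1 "-y"] ee_of_int[of 1] by simp
      finally have "2 * \<bar>1 - y\<bar> \<le> cmod (1 - ee y)" by (simp add: norm_1_minus_ee_uminus)
      moreover have "2 * (d / (2 * of_int q)) \<le> 2 * \<bar>1 - y\<bar>" using yhi by (intro mult_left_mono) auto
      ultimately show ?thesis by (rule order_trans[rotated])
    qed
    then have "of_int N * (d / of_int q) \<le> of_int N * cmod (1 - ee (\<beta> * of_int h))"
      unfolding ey using Np by (intro mult_left_mono) auto
    then have "damp (of_int N * cmod (1 - ee (\<beta> * of_int h))) \<le> (of_int N * (d / of_int q)) powr (-1/2)"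
      using d Np by (intro damp_le) auto
    also have "\<dots> = (of_int N / of_int q) powr (-1/2) * d powr (-1/2)"
      using powr_mult[of "of_int N / of_int q" d "-1/2"] by simp
    also have "\<dots> \<le> u \<rho>"
    proof -
      have "d powr (-1/2) \<le> real_of_int \<rho> powr (-1/2) + real_of_int (q - \<rho>) powr (-1/2)"
        unfolding d_def min_def by auto
      then show ?thesis unfolding u_def by (intro mult_left_mono) auto
    qed
    finally show ?thesis unfolding \<rho>_def .
  qed
  have su: "(\<Sum>\<rho>\<in>{1..q-1}. u \<rho>) \<le> 4 * of_int q / sqrt (of_int N)"
  proof -
    have s1: "(\<Sum>\<rho>\<in>{1..q-1}. real_of_int \<rho> powr (-1/2)) \<le> 2 * sqrt (of_int q)"
    proof -
      have "(\<Sum>\<rho>\<in>{1..q-1}. real_of_int \<rho> powr (-1/2)) \<le> (\<Sum>\<rho>\<in>{1..int (nat q)}. real_of_int \<rho> powr (-1/2))"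
        by (intro sum_mono2) auto
      also have "\<dots> \<le> 2 * sqrt (real (nat q))" by (rule sum_inv_sqrt)
      finally show ?thesis using q by simp
    qed
    have s2: "(\<Sum>\<rho>\<in>{1..q-1}. real_of_int (q - \<rho>) powr (-1/2)) = (\<Sum>\<rho>\<in>{1..q-1}. real_of_int \<rho> powr (-1/2))"
      by (rule sum.reindex_bij_witness[of _ "\<lambda>\<rho>. q - \<rho>" "\<lambda>\<rho>. q - \<rho>"]) auto
    have "(\<Sum>\<rho>\<in>{1..q-1}. u \<rho>) = (of_int N / of_int q) powr (-1/2) * (2 * (\<Sum>\<rho>\<in>{1..q-1}. real_of_int \<rho> powr (-1/2)))"
      unfolding u_def sum_distrib_left[symmetric] sum.distrib s2 by simp
    also have "\<dots> \<le> (of_int N / of_int q) powr (-1/2) * (2 * (2 * sqrt (of_int q)))"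
      using s1 by (intro mult_left_mono) auto
    also have "\<dots> = 4 * of_int q / sqrt (of_int N)"
      using Np by (simp add: powr_minus_divide powr_half_sqrt real_sqrt_divide field_simps)
    finally show ?thesis .
  qed
  define Z where "Z = {(-4*N) div q..(4*N) div q}"
  have cZ: "real (card Z) \<le> 8 * of_int N / of_int q + 2"
  proof -
    have "real (card Z) \<le> of_int ((4*N) div q - (-4*N) div q + 1)"
      using zdiv_mono1[of "-4*N" "4*N" q] N q by (simp add: Z_def)
    also have "\<dots> = of_int ((4*N) div q) - of_int ((-4*N) div q) + 1" by simp
    finally have "real (card Z) \<le> of_int ((4*N) div q) - of_int ((-4*N) div q) + 1" .
    moreover have "of_int ((4*N) div q) \<le> real_of_int (4*N) / of_int q" by (rule real_of_int_div4)
    moreover have "real_of_int (-4*N) / of_int q - 1 \<le> of_int ((-4*N) div q)"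
      using real_of_int_div3[of "-4*N" q] by linarith
    moreover have "real_of_int (-4*N) / of_int q = - (real_of_int (4*N) / of_int q)" by simp
    moreover have "8 * of_int N / of_int q = 2 * (real_of_int (4*N) / of_int q)" by simp
    ultimately show ?thesis by linarith
  qed
  have per: "(\<Sum>h\<in>{h\<in>{-4*N..4*N}. \<not> q dvd h \<and> h div q = t}. u (b * h mod q)) \<le> (\<Sum>\<rho>\<in>{1..q-1}. u \<rho>)" for t
  proof -
    let ?A = "{h\<in>{-4*N..4*N}. \<not> q dvd h \<and> h div q = t}"
    have inj: "inj_on (\<lambda>h. b * h mod q) ?A"
    proof (rule inj_onI)
      fix x y assume x: "x \<in> ?A" and y: "y \<in> ?A" and e: "b * x mod q = b * y mod q"
      from e have "q dvd b * x - b * y" by (simp add: mod_eq_dvd_iff)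
      then have "q dvd b * (x - y)" by (simp add: right_diff_distrib)
      then have "q dvd x - y" using bq by (simp add: coprime_dvd_mult_right_iff coprime_commute)
      then have "x mod q = y mod q" by (simp add: mod_eq_dvd_iff)
      moreover have "x div q = y div q" using x y by simp
      ultimately show "x = y" by (metis div_mult_mod_eq)
    qed
    have "(\<Sum>h\<in>?A. u (b * h mod q)) = (\<Sum>\<rho>\<in>(\<lambda>h. b * h mod q) ` ?A. u \<rho>)"
      using inj by (simp add: sum.reindex)
    also have "\<dots> \<le> (\<Sum>\<rho>\<in>{1..q-1}. u \<rho>)"
    proof (intro sum_mono2 u0)
      show "(\<lambda>h. b * h mod q) ` ?A \<subseteq> {1..q-1}"
      proof clarify
        fix h assume "\<not> q dvd h"
        then have "\<not> q dvd b * h" using bq by (simp add: coprime_dvd_mult_right_iff coprime_commute)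
        then have "b * h mod q \<noteq> 0" by (auto simp: dvd_eq_mod_eq_0)
        moreover have "0 \<le> b * h mod q" "b * h mod q < q" using q by auto
        ultimately show "b * h mod q \<in> {1..q-1}" by auto
      qed
    qed auto
    finally show ?thesis .
  qed
  have "(\<Sum>h\<in>{h\<in>{-4*N..4*N}. \<not> q dvd h}. damp (of_int N * cmod (1 - ee (\<beta> * of_int h))))
     \<le> (\<Sum>h\<in>{h\<in>{-4*N..4*N}. \<not> q dvd h}. u (b * h mod q))" by (intro sum_mono each) auto
  also have "\<dots> = (\<Sum>t\<in>Z. \<Sum>h\<in>{h\<in>{h\<in>{-4*N..4*N}. \<not> q dvd h}. h div q = t}. u (b * h mod q))"
  proof (rule sum.group[symmetric])
    show "(\<lambda>h. h div q) ` {h \<in> {-4*N..4*N}. \<not> q dvd h} \<subseteq> Z"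
      using q by (auto simp: Z_def intro!: zdiv_mono1)
    show "finite {h \<in> {-4*N..4*N}. \<not> q dvd h}" by (rule finite_subset[of _ "{-4*N..4*N}"]) auto
  qed (simp add: Z_def)
  also have "\<dots> \<le> (\<Sum>t\<in>Z. \<Sum>\<rho>\<in>{1..q-1}. u \<rho>)" using per by (intro sum_mono) (simp add: conj_assoc)
  also have "\<dots> = real (card Z) * (\<Sum>\<rho>\<in>{1..q-1}. u \<rho>)" by simp
  also have "\<dots> \<le> (8 * of_int N / of_int q + 2) * (4 * of_int q / sqrt (of_int N))"
    using cZ su u0 Np by (intro mult_mono) (auto intro: sum_nonneg)
  also have "\<dots> = (32 * of_int N + 8 * of_int q) / sqrt (of_int N)" using Np by (simp add: field_simps)
  also have "\<dots> \<le> (96 * of_int N) / sqrt (of_int N)" using Np q by (intro divide_right_mono) auto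
  also have "\<dots> = 96 * sqrt (of_int N)" using Np real_div_sqrt[of "real_of_int N"] by simp
  finally show ?thesis .
qed

lemma damped_sum_bound:
  "(\<Sum>h\<in>{-4*N..4*N}. damp (of_int N * cmod (1 - ee (\<beta> * of_int h))))
     \<le> 97 * sqrt (of_int N) + 8 * (of_int N / of_int q) * damp ((of_int N)\<^sup>2 * \<bar>\<theta>\<bar>)"
proof -
  let ?g = "\<lambda>h. damp (of_int N * cmod (1 - ee (\<beta> * of_int h)))"
  have eq: "{-4*N..4*N} = insert 0 ({h\<in>{-4*N..4*N}. q dvd h \<and> h \<noteq> 0} \<union> {h\<in>{-4*N..4*N}. \<not> q dvd h})"
    using N by auto
  have "(\<Sum>h\<in>{-4*N..4*N}. ?g h) = (\<Sum>h\<in>insert 0 ({h\<in>{-4*N..4*N}. q dvd h \<and> h \<noteq> 0} \<union> {h\<in>{-4*N..4*N}. \<not> q dvd h}). ?g h)"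
    by (rule sum.cong[OF eq refl])
  also have "\<dots> = ?g 0 + ((\<Sum>h\<in>{h\<in>{-4*N..4*N}. q dvd h \<and> h \<noteq> 0}. ?g h) + (\<Sum>h\<in>{h\<in>{-4*N..4*N}. \<not> q dvd h}. ?g h))"
  proof -
    have f: "finite {h\<in>{-4*N..4*N}. P h}" for P by (rule finite_subset[of _ "{-4*N..4*N}"]) auto
    have "(\<Sum>h\<in>{h\<in>{-4*N..4*N}. q dvd h \<and> h \<noteq> 0} \<union> {h\<in>{-4*N..4*N}. \<not> q dvd h}. ?g h)
       = (\<Sum>h\<in>{h\<in>{-4*N..4*N}. q dvd h \<and> h \<noteq> 0}. ?g h) + (\<Sum>h\<in>{h\<in>{-4*N..4*N}. \<not> q dvd h}. ?g h)"
      by (rule sum.union_disjoint[OF f f]) auto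
    then show ?thesis by (subst sum.insert[OF finite_UnI[OF f f]]) auto
  qed
  also have "?g 0 = 1" by (simp add: damp_def)
  also have "1 \<le> sqrt (of_int N)" using N by simp
  finally show ?thesis using multiples_of_denominator nonmultiples_of_denominator by linarith
qed

end

section \<open>Weyl's inequality for the dyadic pieces of the kernel\<close>

text \<open>The continuous transition from \<open>0\<close> on \<open>2 \<bar>m\<bar> \<le> 2\<^sup>j\<close> to \<open>1\<close> on \<open>\<bar>m\<bar> \<ge> 2\<^sup>j\<close> keeps the truncated kernels regular, so that
  the ends of a range of scales need no separate treatment.\<close>

definition ramp :: "nat \<Rightarrow> int \<Rightarrow> real" where
  "ramp j m = max 0 (min 1 (2 * \<bar>real_of_int m\<bar> / 2 ^ j - 1))"

definition cutoff :: "nat \<Rightarrow> nat \<Rightarrow> int \<Rightarrow> real" where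
  "cutoff a b m = ramp a m - ramp b m"

lemma ramp_bounds: "0 \<le> ramp j m" "ramp j m \<le> 1" by (auto simp: ramp_def)

lemma ramp_eq_0: "2 * \<bar>real_of_int m\<bar> \<le> 2 ^ j \<Longrightarrow> ramp j m = 0"
  by (simp add: ramp_def field_simps)

lemma ramp_eq_1: "2 ^ j \<le> \<bar>real_of_int m\<bar> \<Longrightarrow> ramp j m = 1"
  by (simp add: ramp_def field_simps)

lemma ramp_minus [simp]: "ramp j (-m) = ramp j m" by (simp add: ramp_def)

lemma ramp_antimono: "a \<le> b \<Longrightarrow> ramp b m \<le> ramp a m"
proof -
  assume "a \<le> b"
  then have "(2::real) ^ a \<le> 2 ^ b" by (intro power_increasing) auto
  then have "2 * \<bar>real_of_int m\<bar> / 2 ^ b \<le> 2 * \<bar>real_of_int m\<bar> / 2 ^ a" by (intro divide_left_mono) auto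
  then show ?thesis unfolding ramp_def by linarith
qed

lemma ramp_lipschitz:
  assumes "l * l' > 0" "\<bar>l'\<bar> \<le> \<bar>l\<bar>"
  shows "\<bar>real_of_int l'\<bar> * \<bar>ramp j l - ramp j l'\<bar> \<le> 2 * \<bar>real_of_int (l - l')\<bar>"
proof (cases "2 ^ j \<le> \<bar>real_of_int l'\<bar>")
  case True
  moreover have "\<bar>real_of_int l'\<bar> \<le> \<bar>real_of_int l\<bar>" using assms(2) by linarith
  ultimately have "ramp j l' = 1" "ramp j l = 1" by (auto intro: ramp_eq_1)
  then show ?thesis by simp
next
  case False
  have "\<bar>ramp j l - ramp j l'\<bar> \<le> \<bar>2 * \<bar>real_of_int l\<bar> / 2 ^ j - 2 * \<bar>real_of_int l'\<bar> / 2 ^ j\<bar>"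
    unfolding ramp_def by linarith
  also have "\<dots> = 2 * \<bar>\<bar>real_of_int l\<bar> - \<bar>real_of_int l'\<bar>\<bar> / 2 ^ j"
  proof -
    have "2 * \<bar>real_of_int l\<bar> / 2 ^ j - 2 * \<bar>real_of_int l'\<bar> / 2 ^ j = 2 * (\<bar>real_of_int l\<bar> - \<bar>real_of_int l'\<bar>) / 2 ^ j"
      by (simp add: diff_divide_distrib)
    then show ?thesis by (simp only: abs_mult abs_divide) simp
  qed
  also have "\<dots> \<le> 2 * \<bar>real_of_int (l - l')\<bar> / 2 ^ j" by (intro divide_right_mono) auto
  finally have "\<bar>real_of_int l'\<bar> * \<bar>ramp j l - ramp j l'\<bar> \<le> 2 ^ j * (2 * \<bar>real_of_int (l - l')\<bar> / 2 ^ j)"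
    using False by (intro mult_mono) auto
  then show ?thesis by simp
qed

lemma cutoff_bounds: "a \<le> b \<Longrightarrow> 0 \<le> cutoff a b m" "a \<le> b \<Longrightarrow> cutoff a b m \<le> 1"
  using ramp_antimono[of a b m] ramp_bounds[of a m] ramp_bounds[of b m] by (auto simp: cutoff_def)

lemma cutoff_minus [simp]: "cutoff a b (-m) = cutoff a b m" by (simp add: cutoff_def)

lemma cutoff_support:
  assumes "a \<le> b" "cutoff a b m \<noteq> 0"
  shows "2 ^ a < 2 * \<bar>real_of_int m\<bar>" "\<bar>real_of_int m\<bar> < 2 ^ b"
proof -
  show "2 ^ a < 2 * \<bar>real_of_int m\<bar>"
  proof (rule ccontr)
    assume "\<not> ?thesis"
    then have "ramp a m = 0" by (intro ramp_eq_0) auto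
    then show False using ramp_antimono[OF assms(1), of m] ramp_bounds[of b m] assms(2) by (auto simp: cutoff_def)
  qed
  show "\<bar>real_of_int m\<bar> < 2 ^ b"
  proof (rule ccontr)
    assume "\<not> ?thesis"
    then have "ramp b m = 1" by (intro ramp_eq_1) auto
    then show False using ramp_antimono[OF assms(1), of m] ramp_bounds[of a m] assms(2) by (auto simp: cutoff_def)
  qed
qed

lemma cutoff_lipschitz:
  assumes "l * l' > 0" "\<bar>l'\<bar> \<le> \<bar>l\<bar>"
  shows "\<bar>real_of_int l'\<bar> * \<bar>cutoff a b l - cutoff a b l'\<bar> \<le> 4 * \<bar>real_of_int (l - l')\<bar>"
proof -
  have "\<bar>real_of_int l'\<bar> * \<bar>cutoff a b l - cutoff a b l'\<bar> \<le> \<bar>real_of_int l'\<bar> * (\<bar>ramp a l - ramp a l'\<bar> + \<bar>ramp b l - ramp b l'\<bar>)"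
    unfolding cutoff_def by (intro mult_left_mono) auto
  then show ?thesis using ramp_lipschitz[OF assms, of a] ramp_lipschitz[OF assms, of b] by (simp add: distrib_left)
qed

text \<open>The kernel \<open>e(\<theta> l\<^sup>2) / l\<close>, continuously truncated to the scales from \<open>a\<close> to \<open>b\<close>.\<close>

definition phased :: "real \<Rightarrow> nat \<Rightarrow> nat \<Rightarrow> int \<Rightarrow> complex" where
  "phased \<theta> a b l = ee (\<theta> * (of_int l)\<^sup>2) * complex_of_real (cutoff a b l / of_int l)"

lemma norm_phased: "cmod (phased \<theta> a b l) = \<bar>cutoff a b l\<bar> / \<bar>real_of_int l\<bar>"
  by (simp add: phased_def norm_mult norm_divide)

lemma phased_minus: "phased \<theta> a b (-l) = - phased \<theta> a b l"
  by (simp add: phased_def)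

text \<open>The phase \<open>\<theta> l\<^sup>2\<close> does not destroy the regularity of \<open>1 / l\<close> as long as it stays bounded on
  the support of the cutoff.\<close>

lemma phased_regular:
  assumes ab: "a \<le> b" and K: "K \<ge> 0" "\<And>l. cutoff a b l \<noteq> 0 \<Longrightarrow> \<bar>\<theta>\<bar> * (of_int l)\<^sup>2 \<le> K" and ll: "l * l' > 0"
  shows "cmod (phased \<theta> a b l - phased \<theta> a b l') \<le> (5 + 4 * pi * K) * \<bar>real_of_int (l - l')\<bar> / real_of_int (l * l')"
proof -
  have main: "cmod (phased \<theta> a b l - phased \<theta> a b l') \<le> (5 + 4 * pi * K) * \<bar>real_of_int (l - l')\<bar> / real_of_int (l * l')"
    if ll: "l * l' > 0" and le: "\<bar>l'\<bar> \<le> \<bar>l\<bar>" for l l' :: int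
  proof -
    define x y c c' where "x = real_of_int l" and "y = real_of_int l'" and "c = cutoff a b l" and "c' = cutoff a b l'"
    have xy: "x * y > 0" using ll unfolding x_def y_def by (metis of_int_0_less_iff of_int_mult)
    then have nz: "x \<noteq> 0" "y \<noteq> 0" by auto
    have yx: "\<bar>y\<bar> \<le> \<bar>x\<bar>" using le unfolding x_def y_def by linarith
    have cb: "0 \<le> c" "c \<le> 1" "0 \<le> c'" "c' \<le> 1" using cutoff_bounds(1)[OF ab] cutoff_bounds(2) ab by (auto simp: c_def c'_def)
    have lip: "\<bar>y\<bar> * \<bar>c - c'\<bar> \<le> 4 * \<bar>x - y\<bar>" using cutoff_lipschitz[OF ll le, of a b] by (simp add: x_def y_def c_def c'_def)
    have "c * y - c' * x = y * (c - c') + c' * (y - x)" by (simp add: algebra_simps)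
    then have "\<bar>c * y - c' * x\<bar> \<le> \<bar>y\<bar> * \<bar>c - c'\<bar> + \<bar>c'\<bar> * \<bar>y - x\<bar>" by (metis abs_mult abs_triangle_ineq)
    also have "\<dots> \<le> 4 * \<bar>x - y\<bar> + 1 * \<bar>y - x\<bar>" using lip cb by (intro add_mono mult_right_mono) auto
    finally have t1: "\<bar>c * y - c' * x\<bar> \<le> 5 * \<bar>x - y\<bar>" by (simp add: abs_minus_commute)
    have t2: "c * \<bar>y\<bar> * cmod (ee (\<theta> * x\<^sup>2) - ee (\<theta> * y\<^sup>2)) \<le> 4 * pi * K * \<bar>x - y\<bar>"
    proof (cases "c = 0")
      case False
      have "cmod (ee (\<theta> * x\<^sup>2) - ee (\<theta> * y\<^sup>2)) \<le> 2 * pi * \<bar>\<theta> * x\<^sup>2 - \<theta> * y\<^sup>2\<bar>" by (rule norm_ee_diff_le)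
      also have "\<theta> * x\<^sup>2 - \<theta> * y\<^sup>2 = \<theta> * (x + y) * (x - y)" by (simp add: power2_eq_square algebra_simps)
      also have "2 * pi * \<bar>\<theta> * (x + y) * (x - y)\<bar> = 2 * pi * \<bar>\<theta>\<bar> * \<bar>x + y\<bar> * \<bar>x - y\<bar>" by (simp add: abs_mult)
      also have "\<dots> \<le> 2 * pi * \<bar>\<theta>\<bar> * (2 * \<bar>x\<bar>) * \<bar>x - y\<bar>" using yx by (intro mult_right_mono mult_left_mono) auto
      finally have e: "cmod (ee (\<theta> * x\<^sup>2) - ee (\<theta> * y\<^sup>2)) \<le> 2 * pi * \<bar>\<theta>\<bar> * (2 * \<bar>x\<bar>) * \<bar>x - y\<bar>" .
      have "c * \<bar>y\<bar> * cmod (ee (\<theta> * x\<^sup>2) - ee (\<theta> * y\<^sup>2)) \<le> 1 * \<bar>x\<bar> * (2 * pi * \<bar>\<theta>\<bar> * (2 * \<bar>x\<bar>) * \<bar>x - y\<bar>)"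
        using cb yx e by (intro mult_mono) auto
      also have "\<dots> = 4 * pi * (\<bar>\<theta>\<bar> * x\<^sup>2) * \<bar>x - y\<bar>" by (simp add: power2_eq_square)
      also have "\<dots> \<le> 4 * pi * K * \<bar>x - y\<bar>"
        using K(2)[of l] False by (intro mult_right_mono mult_left_mono) (auto simp: c_def x_def)
      finally show ?thesis .
    qed (use K in auto)
    have "phased \<theta> a b l - phased \<theta> a b l' = (ee (\<theta> * x\<^sup>2) * of_real (c * y) - ee (\<theta> * y\<^sup>2) * of_real (c' * x)) / of_real (x * y)"
      using nz by (simp add: phased_def x_def y_def c_def c'_def field_simps)
    also have "ee (\<theta> * x\<^sup>2) * of_real (c * y) - ee (\<theta> * y\<^sup>2) * of_real (c' * x)
       = ee (\<theta> * y\<^sup>2) * of_real (c * y - c' * x) + of_real (c * y) * (ee (\<theta> * x\<^sup>2) - ee (\<theta> * y\<^sup>2))"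
      by (simp add: algebra_simps)
    finally have "cmod (phased \<theta> a b l - phased \<theta> a b l') = cmod (ee (\<theta> * y\<^sup>2) * of_real (c * y - c' * x) + of_real (c * y) * (ee (\<theta> * x\<^sup>2) - ee (\<theta> * y\<^sup>2))) / (x * y)"
      using xy by (simp only: norm_divide norm_of_real abs_of_pos)
    also have "\<dots> \<le> (\<bar>c * y - c' * x\<bar> + c * \<bar>y\<bar> * cmod (ee (\<theta> * x\<^sup>2) - ee (\<theta> * y\<^sup>2))) / (x * y)"
    proof (rule divide_right_mono)
      have "cmod (ee (\<theta> * y\<^sup>2) * of_real (c * y - c' * x)) = \<bar>c * y - c' * x\<bar>"
        by (simp only: norm_mult norm_ee norm_of_real mult_1)
      moreover have "cmod (of_real (c * y) * (ee (\<theta> * x\<^sup>2) - ee (\<theta> * y\<^sup>2))) = c * \<bar>y\<bar> * cmod (ee (\<theta> * x\<^sup>2) - ee (\<theta> * y\<^sup>2))"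
        using cb by (simp only: norm_mult norm_of_real abs_mult abs_of_nonneg)
      ultimately show "cmod (ee (\<theta> * y\<^sup>2) * of_real (c * y - c' * x) + of_real (c * y) * (ee (\<theta> * x\<^sup>2) - ee (\<theta> * y\<^sup>2)))
        \<le> \<bar>c * y - c' * x\<bar> + c * \<bar>y\<bar> * cmod (ee (\<theta> * x\<^sup>2) - ee (\<theta> * y\<^sup>2))"
        by (metis norm_triangle_ineq)
    qed (use xy in simp)
    also have "\<dots> \<le> (5 * \<bar>x - y\<bar> + 4 * pi * K * \<bar>x - y\<bar>) / (x * y)"
      using t1 t2 xy by (intro divide_right_mono add_mono) auto
    finally show ?thesis by (simp add: x_def y_def distrib_right)
  qed
  show ?thesis
  proof (cases "\<bar>l'\<bar> \<le> \<bar>l\<bar>")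
    case False
    then show ?thesis using main[of l' l] ll by (simp add: norm_minus_commute abs_minus_commute mult.commute)
  qed (use main ll in blast)
qed

text \<open>The \<open>TT\<^sup>*\<close> method: the operator norm is estimated by Schur's test for the autocorrelation of the kernel.\<close>

lemma form_bdd_convolution:
  fixes k :: "int \<Rightarrow> complex"
  assumes k: "\<And>l. l \<notin> {-R..R} \<Longrightarrow> k l = 0" and Z: "finite Z" and S: "S \<ge> 0"
    and c: "\<And>h. cmod (\<Sum>l\<in>{-R..R}. k (l + h) * cnj (k l)) \<le> c h" and cZ: "\<And>h. h \<notin> Z \<Longrightarrow> (\<Sum>l\<in>{-R..R}. k (l + h) * cnj (k l)) = 0"
    and sum: "(\<Sum>h\<in>Z. c h) \<le> S\<^sup>2"
  shows "form_bdd (\<lambda>_. 1) S (\<lambda>n m. k (n - m))"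
  unfolding form_bdd_def
proof (intro allI impI)
  fix W :: "int set" and f g :: "int \<Rightarrow> complex" assume W: "finite W"
  define X where "X = W \<union> (\<Union>m\<in>W. {m-R..m+R})"
  have X: "finite X" "W \<subseteq> X" using W by (auto simp: X_def)
  define T where "T n = (\<Sum>m\<in>W. k (n - m) * f m)" for n
  define C where "C h = (\<Sum>l\<in>{-R..R}. k (l + h) * cnj (k l))" for h
  have "complex_of_real (\<Sum>n\<in>X. (cmod (T n))\<^sup>2) = (\<Sum>n\<in>X. T n * cnj (T n))"
    by (simp only: of_real_sum complex_norm_square)
  also have "\<dots> = (\<Sum>n\<in>X. \<Sum>m\<in>W. \<Sum>m'\<in>W. (k (n - m) * cnj (k (n - m'))) * (f m * cnj (f m')))"
    unfolding T_def cnj_sum sum_product by (simp add: mult_ac)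
  also have "\<dots> = (\<Sum>m\<in>W. \<Sum>n\<in>X. \<Sum>m'\<in>W. (k (n - m) * cnj (k (n - m'))) * (f m * cnj (f m')))"
    by (rule sum.swap)
  also have "\<dots> = (\<Sum>m\<in>W. \<Sum>m'\<in>W. \<Sum>n\<in>X. (k (n - m) * cnj (k (n - m'))) * (f m * cnj (f m')))"
    by (rule sum.cong[OF refl], rule sum.swap)
  also have "\<dots> = (\<Sum>m\<in>W. \<Sum>m'\<in>W. C (m' - m) * f m * cnj (f m'))"
  proof (intro sum.cong refl)
    fix m m' assume m: "m \<in> W" "m' \<in> W"
    have "(\<Sum>n\<in>X. k (n - m) * cnj (k (n - m'))) = (\<Sum>n\<in>{m'-R..m'+R}. k (n - m) * cnj (k (n - m')))"
      using X m k by (intro sum.mono_neutral_right) (auto simp: X_def)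
    also have "\<dots> = C (m' - m)" unfolding C_def
      by (rule sum.reindex_bij_witness[of _ "\<lambda>l. l + m'" "\<lambda>n. n - m'"]) auto
    finally show "(\<Sum>n\<in>X. k (n - m) * cnj (k (n - m')) * (f m * cnj (f m'))) = C (m' - m) * f m * cnj (f m')"
      unfolding sum_distrib_right[symmetric] by (simp add: mult.assoc)
  qed
  also have "\<dots> = (\<Sum>n\<in>W. \<Sum>m\<in>W. C (n - m) * f m * cnj (f n))" by (rule sum.swap)
  finally have "cmod (complex_of_real (\<Sum>n\<in>X. (cmod (T n))\<^sup>2)) = cmod (\<Sum>n\<in>W. \<Sum>m\<in>W. C (n - m) * f m * cnj (f n))"
    by simp
  also have "\<dots> \<le> S\<^sup>2 * sqrt (\<Sum>m\<in>W. (cmod (f m))\<^sup>2 * 1) * sqrt (\<Sum>n\<in>W. (cmod (cnj (f n)))\<^sup>2 / 1)"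
  proof (rule form_bddD[OF _ W])
    have c0: "c h \<ge> 0" for h using c[of h] norm_ge_zero order_trans by blast
    show "form_bdd (\<lambda>_. 1) (S\<^sup>2) (\<lambda>n m. C (n - m))"
      by (rule form_bdd_Schur[OF Z c0 _ _ sum]) (use c cZ in \<open>auto simp: C_def\<close>)
  qed
  also have "\<dots> = S\<^sup>2 * (\<Sum>m\<in>W. (cmod (f m))\<^sup>2)" by (simp add: sum_nonneg)
  finally have TX: "(\<Sum>n\<in>X. (cmod (T n))\<^sup>2) \<le> S\<^sup>2 * (\<Sum>m\<in>W. (cmod (f m))\<^sup>2)" by (simp only: norm_of_real abs_of_nonneg[OF sum_nonneg[OF zero_le_power2]])
  have "(\<Sum>n\<in>W. \<Sum>m\<in>W. k (n - m) * f m * g n) = (\<Sum>n\<in>W. T n * g n)" by (simp add: T_def sum_distrib_right)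
  then have "cmod (\<Sum>n\<in>W. \<Sum>m\<in>W. k (n - m) * f m * g n) \<le> (\<Sum>n\<in>W. sqrt ((cmod (T n))\<^sup>2) * sqrt ((cmod (g n))\<^sup>2))"
    by (simp add: norm_mult[symmetric] norm_sum)
  also have "\<dots> \<le> sqrt (\<Sum>n\<in>W. (cmod (T n))\<^sup>2) * sqrt (\<Sum>n\<in>W. (cmod (g n))\<^sup>2)"
    by (intro Cauchy_Schwarz_sqrt) auto
  also have "\<dots> \<le> sqrt (S\<^sup>2 * (\<Sum>m\<in>W. (cmod (f m))\<^sup>2)) * sqrt (\<Sum>n\<in>W. (cmod (g n))\<^sup>2)"
  proof (intro mult_right_mono real_sqrt_le_mono)
    have "(\<Sum>n\<in>W. (cmod (T n))\<^sup>2) \<le> (\<Sum>n\<in>X. (cmod (T n))\<^sup>2)" using X by (intro sum_mono2) auto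
    then show "(\<Sum>n\<in>W. (cmod (T n))\<^sup>2) \<le> S\<^sup>2 * (\<Sum>m\<in>W. (cmod (f m))\<^sup>2)" using TX by linarith
  qed (simp add: sum_nonneg)
  finally show "cmod (\<Sum>n\<in>W. \<Sum>m\<in>W. k (n - m) * f m * g n)
     \<le> S * sqrt (\<Sum>m\<in>W. (cmod (f m))\<^sup>2 * 1) * sqrt (\<Sum>n\<in>W. (cmod (g n))\<^sup>2 / 1)"
    using S by (simp add: real_sqrt_mult)
qed

lemma piece_support: "phased \<alpha> j (Suc j) m \<noteq> 0 \<Longrightarrow> 2 ^ j < 2 * \<bar>real_of_int m\<bar> \<and> \<bar>m\<bar> < 2 * 2 ^ j"
proof -
  assume "phased \<alpha> j (Suc j) m \<noteq> 0"
  then have "cutoff j (Suc j) m \<noteq> 0" by (auto simp: phased_def)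
  from cutoff_support[OF _ this] have "2 ^ j < 2 * \<bar>real_of_int m\<bar>" "real_of_int \<bar>m\<bar> < real_of_int (2 ^ Suc j)" by auto
  then show ?thesis by (simp only: of_int_less_iff) simp
qed

lemma norm_piece_le: "cmod (phased \<alpha> j (Suc j) m) \<le> 2 / 2 ^ j"
proof (cases "phased \<alpha> j (Suc j) m = 0")
  case False
  note sup = piece_support[OF this]
  have "cmod (phased \<alpha> j (Suc j) m) \<le> 1 / \<bar>real_of_int m\<bar>"
  proof -
    have "\<bar>cutoff j (Suc j) m\<bar> \<le> 1" using cutoff_bounds[OF le_SucI[OF order_refl], of j m] by linarith
    then show ?thesis unfolding norm_phased by (intro divide_right_mono) auto
  qed
  also have "\<dots> \<le> 1 / (2 ^ j / 2)"
  proof (intro divide_left_mono)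
    have "0 < 2 * \<bar>real_of_int m\<bar>" using sup less_trans[of 0 "2 ^ j"] by auto
    then show "0 < \<bar>real_of_int m\<bar> * (2 ^ j / 2)" by simp
  qed (use sup in auto)
  finally show ?thesis by simp
qed simp

text \<open>For \<open>j > 0\<close> this is the regularity of the kernel on a half line. For \<open>j = 0\<close> the support touches the
  neighbours of the origin, and the size of the kernel is used instead.\<close>

lemma piece_variation: "cmod (phased 0 j (Suc j) m - phased 0 j (Suc j) (m - 1)) \<le> 20 / 4 ^ j"
proof (cases "phased 0 j (Suc j) m = 0 \<and> phased 0 j (Suc j) (m - 1) = 0")
  case False
  have four: "(4::real) ^ j = 2 ^ j * 2 ^ j" by (simp flip: power_mult_distrib)
  show ?thesis
  proof (cases "j = 0")
    case True
    have "cmod (phased 0 j (Suc j) m - phased 0 j (Suc j) (m - 1)) \<le> 2 / 2 ^ j + 2 / 2 ^ j"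
      by (intro order_trans[OF norm_triangle_ineq4] add_mono norm_piece_le)
    then show ?thesis using True by simp
  next
    case j: False
    then obtain i where i: "j = Suc i" by (cases j) auto
    have "2 ^ j < 2 * \<bar>real_of_int m\<bar> \<or> 2 ^ j < 2 * \<bar>real_of_int (m - 1)\<bar>"
      using False piece_support[of 0 j m] piece_support[of 0 j "m - 1"] by blast
    then have "real_of_int (2 ^ i) < real_of_int \<bar>m\<bar> \<or> real_of_int (2 ^ i) < real_of_int \<bar>m - 1\<bar>" by (simp add: i)
    then have "2 ^ i < \<bar>m\<bar> \<or> 2 ^ i < \<bar>m - 1\<bar>" by (simp only: of_int_less_iff)
    moreover have "t \<le> \<bar>m\<bar> \<and> t \<le> \<bar>m - 1\<bar> \<and> (m > 1 \<or> m < 0)" if "t < \<bar>m\<bar> \<or> t < \<bar>m - 1\<bar>" "1 \<le> t" for t :: int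
      using that by (auto simp: abs_if split: if_splits)
    moreover have "(1::int) \<le> 2 ^ i" by (rule one_le_power) simp
    ultimately have big: "2 ^ i \<le> \<bar>m\<bar>" "2 ^ i \<le> \<bar>m - 1\<bar>" "m * (m - 1) > 0"
      by (blast, blast, smt (verit) zero_less_mult_iff)
    have "m * (m - 1) = \<bar>m\<bar> * \<bar>m - 1\<bar>" using big(3) by (simp flip: abs_mult)
    also have "\<dots> \<ge> 2 ^ i * 2 ^ i" using big by (intro mult_mono) auto
    finally have "real_of_int (2 ^ i * 2 ^ i) \<le> real_of_int (m * (m - 1))" by (simp only: of_int_le_iff)
    then have low: "4 ^ j / 4 \<le> real_of_int (m * (m - 1))" 
      using power_mult_distrib[of "2::real" 2 i] by (simp add: i)
    have "cmod (phased 0 j (Suc j) m - phased 0 j (Suc j) (m - 1)) \<le> (5 + 4 * pi * 0) * \<bar>real_of_int (m - (m - 1))\<bar> / real_of_int (m * (m - 1))"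
      using big(3) by (intro phased_regular) auto
    also have "\<dots> = 5 / real_of_int (m * (m - 1))" by simp
    also have "\<dots> \<le> 5 / (4 ^ j / 4)" using low by (intro frac_le) auto
    finally show ?thesis by simp
  qed
qed simp

text \<open>In the autocorrelation at distance \<open>h\<close> the quadratic phases combine to a linear phase of frequency
  \<open>2 \<alpha> h\<close>, against which the Lipschitz factor is summed by parts.\<close>

lemma piece_autocorrelation:
  fixes j :: nat and N :: int
  defines "N \<equiv> 2 ^ j"
  shows "cmod (\<Sum>l\<in>{-(2*N)..2*N}. phased \<alpha> j (Suc j) (l + h) * cnj (phased \<alpha> j (Suc j) l))
     \<le> 400 / of_int N * damp (of_int N * cmod (1 - ee (2 * \<alpha> * of_int h)))"
proof -
  have N: "N \<ge> 1" by (simp add: N_def)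
  have Nr: "real_of_int N = 2 ^ j" by (simp add: N_def)
  define k where "k = phased 0 j (Suc j)"
  define a where "a l = k (l + h) * k l" for l
  have kb: "cmod (k m) \<le> 2 / of_int N" for m unfolding k_def Nr by (rule norm_piece_le)
  have kv: "cmod (k m - k (m - 1)) \<le> 20 / (of_int N)\<^sup>2" for m
    using piece_variation[of j m] unfolding k_def Nr by (simp add: power2_eq_square flip: power_mult_distrib)
  have ph: "phased \<alpha> j (Suc j) l = ee (\<alpha> * (of_int l)\<^sup>2) * k l" for l by (simp add: k_def phased_def)
  have kr: "cnj (k l) = k l" for l by (simp add: k_def phased_def)
  have k0: "k l = 0" if "\<bar>l\<bar> \<ge> 2 * N" for l
    using piece_support[of 0 j l] that unfolding k_def N_def by force
  have "phased \<alpha> j (Suc j) (l + h) * cnj (phased \<alpha> j (Suc j) l) = ee (\<alpha> * (of_int h)\<^sup>2) * (a l * ee (of_int l * (2 * \<alpha> * of_int h)))" for l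
  proof -
    have "\<alpha> * (of_int (l + h))\<^sup>2 + - (\<alpha> * (of_int l)\<^sup>2) = \<alpha> * (of_int h)\<^sup>2 + of_int l * (2 * \<alpha> * of_int h)"
      by (simp add: power2_eq_square algebra_simps)
    then have "ee (\<alpha> * (of_int (l + h))\<^sup>2) * ee (- (\<alpha> * (of_int l)\<^sup>2)) = ee (\<alpha> * (of_int h)\<^sup>2) * ee (of_int l * (2 * \<alpha> * of_int h))"
      by (simp only: ee_add[symmetric])
    moreover have "phased \<alpha> j (Suc j) (l + h) * cnj (phased \<alpha> j (Suc j) l)
        = (ee (\<alpha> * (of_int (l + h))\<^sup>2) * ee (- (\<alpha> * (of_int l)\<^sup>2))) * a l"
      by (simp add: ph a_def kr cnj_ee mult_ac)
    ultimately show ?thesis by (simp add: mult_ac)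
  qed
  then have eq: "cmod (\<Sum>l\<in>{-(2*N)..2*N}. phased \<alpha> j (Suc j) (l + h) * cnj (phased \<alpha> j (Suc j) l))
      = cmod (\<Sum>l\<in>{-(2*N)..2*N}. a l * ee (of_int l * (2 * \<alpha> * of_int h)))"
    by (simp only: sum_distrib_left[symmetric] norm_mult norm_ee mult_1)
  define z where "z = cmod (\<Sum>l\<in>{-(2*N)..2*N}. a l * ee (of_int l * (2 * \<alpha> * of_int h)))"
  have cardN: "real (card {-(2*N)..2*N}) \<le> 5 * of_int N" using N by simp
  have z1: "z \<le> 20 / of_int N"
  proof -
    have "z \<le> (\<Sum>l\<in>{-(2*N)..2*N}. 2 / of_int N * (2 / of_int N))"
      unfolding z_def a_def
      by (intro order_trans[OF norm_sum] sum_mono) (simp only: norm_mult norm_ee mult_1_right, intro mult_mono kb, use N in auto)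
    also have "\<dots> = real (card {-(2*N)..2*N}) * (2 / of_int N * (2 / of_int N))" by simp
    also have "\<dots> \<le> 5 * of_int N * (2 / of_int N * (2 / of_int N))" using cardN by (intro mult_right_mono) auto
    also have "\<dots> = 20 / of_int N" using N by simp
    finally show ?thesis .
  qed
  have z2: "cmod (1 - ee (2 * \<alpha> * of_int h)) * z \<le> 400 / (of_int N)\<^sup>2"
  proof -
    have "z = cmod (\<Sum>l\<in>{-(2*N)..<2*N}. a l * ee (of_int l * (2 * \<alpha> * of_int h)))"
      unfolding z_def by (intro arg_cong[where f = cmod] sum.mono_neutral_right) (use k0 N in \<open>auto simp: a_def\<close>)
    then have "cmod (1 - ee (2 * \<alpha> * of_int h)) * z \<le> (\<Sum>l\<in>{-(2*N)..2*N}. cmod (a l - a (l - 1)))"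
      using k0 by (simp only:) (intro summation_by_parts_bound, auto simp: a_def)
    also have "\<dots> \<le> (\<Sum>l\<in>{-(2*N)..2*N}. 80 / (of_int N)^3)"
    proof (rule sum_mono)
      fix l
      have "a l - a (l - 1) = (k (l + h) - k (l + h - 1)) * k l + k (l + h - 1) * (k l - k (l - 1))"
        by (simp add: a_def algebra_simps)
      then have "cmod (a l - a (l - 1)) \<le> cmod (k (l + h) - k (l + h - 1)) * cmod (k l) + cmod (k (l + h - 1)) * cmod (k l - k (l - 1))"
        by (metis norm_mult norm_triangle_ineq)
      also have "\<dots> \<le> 20 / (of_int N)\<^sup>2 * (2 / of_int N) + 2 / of_int N * (20 / (of_int N)\<^sup>2)"
        using N by (intro add_mono mult_mono kb kv) auto
      also have "\<dots> = 80 / (of_int N)^3" by (simp add: power2_eq_square power3_eq_cube)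
      finally show "cmod (a l - a (l - 1)) \<le> 80 / (of_int N)^3" .
    qed
    also have "\<dots> = real (card {-(2*N)..2*N}) * (80 / (of_int N)^3)" by simp
    also have "\<dots> \<le> 5 * of_int N * (80 / (of_int N)^3)" using cardN N by (intro mult_right_mono) auto
    also have "\<dots> = 400 / (of_int N)\<^sup>2" using N by (simp add: power2_eq_square power3_eq_cube)
    finally show ?thesis .
  qed
  have Np: "real_of_int N > 0" using N by simp
  have "z * of_int N / 400 \<le> damp (of_int N * cmod (1 - ee (2 * \<alpha> * of_int h)))"
  proof (rule min_le_damp)
    have "z * of_int N \<le> 20" using z1 Np by (simp add: field_simps)
    then show "z * of_int N / 400 \<le> 1" by simp
    have "z * of_int N / 400 * (of_int N * cmod (1 - ee (2 * \<alpha> * of_int h))) = (of_int N)\<^sup>2 * (cmod (1 - ee (2 * \<alpha> * of_int h)) * z) / 400"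
      by (simp add: power2_eq_square mult_ac)
    also have "\<dots> \<le> (of_int N)\<^sup>2 * (400 / (of_int N)\<^sup>2) / 400" using z2 by (intro divide_right_mono mult_left_mono) auto
    also have "\<dots> = 1" using Np by simp
    finally show "z * of_int N / 400 * (of_int N * cmod (1 - ee (2 * \<alpha> * of_int h))) \<le> 1" .
  qed (use Np in auto)
  then show ?thesis unfolding eq z_def[symmetric] using Np by (simp add: field_simps)
qed

text \<open>Up to a constant, a bound for the square of the \<open>\<ell>\<^sup>2\<close> norm of the piece at scale \<open>j\<close> if \<open>2 \<alpha>\<close> has the signed
  distance \<open>\<theta>\<close> from a reduced fraction with denominator \<open>q\<close>.\<close>

definition decay :: "nat \<Rightarrow> int \<Rightarrow> real \<Rightarrow> real" where
  "decay j q \<theta> = 1 / sqrt (2 ^ j) + damp (4 ^ j * \<bar>\<theta>\<bar>) / of_int q"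

lemma piece_l2:
  assumes q: "1 \<le> q" "q \<le> 8 * 2 ^ j" and bq: "coprime b q"
    and \<theta>: "\<bar>2 * \<alpha> - of_int b / of_int q\<bar> \<le> 1 / (8 * 2 ^ j * of_int q)"
  shows "form_bdd (\<lambda>_. 1) (200 * sqrt (decay j q (2 * \<alpha> - of_int b / of_int q))) (\<lambda>n m. phased \<alpha> j (Suc j) (n - m))"
proof -
  define N where "N = (2::int) ^ j"
  define \<theta>' where "\<theta>' = 2 * \<alpha> - of_int b / of_int q"
  have N: "N \<ge> 1" by (simp add: N_def)
  have Nr: "real_of_int N = 2 ^ j" by (simp add: N_def)
  have N2: "(real_of_int N)\<^sup>2 = 4 ^ j" unfolding Nr by (simp add: power2_eq_square flip: power_mult_distrib)
  have dec0: "decay j q \<theta>' \<ge> 0" using q by (simp add: decay_def damp_bounds)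
  show ?thesis
  proof (rule form_bdd_convolution[where R = "2 * N" and Z = "{-4*N..4*N}"
        and c = "\<lambda>h. 400 / of_int N * damp (of_int N * cmod (1 - ee (2 * \<alpha> * of_int h)))"])
    show "phased \<alpha> j (Suc j) l = 0" if "l \<notin> {-(2*N)..2*N}" for l
      using piece_support[of \<alpha> j l] that by (force simp: N_def)
    show "cmod (\<Sum>l\<in>{-(2*N)..2*N}. phased \<alpha> j (Suc j) (l + h) * cnj (phased \<alpha> j (Suc j) l))
      \<le> 400 / of_int N * damp (of_int N * cmod (1 - ee (2 * \<alpha> * of_int h)))" for h
      unfolding N_def by (rule piece_autocorrelation)
    show "(\<Sum>l\<in>{-(2*N)..2*N}. phased \<alpha> j (Suc j) (l + h) * cnj (phased \<alpha> j (Suc j) l)) = 0" if "h \<notin> {-4*N..4*N}" for h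
    proof (rule sum.neutral, rule ballI)
      fix l assume "l \<in> {-(2*N)..2*N}"
      then have "\<bar>l + h\<bar> \<ge> 2 * N" using that by auto
      then have "phased \<alpha> j (Suc j) (l + h) = 0" using piece_support[of \<alpha> j "l + h"] by (force simp: N_def)
      then show "phased \<alpha> j (Suc j) (l + h) * cnj (phased \<alpha> j (Suc j) l) = 0" by simp
    qed
    have "(\<Sum>h\<in>{-4*N..4*N}. damp (of_int N * cmod (1 - ee (2 * \<alpha> * of_int h))))
       \<le> 97 * sqrt (of_int N) + 8 * (of_int N / of_int q) * damp ((of_int N)\<^sup>2 * \<bar>\<theta>'\<bar>)"
      by (rule damped_sum_bound[OF N q(1) _ bq \<theta>'_def]) (use q \<theta> in \<open>auto simp: N_def \<theta>'_def\<close>)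
    then have "(\<Sum>h\<in>{-4*N..4*N}. 400 / of_int N * damp (of_int N * cmod (1 - ee (2 * \<alpha> * of_int h))))
       \<le> 400 / of_int N * (97 * sqrt (of_int N) + 8 * (of_int N / of_int q) * damp ((of_int N)\<^sup>2 * \<bar>\<theta>'\<bar>))"
      unfolding sum_distrib_left[symmetric] using N by (intro mult_left_mono) auto
    also have "\<dots> = 38800 * (sqrt (of_int N) / of_int N) + 3200 * (damp ((of_int N)\<^sup>2 * \<bar>\<theta>'\<bar>) / of_int q)"
      using N by (simp add: field_simps)
    also have "sqrt (of_int N) / of_int N = 1 / sqrt (real_of_int N)"
      using N by (simp add: field_simps)
    also have "38800 * (1 / sqrt (real_of_int N)) + 3200 * (damp ((of_int N)\<^sup>2 * \<bar>\<theta>'\<bar>) / of_int q)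
       \<le> 40000 * (1 / sqrt (real_of_int N)) + 40000 * (damp ((of_int N)\<^sup>2 * \<bar>\<theta>'\<bar>) / of_int q)"
      using N q damp_bounds(1)[of "(of_int N)\<^sup>2 * \<bar>\<theta>'\<bar>"] by (intro add_mono mult_right_mono) auto
    also have "\<dots> = 40000 * decay j q \<theta>'" unfolding decay_def N2 unfolding Nr by simp
    also have "\<dots> = (200 * sqrt (decay j q \<theta>'))\<^sup>2" using dec0 by (simp add: power_mult_distrib)
    finally show "(\<Sum>h\<in>{-4*N..4*N}. 400 / of_int N * damp (of_int N * cmod (1 - ee (2 * \<alpha> * of_int h)))) \<le> (200 * sqrt (decay j q (2 * \<alpha> - of_int b / of_int q)))\<^sup>2"
      by (simp only: \<theta>'_def)
    show "0 \<le> 200 * sqrt (decay j q (2 * \<alpha> - of_int b / of_int q))" using dec0 by (simp add: \<theta>'_def)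
  qed simp
qed

lemma powr_add_le:
  fixes x y :: real
  assumes "x \<ge> 0" "y \<ge> 0" "0 < s" "s \<le> 1"
  shows "(x + y) powr s \<le> x powr s + y powr s"
proof (cases "x + y = 0")
  case False
  then have xy: "x + y > 0" using assms by simp
  have le: "t \<le> t powr s" if "0 \<le> t" "t \<le> 1" for t :: real
    using that assms powr_mono'[of s 1 t] by (cases "t = 0") auto
  have "1 = x / (x + y) + y / (x + y)" using False by (simp add: add_divide_distrib[symmetric])
  also have "\<dots> \<le> (x / (x + y)) powr s + (y / (x + y)) powr s"
    using assms xy by (intro add_mono le) auto
  also have "\<dots> = (x powr s + y powr s) / (x + y) powr s"
    using assms xy by (simp add: powr_divide add_divide_distrib)
  finally show ?thesis using xy by (simp add: field_simps)
qed (use assms in simp)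

text \<open>Weyl's inequality on \<open>\<ell>\<^sup>2(w)\<close>: the eighth root of the unweighted norm survives, which is the
  sixteenth root of \<open>decay\<close>.\<close>

lemma piece_weighted:
  assumes w: "bump C w" and q: "1 \<le> q" "q \<le> 8 * 2 ^ j" and bq: "coprime b q"
    and \<theta>: "\<bar>2 * \<alpha> - of_int b / of_int q\<bar> \<le> 1 / (8 * 2 ^ j * of_int q)"
  shows "form_bdd w (4800 * C powr (1/3) * (2 powr (- real j / 32)
      + (damp (4 ^ j * \<bar>2 * \<alpha> - of_int b / of_int q\<bar>) / of_int q) powr (1/16))) (\<lambda>n m. phased \<alpha> j (Suc j) (n - m))"
proof -
  define \<theta>' where "\<theta>' = 2 * \<alpha> - of_int b / of_int q"
  define d where "d = decay j q \<theta>'"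
  have x: "0 < 1 / sqrt (2 ^ j :: real)" "1 / sqrt (2 ^ j :: real) \<le> 1" by auto
  have y: "0 \<le> damp (4 ^ j * \<bar>\<theta>'\<bar>) / of_int q" "damp (4 ^ j * \<bar>\<theta>'\<bar>) / of_int q \<le> 1"
    using q damp_bounds[of "4 ^ j * \<bar>\<theta>'\<bar>"] by (auto simp: field_simps intro: order_trans)
  have d: "0 < d" "d \<le> 2" using x y unfolding d_def decay_def by linarith+
  define \<epsilon> where "\<epsilon> = sqrt (d / 2)"
  have \<epsilon>: "0 < \<epsilon>" "\<epsilon> \<le> 1" using d by (auto simp: \<epsilon>_def)
  have l2: "form_bdd (\<lambda>_. 1) (300 * \<epsilon>) (\<lambda>n m. phased \<alpha> j (Suc j) (n - m))"
  proof (rule form_bdd_mono[OF piece_l2[OF q bq \<theta>]])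
    have "200 * sqrt d = 200 * sqrt 2 * \<epsilon>" by (simp add: \<epsilon>_def real_sqrt_divide)
    also have "\<dots> \<le> 300 * \<epsilon>"
    proof (intro mult_right_mono)
      have "sqrt 2 \<le> (3/2::real)" by (rule real_le_lsqrt) (auto simp: power2_eq_square)
      then show "200 * sqrt 2 \<le> (300::real)" by simp
    qed (use \<epsilon> in auto)
    finally show "200 * sqrt (decay j q (2 * \<alpha> - of_int b / of_int q)) \<le> 300 * \<epsilon>" by (simp add: d_def \<theta>'_def)
  qed (simp add: weight_def)
  have "form_bdd w (16 * C powr (1/3) * 300 * \<epsilon> powr (1/8)) (\<lambda>n m. phased \<alpha> j (Suc j) (n - m))"
  proof (rule single_scale[OF w, where N = "2 * 2 ^ j"])
    show "cmod (phased \<alpha> j (Suc j) (n - m)) \<le> 300 / real_of_int (2 * 2 ^ j)" for n m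
      using norm_piece_le[of \<alpha> j "n - m"] by (rule order_trans) (simp add: field_simps)
    show "phased \<alpha> j (Suc j) (n - m) = 0" if "\<bar>n - m\<bar> > 2 * 2 ^ j" for n m
      using piece_support[of \<alpha> j "n - m"] that by force
    show "(1::int) \<le> 2 * 2 ^ j" using one_le_power[of "2::int" "Suc j"] by simp
  qed (use \<epsilon> l2 in auto)
  then show ?thesis
  proof (rule form_bdd_mono)
    have "\<epsilon> powr (1/8) = (d / 2) powr (1/16)"
      using d by (simp add: \<epsilon>_def powr_half_sqrt[symmetric] powr_powr)
    also have "\<dots> \<le> d powr (1/16)" using d by (intro powr_mono2) auto
    also have "\<dots> \<le> (1 / sqrt (2 ^ j)) powr (1/16) + (damp (4 ^ j * \<bar>\<theta>'\<bar>) / of_int q) powr (1/16)"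
      unfolding d_def decay_def using x y by (intro powr_add_le) auto
    also have "(1 / sqrt (2 ^ j :: real)) powr (1/16) = 2 powr (- real j / 32)"
    proof -
      have "1 / sqrt (2 ^ j :: real) = 2 powr (- real j / 2)"
        by (simp add: powr_minus_divide powr_half_sqrt[symmetric] powr_powr flip: powr_realpow)
      then show ?thesis by (simp add: powr_powr)
    qed
    finally have "4800 * C powr (1/3) * \<epsilon> powr (1/8) \<le> 4800 * C powr (1/3) * (2 powr (- real j / 32) + (damp (4 ^ j * \<bar>\<theta>'\<bar>) / of_int q) powr (1/16))"
      by (intro mult_left_mono) auto
    then show "16 * C powr (1/3) * 300 * \<epsilon> powr (1/8) \<le> 4800 * C powr (1/3) * (2 powr (- real j / 32)
      + (damp (4 ^ j * \<bar>2 * \<alpha> - of_int b / of_int q\<bar>) / of_int q) powr (1/16))" by (simp add: \<theta>'_def)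
  qed (use w in \<open>simp add: bump_def\<close>)
qed

section \<open>The block of scales near a rational frequency\<close>

lemma sum_int_nat: "(\<Sum>x\<in>{0..<int n}. h x) = (\<Sum>k<n. h (int k))"
  by (rule sum.reindex_bij_witness[of _ int nat]) auto

lemma sum_blocks:
  fixes P :: int
  assumes P: "P > 0"
  shows "(\<Sum>l\<in>{c..<d}. \<Sum>x\<in>{0..<P}. h (P * l + x)) = (\<Sum>n\<in>{P * c..<P * d}. h n)"
proof -
  have "(\<Sum>l\<in>{c..<d}. \<Sum>x\<in>{0..<P}. h (P * l + x)) = (\<Sum>(l, x)\<in>{c..<d} \<times> {0..<P}. h (P * l + x))"
    by (rule sum.cartesian_product)
  also have "\<dots> = (\<Sum>n\<in>{P * c..<P * d}. h n)"
  proof (rule sum.reindex_bij_witness[of _ "\<lambda>n. (n div P, n mod P)" "\<lambda>(l, x). P * l + x"])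
    fix n assume n: "n \<in> {P * c..<P * d}"
    have "c = P * c div P" using P by simp
    also have "\<dots> \<le> n div P" using n P by (intro zdiv_mono1) auto
    finally have c: "c \<le> n div P" .
    have "P * (n div P) \<le> n" using P by (simp add: minus_mod_eq_mult_div[symmetric])
    then have "P * (n div P) < P * d" using n by simp
    then have "n div P < d" using P by simp
    then show "(n div P, n mod P) \<in> {c..<d} \<times> {0..<P}" using c P by simp
  next
    fix lx assume lx: "lx \<in> {c..<d} \<times> {0..<P}"
    obtain l x where [simp]: "lx = (l, x)" by (cases lx)
    have lx': "c \<le> l" "l + 1 \<le> d" "0 \<le> x" "x < P" using lx by auto
    have "P * c \<le> P * l" "P * (l + 1) \<le> P * d" using lx' P by (auto intro: mult_left_mono)
    then have "P * c \<le> P * l + x" "P * l + x < P * d" using lx' unfolding distrib_left by linarith+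
    then show "(case lx of (l, x) \<Rightarrow> P * l + x) \<in> {P * c..<P * d}" by simp
  qed (use P in \<open>auto simp: div_pos_pos_trivial\<close>)
  finally show ?thesis .
qed

text \<open>The kernel of \<open>A\<^sup>* A\<close> is a complete exponential sum over \<open>x\<close>, which vanishes unless \<open>q\<close> divides \<open>y - y'\<close>. What is
  left are three diagonals with entries of size at most \<open>1 / (2 q)\<close>.\<close>

lemma gauss_matrix_l2:
  fixes q b :: int and f :: "int \<Rightarrow> complex"
  assumes q: "q \<ge> 1" and bq: "coprime b q"
  defines "P \<equiv> 2 * q"
  defines "A \<equiv> (\<lambda>x y. ee (of_int (b * (x - y)\<^sup>2) / of_int P) / of_int P)"
  shows "(\<Sum>x\<in>{0..<P}. (cmod (\<Sum>y\<in>{0..<P}. A x y * f y))\<^sup>2) \<le> 3 / (2 * of_int q) * (\<Sum>y\<in>{0..<P}. (cmod (f y))\<^sup>2)"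
proof -
  define I where "I = {0..<P}"
  have P: "P > 0" "real_of_int P > 0" using q by (auto simp: P_def)
  have Pc: "complex_of_int P \<noteq> 0" using P by simp
  define K where "K y y' = (\<Sum>x\<in>I. A x y * cnj (A x y'))" for y y'
  have Kval: "cmod (K y y') \<le> (if q dvd y - y' then 1 / of_int P else 0)" for y y'
  proof -
    have "A x y * cnj (A x y') = ee (of_int (b * (y\<^sup>2 - y'\<^sup>2)) / of_int P) / (of_int P)\<^sup>2 * ee (of_int x * (of_int (2 * b * (y' - y)) / of_int P))" for x
    proof -
      have "ee (of_int (b * (x - y)\<^sup>2) / of_int P) * ee (- (of_int (b * (x - y')\<^sup>2) / of_int P))
        = ee (of_int (b * (y\<^sup>2 - y'\<^sup>2)) / of_int P) * ee (of_int x * (of_int (2 * b * (y' - y)) / of_int P))"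
        unfolding ee_add[symmetric] by (rule arg_cong[where f = ee]) (simp add: power2_eq_square algebra_simps diff_divide_distrib add_divide_distrib)
      then show ?thesis by (simp add: A_def cnj_ee power2_eq_square)
    qed
    then have "K y y' = ee (of_int (b * (y\<^sup>2 - y'\<^sup>2)) / of_int P) / (of_int P)\<^sup>2 * (\<Sum>x\<in>I. ee (of_int x * (of_int (2 * b * (y' - y)) / of_int P)))"
      by (simp add: K_def sum_distrib_left)
    also have "(\<Sum>x\<in>I. ee (of_int x * (of_int (2 * b * (y' - y)) / of_int P))) = (if P dvd 2 * b * (y' - y) then of_int P else 0)"
    proof -
      have "I = {0..<int (nat P)}" using P by (simp add: I_def)
      then show ?thesis
        using sum_characters[of "nat P" "2 * b * (y' - y)"] P sum_int_nat[of "\<lambda>x. ee (of_int x * (of_int (2 * b * (y' - y)) / of_int P))" "nat P"]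
        by simp
    qed
    finally have "cmod (K y y') = (if P dvd 2 * b * (y' - y) then 1 / of_int P else 0)"
      using P by (simp add: norm_mult norm_divide norm_power power2_eq_square)
    moreover have "q dvd y - y'" if "P dvd 2 * b * (y' - y)"
    proof -
      have "2 * q dvd 2 * (b * (y' - y))" using that by (simp add: P_def mult.assoc)
      then have "q dvd b * (y' - y)" by simp
      then have "q dvd y' - y" using bq by (simp add: coprime_dvd_mult_right_iff coprime_commute)
      then show ?thesis by (simp add: dvd_diff_commute)
    qed
    ultimately show ?thesis using P by auto
  qed
  define K' where "K' y' y = (if y \<in> I \<and> y' \<in> I then K y y' else 0)" for y' y
  have fb: "form_bdd (\<lambda>_. 1) (3 / (2 * of_int q)) K'"
  proof (rule form_bdd_Schur[where Z = "{-q, 0, q}" and c = "\<lambda>_. 1 / of_int P"])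
    fix n m assume nm: "n - m \<notin> {-q, 0, q}"
    show "K' n m = 0"
    proof (rule ccontr)
      assume "K' n m \<noteq> 0"
      then have I: "n \<in> I" "m \<in> I" and "K m n \<noteq> 0" by (auto simp: K'_def split: if_splits)
      then have "q dvd m - n" using Kval[of m n] by (auto split: if_splits)
      then obtain t where t: "m - n = q * t" by (elim dvdE)
      have "\<bar>m - n\<bar> < 2 * q" using I by (auto simp: I_def P_def)
      then have "q * \<bar>t\<bar> < q * 2" using q by (simp add: t abs_mult)
      then have "\<bar>t\<bar> < 2" using q by simp
      then have "t \<in> {-1, 0, 1}" by auto
      then show False using t nm by auto
    qed
  next
    fix n m
    have "cmod (K m n) \<le> 1 / of_int P" using Kval[of m n] P by (auto split: if_splits intro: order_trans)
    then show "cmod (K' n m) \<le> 1 / of_int P" using P by (simp add: K'_def)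
  next
    show "(\<Sum>h\<in>{-q, 0, q}. 1 / real_of_int P) \<le> 3 / (2 * of_int q)" using q by (simp add: P_def field_simps)
  qed (use P in auto)
  have "complex_of_real (\<Sum>x\<in>I. (cmod (\<Sum>y\<in>I. A x y * f y))\<^sup>2) = (\<Sum>x\<in>I. (\<Sum>y\<in>I. A x y * f y) * (\<Sum>y'\<in>I. cnj (A x y') * cnj (f y')))"
    by (simp only: of_real_sum complex_norm_square cnj_sum complex_cnj_mult)
  also have "\<dots> = (\<Sum>x\<in>I. \<Sum>y\<in>I. \<Sum>y'\<in>I. (A x y * cnj (A x y')) * (f y * cnj (f y')))"
    unfolding sum_product by (simp add: mult_ac)
  also have "\<dots> = (\<Sum>y\<in>I. \<Sum>x\<in>I. \<Sum>y'\<in>I. (A x y * cnj (A x y')) * (f y * cnj (f y')))" by (rule sum.swap)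
  also have "\<dots> = (\<Sum>y\<in>I. \<Sum>y'\<in>I. \<Sum>x\<in>I. (A x y * cnj (A x y')) * (f y * cnj (f y')))"
    by (rule sum.cong[OF refl], rule sum.swap)
  also have "\<dots> = (\<Sum>y\<in>I. \<Sum>y'\<in>I. K' y' y * f y * cnj (f y'))"
    unfolding sum_distrib_right[symmetric] by (intro sum.cong refl) (simp add: K'_def K_def mult.assoc)
  also have "\<dots> = (\<Sum>y'\<in>I. \<Sum>y\<in>I. K' y' y * f y * cnj (f y'))" by (rule sum.swap)
  finally have "cmod (complex_of_real (\<Sum>x\<in>I. (cmod (\<Sum>y\<in>I. A x y * f y))\<^sup>2)) = cmod (\<Sum>y'\<in>I. \<Sum>y\<in>I. K' y' y * f y * cnj (f y'))"
    by (rule arg_cong)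
  also have "\<dots> \<le> 3 / (2 * of_int q) * sqrt (\<Sum>m\<in>I. (cmod (f m))\<^sup>2 * 1) * sqrt (\<Sum>n\<in>I. (cmod (cnj (f n)))\<^sup>2 / 1)"
    by (rule form_bddD[OF fb]) (simp add: I_def)
  also have "\<dots> = 3 / (2 * of_int q) * (\<Sum>m\<in>I. (cmod (f m))\<^sup>2)" by (simp add: sum_nonneg)
  finally show ?thesis unfolding I_def
    by (simp only: norm_of_real abs_of_nonneg[OF sum_nonneg[OF zero_le_power2]])
qed

text \<open>The Gauss sum matrix loses nothing from \<open>L\<^sup>1\<close> to \<open>L\<^sup>\<infinity>\<close> and gains \<open>q\<^bsup>-1/2\<^esup>\<close> on \<open>L\<^sup>2\<close>,
  in normalised terms; in between it gains a power of \<open>q\<close>.\<close>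

lemma gauss_matrix_pairing:
  fixes q b :: int
  assumes q: "q \<ge> 1" and bq: "coprime b q"
  defines "P \<equiv> 2 * q"
  defines "A \<equiv> (\<lambda>x y. ee (of_int (b * (x - y)\<^sup>2) / of_int P) / of_int P)"
  shows "cmod (\<Sum>x\<in>{0..<P}. \<Sum>y\<in>{0..<P}. A x y * f y * g x)
    \<le> 6 * of_int P * of_int q powr (-1/16) * pav (9/8) {0..<P} f * pav (9/8) {0..<P} g"
proof -
  let ?I = "{0..<P}"
  have P: "P > 0" using q by (simp add: P_def)
  have cI: "real (card ?I) = of_int P" using P by simp
  define \<epsilon> where "\<epsilon> = 1 / sqrt (of_int q)"
  have \<epsilon>: "0 < \<epsilon>" "\<epsilon> \<le> 1" using q by (auto simp: \<epsilon>_def)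
  have "cmod (\<Sum>x\<in>?I. \<Sum>y\<in>?I. A x y * f y * g x)
    \<le> 3 * 2 * real (card ?I) * \<epsilon> powr (9/8 - 1) * pav (9/8) ?I f * pav (9/8) ?I g"
  proof (rule truncated_pairing)
    fix x y
    show "cmod (A x y) \<le> 2 / real (card ?I)" unfolding cI A_def using P by (simp add: norm_divide divide_right_mono)
  next
    fix f g :: "int \<Rightarrow> complex"
    have "cmod (\<Sum>x\<in>?I. \<Sum>y\<in>?I. A x y * f y * g x) = cmod (\<Sum>x\<in>?I. (\<Sum>y\<in>?I. A x y * f y) * g x)"
      by (simp add: sum_distrib_right)
    also have "\<dots> \<le> (\<Sum>x\<in>?I. sqrt ((cmod (\<Sum>y\<in>?I. A x y * f y))\<^sup>2) * sqrt ((cmod (g x))\<^sup>2))"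
      by (simp add: norm_mult[symmetric] norm_sum)
    also have "\<dots> \<le> sqrt (\<Sum>x\<in>?I. (cmod (\<Sum>y\<in>?I. A x y * f y))\<^sup>2) * sqrt (\<Sum>x\<in>?I. (cmod (g x))\<^sup>2)"
      by (intro Cauchy_Schwarz_sqrt) auto
    also have "\<dots> \<le> sqrt ((2 * \<epsilon>)\<^sup>2 * (\<Sum>y\<in>?I. (cmod (f y))\<^sup>2)) * sqrt (\<Sum>x\<in>?I. (cmod (g x))\<^sup>2)"
    proof (intro mult_right_mono real_sqrt_le_mono)
      have "(\<Sum>x\<in>?I. (cmod (\<Sum>y\<in>?I. A x y * f y))\<^sup>2) \<le> 3 / (2 * of_int q) * (\<Sum>y\<in>?I. (cmod (f y))\<^sup>2)"
        unfolding A_def P_def by (rule gauss_matrix_l2[OF q bq])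
      also have "\<dots> \<le> (2 * \<epsilon>)\<^sup>2 * (\<Sum>y\<in>?I. (cmod (f y))\<^sup>2)"
        using q by (intro mult_right_mono sum_nonneg) (auto simp: \<epsilon>_def power_mult_distrib power_divide field_simps)
      finally show "(\<Sum>x\<in>?I. (cmod (\<Sum>y\<in>?I. A x y * f y))\<^sup>2) \<le> (2 * \<epsilon>)\<^sup>2 * (\<Sum>y\<in>?I. (cmod (f y))\<^sup>2)" .
    qed (simp add: sum_nonneg)
    also have "\<dots> = 2 * \<epsilon> * sqrt (\<Sum>y\<in>?I. (cmod (f y))\<^sup>2) * sqrt (\<Sum>x\<in>?I. (cmod (g x))\<^sup>2)"
      using \<epsilon> by (simp add: real_sqrt_mult)
    finally show "cmod (\<Sum>x\<in>?I. \<Sum>y\<in>?I. A x y * f y * g x)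
       \<le> 2 * \<epsilon> * sqrt (\<Sum>y\<in>?I. (cmod (f y))\<^sup>2) * sqrt (\<Sum>x\<in>?I. (cmod (g x))\<^sup>2)" .
  qed (use P \<epsilon> in auto)
  also have "\<epsilon> powr (9/8 - 1) = of_int q powr (-1/16)"
  proof -
    have "\<epsilon> = of_int q powr (-1/2)" using q by (simp add: \<epsilon>_def powr_minus_divide powr_half_sqrt)
    then show ?thesis by (simp add: powr_powr)
  qed
  finally show ?thesis unfolding cI by simp
qed

definition tensor_const :: "real \<Rightarrow> real \<Rightarrow> real" where
  "tensor_const D C = cz_const (9/8) (pairing_const D powr (9/8)) D * 18 * C powr (1/3) * max_const (10/9)"

text \<open>The product of a Gauss sum matrix acting inside blocks of length \<open>2 q\<close> and a
  Calderon-Zygmund operator acting between blocks. Functions on a block carry the \<open>L\<^sup>p\<close> norm with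
  \<open>p = 9/8\<close>, for which the singular integral is bounded trivially from the scalar case and the matrix has
  its gain; averages of this norm over blocks are averages over intervals of \<open>\<int>\<close>, so that the bump
  condition on the weight can be used.\<close>

lemma tensor_form_bdd:
  fixes q b :: int and \<kappa> :: "int \<Rightarrow> complex"
  assumes w: "bump C w" and q: "q \<ge> 1" and bq: "coprime b q" and \<kappa>: "odd_cz D \<kappa>"
  defines "P \<equiv> 2 * q"
  defines "A \<equiv> (\<lambda>x y. ee (of_int (b * (x - y)\<^sup>2) / of_int P) / of_int P)"
  shows "form_bdd w (tensor_const D C * of_int q powr (-1/16)) (\<lambda>n m. A (n mod P) (m mod P) * \<kappa> (n div P - m div P))"
  unfolding form_bdd_def
proof (intro allI impI)
  fix W :: "int set" and f g :: "int \<Rightarrow> complex" assume W: "finite W"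
  have w0: "w x > 0" for x using w by (auto simp: bump_def weight_def)
  have D: "D \<ge> 0" using \<kappa> by (simp add: odd_cz_def)
  have P: "P > 0" "real_of_int P > 0" using q by (auto simp: P_def)
  define f' where "f' n = (if n \<in> W then f n else 0)" for n
  define g' where "g' n = (if n \<in> W then g n else 0)" for n
  define S where "S = {0..<P}"
  have S: "finite S" "S \<noteq> {}" "real (card S) = of_int P" using P by (auto simp: S_def)
  define \<gamma> where "\<gamma> = real_of_int q powr (-1/16)"
  have \<gamma>: "\<gamma> \<ge> 0" by (simp add: \<gamma>_def)
  define F where "F l x = f' (P * l + x)" for l x
  define B where "B l y = (\<Sum>x\<in>S. A x y * g' (P * l + x))" for l y
  define gl where "gl l x = g' (P * l + x)" for l x
  define G where "G l = 6 * \<gamma> * of_int P powr (1/9) * pav (9/8) S (gl l)" for l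
  define a where "a n = ((cmod (f' n))\<^sup>2 * w n) powr (9/10)" for n
  define b' where "b' n = ((cmod (g' n))\<^sup>2 / w n) powr (9/10)" for n
  have ma: "\<And>n. a n \<ge> 0" "\<And>n. n \<notin> W \<Longrightarrow> a n = 0" by (auto simp: a_def f'_def)
  have mb: "\<And>n. b' n \<ge> 0" "\<And>n. n \<notin> W \<Longrightarrow> b' n = 0" by (auto simp: b'_def g'_def)
  define M where "M n = maxfn a n powr (5/9) * maxfn b' n powr (5/9)" for n
  define c3 where "c3 = C powr (1/3)"
  have c3: "c3 \<ge> 0" by (simp add: c3_def)
  define \<Phi> where "\<Phi> l = 18 * \<gamma> * c3 * (\<Sum>x\<in>S. M (P * l + x))" for l
  define cz where "cz = cz_const (9/8) (pairing_const D powr (9/8)) D"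
  have cz: "cz \<ge> 0" by (simp add: cz_def cz_const_def)
  define k where "k = nat (Max (insert 1 (abs ` W))) + 1"
  have kb: "\<bar>n\<bar> < 2 ^ k" if "n \<in> W" for n
  proof -
    have "\<bar>n\<bar> \<le> Max (insert 1 (abs ` W))" using W that by (intro Max_ge) auto
    then have "\<bar>n\<bar> < int k" unfolding k_def by linarith
    also have "int k < 2 ^ k" by (rule of_nat_less_two_power)
    finally show ?thesis .
  qed
  define c :: int where "c = - (2 ^ k)"
  define Q where "Q = {c..<c + 2 ^ Suc k}"
  define Q3 where "Q3 = {c - 2 ^ Suc k..<c + 2 * 2 ^ Suc k}"
  have WQ: "W \<subseteq> {P * c..<P * (c + 2 ^ Suc k)}" "W \<subseteq> {P * (c - 2 ^ Suc k)..<P * (c + 2 * 2 ^ Suc k)}"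
  proof -
    have "n \<in> {P * c..<P * (c + 2 ^ Suc k)}" if "n \<in> W" for n
    proof -
      have "1 * (2::int) ^ k \<le> P * 2 ^ k" using P by (intro mult_right_mono) auto
      then have "- (P * 2 ^ k) \<le> n" "n < P * 2 ^ k" using kb[OF that] by linarith+
      then show ?thesis by (simp add: c_def)
    qed
    then show 1: "W \<subseteq> {P * c..<P * (c + 2 ^ Suc k)}" by blast
    have "P * (c - 2 ^ Suc k) \<le> P * c" "P * (c + 2 ^ Suc k) \<le> P * (c + 2 * 2 ^ Suc k)"
      using P by (intro mult_left_mono; simp)+
    then show "W \<subseteq> {P * (c - 2 ^ Suc k)..<P * (c + 2 * 2 ^ Suc k)}" using 1 by (meson atLeastLessThan_iff order_trans less_le_trans subset_iff)
  qed
  have pairing: "cmod (\<Sum>y\<in>S. B l y * h y) \<le> G l * (\<Sum>y\<in>S. cmod (h y) powr (9/8)) powr (1 / (9/8))" for l h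
  proof -
    have "(\<Sum>y\<in>S. B l y * h y) = (\<Sum>y\<in>S. \<Sum>x\<in>S. A x y * h y * gl l x)"
      unfolding B_def gl_def sum_distrib_right by (intro sum.cong refl) (simp add: mult_ac)
    also have "\<dots> = (\<Sum>x\<in>S. \<Sum>y\<in>S. A x y * h y * gl l x)" by (rule sum.swap)
    also have "cmod \<dots> \<le> 6 * of_int P * \<gamma> * pav (9/8) S h * pav (9/8) S (gl l)"
      unfolding S_def A_def P_def \<gamma>_def by (rule gauss_matrix_pairing[OF q bq])
    also have "pav (9/8) S h = of_int P powr (-8/9) * (\<Sum>y\<in>S. cmod (h y) powr (9/8)) powr (1 / (9/8))"
      using P S by (simp add: pav_def avg_def powr_divide sum_nonneg powr_minus_divide)
    also have "6 * of_int P * \<gamma> * (of_int P powr (-8/9) * (\<Sum>y\<in>S. cmod (h y) powr (9/8)) powr (1 / (9/8))) * pav (9/8) S (gl l)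
       = 6 * \<gamma> * (of_int P * of_int P powr (-8/9)) * pav (9/8) S (gl l) * (\<Sum>y\<in>S. cmod (h y) powr (9/8)) powr (1 / (9/8))"
      by simp
    also have "of_int P * of_int P powr (-8/9) = real_of_int P powr (1/9)"
      using P powr_add[of "real_of_int P" 1 "-8/9"] by simp
    finally show ?thesis by (simp only: G_def)
  qed
  have \<Phi>b: "avg {c - 2 ^ k..<c + 2 * 2 ^ k} (\<lambda>m. \<Sum>x\<in>S. cmod (F m x) powr (9/8)) powr (1 / (9/8)) * avg {c..<c + 2 ^ k} G \<le> \<Phi> l"
    if l: "l \<in> {c..<c + 2 ^ k}" for c k l
  proof -
    define L :: int where "L = 2 ^ k"
    have L: "L \<ge> 1" unfolding L_def by (rule one_le_power) simp
    define I where "I = {P * (c - L)..<P * (c + 2 * L)}"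
    have Iab: "P * (c - L) < P * (c + 2 * L)" using P L by simp
    have cI: "real (card I) = 3 * of_int L * of_int P" using Iab by (simp add: I_def algebra_simps)
    have I: "finite I" "I \<noteq> {}" using Iab by (auto simp: I_def)
    have "(\<Sum>m\<in>{c - L..<c + 2 * L}. \<Sum>x\<in>S. cmod (F m x) powr (9/8)) = (\<Sum>n\<in>I. cmod (f' n) powr (9/8))"
      unfolding F_def S_def I_def by (rule sum_blocks[OF P(1), where h = "\<lambda>n. cmod (f' n) powr (9/8)"])
    then have "avg {c - L..<c + 2 * L} (\<lambda>m. \<Sum>x\<in>S. cmod (F m x) powr (9/8)) = of_int P * avg I (\<lambda>n. cmod (f' n) powr (9/8))"
      using L P cI unfolding avg_def by (simp add: field_simps)
    then have e1: "avg {c - L..<c + 2 * L} (\<lambda>m. \<Sum>x\<in>S. cmod (F m x) powr (9/8)) powr (1 / (9/8)) = of_int P powr (8/9) * pav (9/8) I f'"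
      using P by (simp add: pav_def powr_mult avg_nonneg)
    \<comment> \<open>The average of the block norms of \<open>g\<close> over \<open>l\<close> is at most a constant times the \<open>L\<^sup>p\<close> average over the tripled interval of \<open>\<int>\<close>.\<close>
    have "avg {c..<c + L} (\<lambda>l. pav (9/8) S (gl l)) powr (9/8) \<le> avg {c..<c + L} (\<lambda>l. pav (9/8) S (gl l) powr (9/8))"
      by (intro avg_power_mean) auto
    also have "\<dots> = avg {c..<c + L} (\<lambda>l. avg S (\<lambda>x. cmod (gl l x) powr (9/8)))"
      unfolding pav_def by (simp add: powr_powr avg_nonneg)
    also have "\<dots> = 1 / (of_int L * of_int P) * (\<Sum>l\<in>{c..<c + L}. \<Sum>x\<in>S. cmod (gl l x) powr (9/8))"
      using L S unfolding avg_def by (simp add: sum_divide_distrib mult.commute)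
    also have "(\<Sum>l\<in>{c..<c + L}. \<Sum>x\<in>S. cmod (gl l x) powr (9/8)) = (\<Sum>n\<in>{P * c..<P * (c + L)}. cmod (g' n) powr (9/8))"
      unfolding gl_def S_def by (rule sum_blocks[OF P(1), where h = "\<lambda>n. cmod (g' n) powr (9/8)"])
    also have "1 / (of_int L * of_int P) * \<dots> \<le> 1 / (of_int L * of_int P) * (\<Sum>n\<in>I. cmod (g' n) powr (9/8))"
    proof (intro mult_left_mono sum_mono2)
      have "P * (c - L) \<le> P * c" "P * (c + L) \<le> P * (c + 2 * L)" using P L by (intro mult_left_mono; simp)+
      then show "{P * c..<P * (c + L)} \<subseteq> I" unfolding I_def by auto
    qed (use I L P in auto)
    also have "\<dots> = 3 * avg I (\<lambda>n. cmod (g' n) powr (9/8))" using L P cI by (simp add: avg_def)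
    finally have "(avg {c..<c + L} (\<lambda>l. pav (9/8) S (gl l)) powr (9/8)) powr (8/9) \<le> (3 * avg I (\<lambda>n. cmod (g' n) powr (9/8))) powr (8/9)"
      by (intro powr_mono2) auto
    then have "avg {c..<c + L} (\<lambda>l. pav (9/8) S (gl l)) \<le> (3 * avg I (\<lambda>n. cmod (g' n) powr (9/8))) powr (8/9)"
      by (simp add: powr_powr avg_nonneg)
    also have "\<dots> = 3 powr (8/9) * pav (9/8) I g'" by (simp add: pav_def powr_mult avg_nonneg)
    also have "\<dots> \<le> 3 powr 1 * pav (9/8) I g'" by (intro mult_right_mono powr_mono) auto
    finally have e2: "avg {c..<c + L} (\<lambda>l. pav (9/8) S (gl l)) \<le> 3 * pav (9/8) I g'" by simp
    have "avg {c..<c + L} G = 6 * \<gamma> * of_int P powr (1/9) * avg {c..<c + L} (\<lambda>l. pav (9/8) S (gl l))"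
      unfolding G_def avg_def by (simp add: sum_distrib_left mult_ac)
    also have "\<dots> \<le> 6 * \<gamma> * of_int P powr (1/9) * (3 * pav (9/8) I g')"
      using e2 \<gamma> by (intro mult_left_mono) auto
    finally have "of_int P powr (8/9) * pav (9/8) I f' * avg {c..<c + L} G
       \<le> of_int P powr (8/9) * pav (9/8) I f' * (6 * \<gamma> * of_int P powr (1/9) * (3 * pav (9/8) I g'))"
      by (intro mult_left_mono) auto
    also have "\<dots> = 18 * \<gamma> * (of_int P powr (8/9) * of_int P powr (1/9)) * (pav (9/8) I f' * pav (9/8) I g')" by simp
    also have "of_int P powr (8/9) * of_int P powr (1/9) = real_of_int P" using P by (simp flip: powr_add)
    also have "18 * \<gamma> * real_of_int P * (pav (9/8) I f' * pav (9/8) I g')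
       \<le> 18 * \<gamma> * real_of_int P * (c3 * (avg I a powr (5/9) * avg I b' powr (5/9)))"
      using pav_pav_le[OF w Iab, of f' g'] P \<gamma> unfolding I_def a_def b'_def c3_def by (intro mult_left_mono) auto
    \<comment> \<open>The remaining factor \<open>P\<close> counts the points of the block, at each of which the maximal functions dominate.\<close>
    also have "\<dots> = 18 * \<gamma> * c3 * (\<Sum>x\<in>S. avg I a powr (5/9) * avg I b' powr (5/9))" using S by simp
    also have "\<dots> \<le> \<Phi> l" unfolding \<Phi>_def
    proof (intro mult_left_mono sum_mono)
      fix x assume x: "x \<in> S"
      have lc: "c \<le> l" "l + 1 \<le> c + L" using l by (auto simp: L_def)
      have "P * (c - L) \<le> P * l" "P * (l + 1) \<le> P * (c + 2 * L)" using P L lc by (intro mult_left_mono; simp)+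
      moreover have "P * (l + 1) = P * l + P" "0 \<le> x" "x < P" using x by (auto simp: S_def distrib_left)
      ultimately have n: "P * (c - L) \<le> P * l + x" "P * l + x < P * (c + 2 * L)" by linarith+
      have "avg I a \<le> maxfn a (P * l + x)" unfolding I_def using n by (intro avg_le_maxfn[OF W ma])
      moreover have "avg I b' \<le> maxfn b' (P * l + x)" unfolding I_def using n by (intro avg_le_maxfn[OF W mb])
      ultimately show "avg I a powr (5/9) * avg I b' powr (5/9) \<le> M (P * l + x)"
        unfolding M_def using ma mb by (intro mult_mono powr_mono2 avg_nonneg) auto
    qed (use \<gamma> c3 in auto)
    finally show ?thesis unfolding L_def[symmetric] e1 .
  qed
  have main: "cmod (\<Sum>l\<in>Q. \<Sum>y\<in>S. B l y * (\<Sum>m\<in>Q3. \<kappa> (l - m) * F m y)) \<le> cz * (\<Sum>l\<in>Q. \<Phi> l)"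
    unfolding Q_def Q3_def cz_def
  proof (rule stopping_time_bound[where G = G])
    show "(\<Sum>l\<in>Y. cmod (\<Sum>m\<in>W. \<kappa> (l - m) * h m) powr (9/8)) \<le> pairing_const D powr (9/8) * (\<Sum>m\<in>W. cmod (h m) powr (9/8))"
      if "finite W" "finite Y" for W Y h
      by (rule odd_cz_lp[OF \<kappa> that])
    show "cmod (\<kappa> l - \<kappa> l') \<le> D * \<bar>real_of_int (l - l')\<bar> / real_of_int (l * l')" if "l * l' > 0" for l l'
      using \<kappa> that by (simp add: odd_cz_def)
    show "G l \<ge> 0" for l using \<gamma> by (simp add: G_def)
  qed (use D S pairing \<Phi>b in auto)
  have "(\<Sum>l\<in>Q. \<Phi> l) = 18 * \<gamma> * c3 * (\<Sum>n\<in>{P * c..<P * (c + 2 ^ Suc k)}. M n)"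
    unfolding \<Phi>_def Q_def S_def sum_distrib_left[symmetric] by (simp only: sum_blocks[OF P(1)])
  also have "\<dots> \<le> 18 * \<gamma> * c3 * (max_const (10/9) * (sqrt (\<Sum>m\<in>W. (cmod (f m))\<^sup>2 * w m) * sqrt (\<Sum>n\<in>W. (cmod (g n))\<^sup>2 / w n)))"
  proof (intro mult_left_mono)
    let ?R = "{P * c..<P * (c + 2 ^ Suc k)}"
    have "(\<Sum>n\<in>?R. M n) = (\<Sum>n\<in>?R. sqrt (maxfn a n powr (10/9)) * sqrt (maxfn b' n powr (10/9)))"
      unfolding M_def by (simp add: powr_half_sqrt[symmetric] powr_powr)
    also have "\<dots> \<le> sqrt (\<Sum>n\<in>?R. maxfn a n powr (10/9)) * sqrt (\<Sum>n\<in>?R. maxfn b' n powr (10/9))"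
      by (intro Cauchy_Schwarz_sqrt) auto
    also have "\<dots> \<le> sqrt (max_const (10/9) * (\<Sum>n\<in>W. a n powr (10/9))) * sqrt (max_const (10/9) * (\<Sum>n\<in>W. b' n powr (10/9)))"
    proof -
      have "(\<Sum>n\<in>?R. maxfn a n powr (10/9)) \<le> max_const (10/9) * (\<Sum>n\<in>W. a n powr (10/9))"
        by (rule maximal_strong_type[OF W ma]) auto
      moreover have "(\<Sum>n\<in>?R. maxfn b' n powr (10/9)) \<le> max_const (10/9) * (\<Sum>n\<in>W. b' n powr (10/9))"
        by (rule maximal_strong_type[OF W mb]) auto
      moreover have "0 \<le> (\<Sum>n\<in>?R. maxfn a n powr (10/9))" "0 \<le> (\<Sum>n\<in>?R. maxfn b' n powr (10/9))"
        by (auto intro: sum_nonneg)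
      ultimately show ?thesis by (intro mult_mono real_sqrt_le_mono real_sqrt_ge_zero) auto
    qed
    also have "(\<Sum>n\<in>W. a n powr (10/9)) = (\<Sum>m\<in>W. (cmod (f m))\<^sup>2 * w m)"
      using less_imp_le[OF w0] by (intro sum.cong refl) (simp add: a_def f'_def powr_powr)
    also have "(\<Sum>n\<in>W. b' n powr (10/9)) = (\<Sum>n\<in>W. (cmod (g n))\<^sup>2 / w n)"
      using less_imp_le[OF w0] by (intro sum.cong refl) (simp add: b'_def g'_def powr_powr)
    also have "sqrt (max_const (10/9) * (\<Sum>m\<in>W. (cmod (f m))\<^sup>2 * w m)) * sqrt (max_const (10/9) * (\<Sum>n\<in>W. (cmod (g n))\<^sup>2 / w n))
       = (sqrt (max_const (10/9)) * sqrt (max_const (10/9))) * (sqrt (\<Sum>m\<in>W. (cmod (f m))\<^sup>2 * w m) * sqrt (\<Sum>n\<in>W. (cmod (g n))\<^sup>2 / w n))"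
      by (simp add: real_sqrt_mult)
    also have "sqrt (max_const (10/9)) * sqrt (max_const (10/9)) = max_const (10/9)"
      using max_const_nonneg[of "10/9"] by simp
    finally show "(\<Sum>n\<in>?R. M n) \<le> max_const (10/9) * (sqrt (\<Sum>m\<in>W. (cmod (f m))\<^sup>2 * w m) * sqrt (\<Sum>n\<in>W. (cmod (g n))\<^sup>2 / w n))" .
  qed (use \<gamma> c3 in auto)
  finally have fin: "cz * (\<Sum>l\<in>Q. \<Phi> l) \<le> cz * (18 * \<gamma> * c3 * (max_const (10/9) * (sqrt (\<Sum>m\<in>W. (cmod (f m))\<^sup>2 * w m) * sqrt (\<Sum>n\<in>W. (cmod (g n))\<^sup>2 / w n))))"
    using cz by (rule mult_left_mono)
  let ?k = "\<lambda>n m. A (n mod P) (m mod P) * \<kappa> (n div P - m div P)"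
  have "(\<Sum>n\<in>W. \<Sum>m\<in>W. ?k n m * f m * g n) = (\<Sum>n\<in>{P * c..<P * (c + 2 ^ Suc k)}. \<Sum>m\<in>{P * (c - 2 ^ Suc k)..<P * (c + 2 * 2 ^ Suc k)}. ?k n m * f' m * g' n)"
  proof -
    have in1: "(\<Sum>m\<in>W. ?k n m * f m * g n) = (\<Sum>m\<in>{P * (c - 2 ^ Suc k)..<P * (c + 2 * 2 ^ Suc k)}. ?k n m * f' m * g' n)"
      if "n \<in> W" for n
      using WQ that by (intro sum.mono_neutral_cong_left) (auto simp: f'_def g'_def)
    show ?thesis
    proof (rule sum.mono_neutral_cong_left[OF _ WQ(1)])
      show "\<forall>n\<in>{P * c..<P * (c + 2 ^ Suc k)} - W. (\<Sum>m\<in>{P * (c - 2 ^ Suc k)..<P * (c + 2 * 2 ^ Suc k)}. ?k n m * f' m * g' n) = 0"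
        by (simp add: g'_def)
    qed (use in1 in auto)
  qed
  also have "\<dots> = (\<Sum>l\<in>Q. \<Sum>x\<in>S. \<Sum>l'\<in>Q3. \<Sum>y\<in>S. A x y * \<kappa> (l - l') * F l' y * gl l x)"
    unfolding Q_def Q3_def S_def sum_blocks[OF P(1), symmetric]
    using P by (intro sum.cong refl) (simp add: F_def gl_def div_pos_pos_trivial)
  also have "\<dots> = (\<Sum>l\<in>Q. \<Sum>y\<in>S. B l y * (\<Sum>m\<in>Q3. \<kappa> (l - m) * F m y))"
  proof (rule sum.cong[OF refl])
    fix l
    have "(\<Sum>x\<in>S. \<Sum>l'\<in>Q3. \<Sum>y\<in>S. A x y * \<kappa> (l - l') * F l' y * gl l x)
       = (\<Sum>x\<in>S. \<Sum>y\<in>S. \<Sum>l'\<in>Q3. A x y * \<kappa> (l - l') * F l' y * gl l x)"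
      by (rule sum.cong[OF refl], rule sum.swap)
    also have "\<dots> = (\<Sum>y\<in>S. \<Sum>x\<in>S. \<Sum>l'\<in>Q3. A x y * \<kappa> (l - l') * F l' y * gl l x)" by (rule sum.swap)
    also have "\<dots> = (\<Sum>y\<in>S. B l y * (\<Sum>m\<in>Q3. \<kappa> (l - m) * F m y))"
      unfolding B_def gl_def sum_product by (simp add: mult_ac)
    finally show "(\<Sum>x\<in>S. \<Sum>l'\<in>Q3. \<Sum>y\<in>S. A x y * \<kappa> (l - l') * F l' y * gl l x) = (\<Sum>y\<in>S. B l y * (\<Sum>m\<in>Q3. \<kappa> (l - m) * F m y))" .
  qed
  finally have "cmod (\<Sum>n\<in>W. \<Sum>m\<in>W. ?k n m * f m * g n)
     \<le> cz * (18 * \<gamma> * c3 * (max_const (10/9) * (sqrt (\<Sum>m\<in>W. (cmod (f m))\<^sup>2 * w m) * sqrt (\<Sum>n\<in>W. (cmod (g n))\<^sup>2 / w n))))"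
    using main fin by simp
  then show "cmod (\<Sum>n\<in>W. \<Sum>m\<in>W. ?k n m * f m * g n)
     \<le> tensor_const D C * of_int q powr (-1/16) * sqrt (\<Sum>m\<in>W. (cmod (f m))\<^sup>2 * w m) * sqrt (\<Sum>n\<in>W. (cmod (g n))\<^sup>2 / w n)"
    by (simp add: tensor_const_def cz_def \<gamma>_def c3_def mult_ac)
qed

lemma ex_dyadic: "d \<noteq> 0 \<Longrightarrow> \<exists>i. (2::int) ^ i \<le> \<bar>d\<bar> \<and> \<bar>d\<bar> < 2 ^ Suc i"
proof -
  assume "d \<noteq> 0"
  then have "1 \<le> nat \<bar>d\<bar>" by simp
  then obtain i where i: "2 ^ i \<le> nat \<bar>d\<bar>" "nat \<bar>d\<bar> < 2 ^ (i + 1)" using ex_power_ivl1[of 2 "nat \<bar>d\<bar>"] by auto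
  have "int (2 ^ i) \<le> int (nat \<bar>d\<bar>)" "int (nat \<bar>d\<bar>) < int (2 ^ (i + 1))" using i by (simp_all only: of_nat_le_iff of_nat_less_iff)
  then show ?thesis by (intro exI[of _ i]) simp
qed

lemma sum_half_powers: "(\<Sum>i\<in>{s..<n}. (1/2::real) ^ i) \<le> 2 * (1/2) ^ s"
proof (cases "s \<le> n")
  case True
  have "(\<Sum>i\<in>{s..<n}. (1/2::real) ^ i) = 2 * (1/2) ^ s - 2 * (1/2) ^ n" using True
  proof (induction n rule: dec_induct)
    case (step n)
    then show ?case by (simp add: sum.atLeastLessThan_Suc)
  qed simp
  then show ?thesis by simp
qed simp

text \<open>An error kernel of size \<open>\<Lambda> / (n - m)\<^sup>2\<close> away from the diagonal is summable over scales on
  \<open>\<ell>\<^sup>2(w)\<close> without using any cancellation.\<close>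

lemma quadratic_tail_form_bdd:
  assumes w: "bump C w" and L: "\<Lambda> \<ge> 0" and a: "a \<ge> 2"
    and E: "\<And>n m. E n m \<noteq> 0 \<Longrightarrow> 2 ^ a \<le> 4 * \<bar>n - m\<bar> \<and> \<bar>n - m\<bar> < 2 ^ Suc e \<and> cmod (E n m) \<le> \<Lambda> / (real_of_int (n - m))\<^sup>2"
  shows "form_bdd w (640 * C powr (1/3) * \<Lambda> / 2 ^ a) E"
proof -
  define Ei where "Ei i n m = (if 2 ^ i \<le> \<bar>n - m\<bar> \<and> \<bar>n - m\<bar> < 2 ^ Suc i then E n m else 0)" for i and n m :: int
  define J where "J = {a - 2..<Suc e}"
  have decomp: "E = (\<lambda>n m. \<Sum>i\<in>J. Ei i n m)"
  proof (intro ext)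
    fix n m
    show "E n m = (\<Sum>i\<in>J. Ei i n m)"
    proof (cases "E n m = 0")
      case True
      then have "Ei i n m = 0" for i by (simp add: Ei_def)
      then show ?thesis using True by simp
    next
      case False
      note b = E[OF False]
      have "(0::int) < 2 ^ a" by simp
      then have "n - m \<noteq> 0" using b by auto
      then obtain i where i: "2 ^ i \<le> \<bar>n - m\<bar>" "\<bar>n - m\<bar> < 2 ^ Suc i" using ex_dyadic by blast
      have "(2::int) ^ a < 2 ^ (i + 3)" using b i by (simp add: power_add)
      then have "a < i + 3" using power_less_imp_less_exp[of "2::int" a "i + 3"] by simp
      moreover have "(2::int) ^ i < 2 ^ Suc e" using b i by linarith
      then have "i < Suc e" using power_less_imp_less_exp[of "2::int" i "Suc e"] by simp
      ultimately have iJ: "i \<in> J" using a by (auto simp: J_def)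
      have other: "Ei i' n m = 0" if "i' \<noteq> i" for i'
      proof (rule ccontr)
        assume "Ei i' n m \<noteq> 0"
        then have i': "2 ^ i' \<le> \<bar>n - m\<bar>" "\<bar>n - m\<bar> < 2 ^ Suc i'" by (auto simp: Ei_def split: if_splits)
        have "(2::int) ^ i < 2 ^ Suc i'" "(2::int) ^ i' < 2 ^ Suc i" using i i' by linarith+
        then have "i < Suc i'" "i' < Suc i"
          using power_less_imp_less_exp[of "2::int" i "Suc i'"] power_less_imp_less_exp[of "2::int" i' "Suc i"] by auto
        with that show False by simp
      qed
      have "(\<Sum>i\<in>J. Ei i n m) = (\<Sum>i'\<in>{i}. Ei i' n m)"
        using iJ other by (intro sum.mono_neutral_right) (auto simp: J_def)
      then show ?thesis using i by (simp add: Ei_def)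
    qed
  qed
  have each: "form_bdd w (16 * C powr (1/3) * (5 * \<Lambda> / 2 ^ i) * 1 powr (1/8)) (Ei i)" for i
  proof (rule single_scale[OF w])
    have p: "(1::int) \<le> 2 ^ i" by (rule one_le_power) simp
    show "(1::int) \<le> 2 ^ Suc i" by (rule one_le_power) simp
    have four: "(4::real) ^ i = 2 ^ i * 2 ^ i" by (simp flip: power_mult_distrib)
    have Eb: "cmod (Ei i n m) \<le> \<Lambda> / 4 ^ i" for n m
    proof (cases "Ei i n m = 0")
      case False
      then have "E n m \<noteq> 0" and lo: "2 ^ i \<le> \<bar>n - m\<bar>" and eq: "Ei i n m = E n m" by (auto simp: Ei_def split: if_splits)
      have "real_of_int (2 ^ i) \<le> real_of_int \<bar>n - m\<bar>" using lo by (simp only: of_int_le_iff)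
      then have "(2 ^ i)\<^sup>2 \<le> \<bar>real_of_int (n - m)\<bar>\<^sup>2" by (intro power_mono) auto
      then have "4 ^ i \<le> (real_of_int (n - m))\<^sup>2" by (simp add: four power2_eq_square)
      then have "\<Lambda> / (real_of_int (n - m))\<^sup>2 \<le> \<Lambda> / 4 ^ i" using L by (intro frac_le) auto
      moreover have "cmod (Ei i n m) \<le> \<Lambda> / (real_of_int (n - m))\<^sup>2" using E[OF \<open>E n m \<noteq> 0\<close>] eq by simp
      ultimately show ?thesis by linarith
    qed (use L in simp)
    show "cmod (Ei i n m) \<le> 5 * \<Lambda> / 2 ^ i / real_of_int (2 ^ Suc i)" for n m
    proof -
      have "1 * (\<Lambda> / 4 ^ i) \<le> 5 / 2 * (\<Lambda> / 4 ^ i)" using L by (intro mult_right_mono) auto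
      also have "\<dots> = 5 * \<Lambda> / 2 ^ i / real_of_int (2 ^ Suc i)" by (simp add: four)
      finally show ?thesis using Eb[of n m] by linarith
    qed
    show "Ei i n m = 0" if "\<bar>n - m\<bar> > 2 ^ Suc i" for n m using that by (simp add: Ei_def)
    show "form_bdd (\<lambda>_. 1) (5 * \<Lambda> / 2 ^ i * 1) (Ei i)"
    proof (rule form_bdd_Schur[where Z = "{-(2 ^ Suc i)..2 ^ Suc i}" and c = "\<lambda>_. \<Lambda> / 4 ^ i"])
      show "Ei i n m = 0" if "n - m \<notin> {-(2 ^ Suc i)..2 ^ Suc i}" for n m
        using that by (auto simp: Ei_def abs_if split: if_splits)
      have "real (card {-(2 ^ Suc i)..2 ^ Suc i :: int}) = real_of_int (4 * 2 ^ i + 1)" using p by simp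
      also have "\<dots> \<le> real_of_int (5 * 2 ^ i)" using p by (simp only: of_int_le_iff)
      finally have "real (card {-(2 ^ Suc i)..2 ^ Suc i :: int}) * (\<Lambda> / 4 ^ i) \<le> real_of_int (5 * 2 ^ i) * (\<Lambda> / 4 ^ i)"
        using L by (intro mult_right_mono) auto
      then show "(\<Sum>h\<in>{-(2 ^ Suc i)..2 ^ Suc i :: int}. \<Lambda> / 4 ^ i) \<le> 5 * \<Lambda> / 2 ^ i * 1" by (simp add: four)
    qed (use L Eb in auto)
  qed (use L in auto)
  have "form_bdd w (\<Sum>i\<in>J. 16 * C powr (1/3) * (5 * \<Lambda> / 2 ^ i) * 1 powr (1/8)) E"
    unfolding decomp by (rule form_bdd_sum[OF _ each]) (simp add: J_def)
  then show ?thesis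
  proof (rule form_bdd_mono)
    have "(\<Sum>i\<in>J. 16 * C powr (1/3) * (5 * \<Lambda> / 2 ^ i) * 1 powr (1/8)) = 80 * C powr (1/3) * \<Lambda> * (\<Sum>i\<in>J. (1/2) ^ i)"
      by (simp add: sum_distrib_left power_divide mult.assoc)
    also have "\<dots> \<le> 80 * C powr (1/3) * \<Lambda> * (2 * (1/2) ^ (a - 2))"
      unfolding J_def using L by (intro mult_left_mono sum_half_powers) auto
    also have "(1/2::real) ^ (a - 2) = 4 / 2 ^ a" using a by (simp add: power_divide power_diff)
    finally show "(\<Sum>i\<in>J. 16 * C powr (1/3) * (5 * \<Lambda> / 2 ^ i) * 1 powr (1/8)) \<le> 640 * C powr (1/3) * \<Lambda> / 2 ^ a" by simp
  qed (use w in \<open>simp add: bump_def\<close>)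
qed

definition block_const :: "real \<Rightarrow> real" where
  "block_const C = tensor_const 37 C + 100000 * C powr (1/3)"

text \<open>At \<open>d = n - m\<close> the phase splits into \<open>b d\<^sup>2 / (2 q)\<close>, which depends on the residue of \<open>d\<close> modulo \<open>2 q\<close> only, and
  a phase that varies slowly on the block of scales. In the slow factor \<open>d\<close> is
  rounded to a multiple of \<open>2 q\<close>; as the smallest scale is at least \<open>q\<^sup>2\<close>, the error is a tail of total
  size at most a constant times \<open>1 / q\<close>.\<close>

lemma block_weighted:
  fixes q b :: int
  assumes w: "bump C w" and q: "q \<ge> 1" and bq: "coprime b q" and a6: "a \<ge> 6" and qa: "q\<^sup>2 \<le> 2 ^ a" and ae: "a \<le> e"
    and \<theta>: "\<bar>2 * \<alpha> - of_int b / of_int q\<bar> * 4 ^ e \<le> 4"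
  shows "form_bdd w (block_const C * of_int q powr (-1/16)) (\<lambda>n m. phased \<alpha> a e (n - m))"
proof -
  define P where "P = 2 * q"
  have P: "P > 0" "real_of_int P > 0" using q by (auto simp: P_def)
  define \<theta>' where "\<theta>' = (2 * \<alpha> - of_int b / of_int q) / 2"
  define k0 where "k0 = phased \<theta>' a e"
  have sup: "2 ^ a < 2 * \<bar>l\<bar> \<and> \<bar>l\<bar> < 2 ^ e" if "k0 l \<noteq> 0" for l
  proof -
    have "cutoff a e l \<noteq> 0" using that by (auto simp: k0_def phased_def)
    from cutoff_support[OF ae this] have "real_of_int (2 ^ a) < real_of_int (2 * \<bar>l\<bar>)" "real_of_int \<bar>l\<bar> < real_of_int (2 ^ e)" by auto
    then show ?thesis by (simp only: of_int_less_iff)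
  qed
  have reg: "cmod (k0 l - k0 l') \<le> 37 * \<bar>real_of_int (l - l')\<bar> / real_of_int (l * l')" if ll: "l * l' > 0" for l l'
  proof -
    have "cmod (k0 l - k0 l') \<le> (5 + 4 * pi * 2) * \<bar>real_of_int (l - l')\<bar> / real_of_int (l * l')"
      unfolding k0_def
    proof (rule phased_regular[OF ae _ _ ll])
      fix l assume "cutoff a e l \<noteq> 0"
      then have "\<bar>real_of_int l\<bar> < 2 ^ e" by (rule cutoff_support[OF ae])
      then have "\<bar>real_of_int l\<bar>\<^sup>2 \<le> (2 ^ e)\<^sup>2" by (intro power_mono) auto
      also have "(2 ^ e)\<^sup>2 = (4::real) ^ e" by (simp add: power2_eq_square flip: power_mult_distrib)
      finally have "\<bar>\<theta>'\<bar> * (real_of_int l)\<^sup>2 \<le> \<bar>\<theta>'\<bar> * 4 ^ e" by (intro mult_left_mono) auto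
      also have "\<dots> \<le> 2" using \<theta> by (simp add: \<theta>'_def)
      finally show "\<bar>\<theta>'\<bar> * (real_of_int l)\<^sup>2 \<le> 2" .
    qed simp
    also have "\<dots> \<le> 37 * \<bar>real_of_int (l - l')\<bar> / real_of_int (l * l')"
    proof (intro divide_right_mono mult_right_mono)
      show "5 + 4 * pi * 2 \<le> 37" using pi_less_4 by simp
      show "0 \<le> real_of_int (l * l')" using ll by (simp only: of_int_0_le_iff)
    qed auto
    finally show ?thesis .
  qed
  define \<kappa> where "\<kappa> l = of_int P * k0 (P * l)" for l
  have \<kappa>: "odd_cz 37 \<kappa>" unfolding odd_cz_def
  proof (intro conjI allI impI)
    have "{l. \<kappa> l \<noteq> 0} \<subseteq> {-(2 ^ e)..2 ^ e}"
    proof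
      fix l assume "l \<in> {l. \<kappa> l \<noteq> 0}"
      then have "k0 (P * l) \<noteq> 0" by (auto simp: \<kappa>_def)
      then have "\<bar>P * l\<bar> < 2 ^ e" using sup by blast
      moreover have "1 * \<bar>l\<bar> \<le> P * \<bar>l\<bar>" using P by (intro mult_right_mono) auto
      ultimately have "\<bar>l\<bar> < 2 ^ e" using P by (simp add: abs_mult)
      then show "l \<in> {-(2 ^ e)..2 ^ e}" by auto
    qed
    then show "finite {l. \<kappa> l \<noteq> 0}" by (rule finite_subset) simp
    show "\<kappa> (- l) = - \<kappa> l" for l using phased_minus[of \<theta>' a e "P * l"] by (simp add: \<kappa>_def k0_def)
    show "cmod (\<kappa> l) * \<bar>real_of_int l\<bar> \<le> 37" for l
    proof (cases "l = 0")
      case False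
      have "cmod (\<kappa> l) * \<bar>real_of_int l\<bar> = \<bar>cutoff a e (P * l)\<bar>"
        using P False by (simp add: \<kappa>_def k0_def norm_mult norm_phased abs_mult)
      also have "\<dots> \<le> 1" using cutoff_bounds[OF ae, of "P * l"] by simp
      finally show ?thesis by simp
    qed simp
    show "cmod (\<kappa> l - \<kappa> l') \<le> 37 * \<bar>real_of_int (l - l')\<bar> / real_of_int (l * l')" if ll: "l * l' > 0" for l l'
    proof -
      have "(P * l) * (P * l') = (P * P) * (l * l')" by simp
      then have PP: "(P * l) * (P * l') > 0" 
        using mult_pos_pos[OF mult_pos_pos[OF P(1) P(1)] ll] by (simp only:)
      have "cmod (\<kappa> l - \<kappa> l') = of_int P * cmod (k0 (P * l) - k0 (P * l'))"
        using P by (simp add: \<kappa>_def norm_mult flip: right_diff_distrib)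
      also have "\<dots> \<le> of_int P * (37 * \<bar>real_of_int (P * l - P * l')\<bar> / real_of_int ((P * l) * (P * l')))"
        using P by (intro mult_left_mono reg[OF PP]) auto
      also have "\<dots> = 37 * \<bar>real_of_int (l - l')\<bar> / real_of_int (l * l')"
      proof -
        have "\<bar>real_of_int (P * l - P * l')\<bar> = of_int P * \<bar>real_of_int (l - l')\<bar>"
          using P by (simp add: abs_mult flip: right_diff_distrib)
        then show ?thesis using P by (simp add: field_simps)
      qed
      finally show ?thesis .
    qed
  qed auto
  define A where "A = (\<lambda>x y. ee (of_int (b * (x - y)\<^sup>2) / of_int P) / of_int P)"
  have T: "form_bdd w (tensor_const 37 C * of_int q powr (-1/16)) (\<lambda>n m. A (n mod P) (m mod P) * \<kappa> (n div P - m div P))"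
    unfolding A_def P_def by (rule tensor_form_bdd[OF w q bq \<kappa>])
  define E where "E n m = ee (of_int (b * (n - m)\<^sup>2) / of_int P) * (k0 (n - m) - k0 (P * (n div P - m div P)))" for n m
  have per: "ee (of_int (b * (n - m)\<^sup>2) / of_int P) = ee (of_int (b * (n mod P - m mod P)\<^sup>2) / of_int P)" for n m
  proof -
    define t where "t = n div P - m div P"
    have "n - m = (n mod P - m mod P) + P * t"
      using mult_div_mod_eq[of P n] mult_div_mod_eq[of P m] unfolding t_def right_diff_distrib by linarith
    then have "b * (n - m)\<^sup>2 = b * (n mod P - m mod P)\<^sup>2 + P * (b * (2 * (n mod P - m mod P) * t + P * t\<^sup>2))"
      by (simp only:) (simp add: power2_eq_square algebra_simps)
    then have "real_of_int (b * (n - m)\<^sup>2) = of_int (b * (n mod P - m mod P)\<^sup>2) + of_int P * of_int (b * (2 * (n mod P - m mod P) * t + P * t\<^sup>2))"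
      by (metis of_int_add of_int_mult)
    then have "real_of_int (b * (n - m)\<^sup>2) / of_int P = of_int (b * (n mod P - m mod P)\<^sup>2) / of_int P + of_int (b * (2 * (n mod P - m mod P) * t + P * t\<^sup>2))"
      using P by (simp add: add_divide_distrib)
    then show ?thesis by (simp only: ee_add ee_of_int mult_1_right)
  qed
  have split: "phased \<alpha> a e (n - m) = A (n mod P) (m mod P) * \<kappa> (n div P - m div P) + E n m" for n m
  proof -
    have "\<alpha> * (of_int (n - m))\<^sup>2 = of_int (b * (n - m)\<^sup>2) / of_int P + \<theta>' * (of_int (n - m))\<^sup>2"
      using q by (simp add: \<theta>'_def P_def field_simps)
    then have ph: "phased \<alpha> a e (n - m) = ee (of_int (b * (n - m)\<^sup>2) / of_int P) * k0 (n - m)"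
      unfolding phased_def k0_def by (simp only: ee_add mult.assoc)
    have "A (n mod P) (m mod P) * \<kappa> (n div P - m div P) = ee (of_int (b * (n - m)\<^sup>2) / of_int P) * k0 (P * (n div P - m div P))"
      unfolding per[of n m] A_def \<kappa>_def using P by simp
    then show ?thesis unfolding ph E_def by (simp add: algebra_simps)
  qed
  \<comment> \<open>From \<open>a \<ge> 6\<close> on, \<open>q\<^sup>2 \<le> 2\<^sup>a\<close> keeps the support of the kernel more than one block away from the diagonal.\<close>
  have P4: "4 * P \<le> 2 ^ a"
  proof -
    have "(8 * q)\<^sup>2 = 64 * q\<^sup>2" by (simp add: power_mult_distrib)
    also have "\<dots> \<le> 2 ^ 6 * 2 ^ a" using qa by simp
    also have "\<dots> \<le> 2 ^ a * 2 ^ a" using a6 by (intro mult_right_mono power_increasing) auto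
    finally have "(8 * q)\<^sup>2 \<le> (2 ^ a)\<^sup>2" by (simp add: power2_eq_square)
    then have "8 * q \<le> 2 ^ a" by (rule power2_le_imp_le) simp
    then show ?thesis by (simp add: P_def)
  qed
  have Ebd: "2 ^ a \<le> 4 * \<bar>n - m\<bar> \<and> \<bar>n - m\<bar> < 2 ^ Suc e \<and> cmod (E n m) \<le> 74 * of_int P / (real_of_int (n - m))\<^sup>2"
    if nz: "E n m \<noteq> 0" for n m
  proof -
    define d d' where "d = n - m" and "d' = P * (n div P - m div P)"
    have "0 \<le> n mod P" "n mod P < P" "0 \<le> m mod P" "m mod P < P" using P by auto
    moreover have "d - d' = n mod P - m mod P"
      using mult_div_mod_eq[of P n] mult_div_mod_eq[of P m] unfolding d_def d'_def right_diff_distrib by linarith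
    ultimately have close: "\<bar>d - d'\<bar> < P" by linarith
    have "k0 d \<noteq> 0 \<or> k0 d' \<noteq> 0" using nz by (auto simp: E_def d_def d'_def)
    then have or: "(2 ^ a < 2 * \<bar>d\<bar> \<and> \<bar>d\<bar> < 2 ^ e) \<or> (2 ^ a < 2 * \<bar>d'\<bar> \<and> \<bar>d'\<bar> < 2 ^ e)" using sup by blast
    have pae: "(2::int) ^ a \<le> 2 ^ e" using ae by (intro power_increasing) auto
    have 1: "2 ^ a \<le> 4 * \<bar>d\<bar>" using or close P4 by linarith
    have 2: "\<bar>d\<bar> < 2 ^ Suc e" using or close P4 pae P by auto
    have 3: "\<bar>d\<bar> \<le> 2 * \<bar>d'\<bar>" using or close P4 by linarith
    have 4: "d * d' > 0"
    proof -
      have "(d > 0 \<and> d' > 0) \<or> (d < 0 \<and> d' < 0)" using or close P4 P by linarith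
      then show ?thesis by (auto simp: zero_less_mult_iff)
    qed
    have d0: "d \<noteq> 0" using 4 by auto
    have "d * d = \<bar>d\<bar> * \<bar>d\<bar>" by simp
    also have "\<dots> \<le> \<bar>d\<bar> * (2 * \<bar>d'\<bar>)" using 3 by (intro mult_left_mono) auto
    also have "\<dots> = 2 * (d * d')" using 4 by (simp add: abs_mult[symmetric])
    finally have "real_of_int (d * d) \<le> real_of_int (2 * (d * d'))" by (simp only: of_int_le_iff)
    then have dd: "(real_of_int d)\<^sup>2 / 2 \<le> real_of_int (d * d')" by (simp add: power2_eq_square)
    have "cmod (E n m) = cmod (k0 d - k0 d')" by (simp add: E_def d_def d'_def norm_mult)
    also have "\<dots> \<le> 37 * \<bar>real_of_int (d - d')\<bar> / real_of_int (d * d')" by (rule reg[OF 4])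
    also have "\<dots> \<le> 37 * of_int P / ((real_of_int d)\<^sup>2 / 2)"
    proof (rule frac_le)
      have "\<bar>real_of_int (d - d')\<bar> \<le> of_int P" using close by linarith
      then show "37 * \<bar>real_of_int (d - d')\<bar> \<le> 37 * of_int P" by simp
    qed (use dd d0 P in auto)
    also have "\<dots> = 74 * of_int P / (real_of_int d)\<^sup>2" by simp
    finally show ?thesis using 1 2 by (simp add: d_def)
  qed
  have Eb: "form_bdd w (640 * C powr (1/3) * (74 * of_int P) / 2 ^ a) E"
    by (rule quadratic_tail_form_bdd[OF w _ _ Ebd]) (use P a6 in auto)
  have "form_bdd w (tensor_const 37 C * of_int q powr (-1/16) + 640 * C powr (1/3) * (74 * of_int P) / 2 ^ a) (\<lambda>n m. phased \<alpha> a e (n - m))"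
    unfolding split by (rule form_bdd_add[OF T Eb])
  then show ?thesis
  proof (rule form_bdd_mono)
    have q1: "real_of_int q \<ge> 1" using q by simp
    have "real_of_int (q\<^sup>2) \<le> real_of_int (2 ^ a)" using qa by (simp only: of_int_le_iff)
    then have "(real_of_int q)\<^sup>2 \<le> 2 ^ a" by simp
    then have "real_of_int q / 2 ^ a \<le> real_of_int q / (real_of_int q)\<^sup>2" using q1 by (intro divide_left_mono) auto
    also have "\<dots> = of_int q powr (-1)" using q1 by (simp add: power2_eq_square powr_minus_divide)
    also have "\<dots> \<le> of_int q powr (-1/16)" using q1 by (intro powr_mono) auto
    finally have "94720 * C powr (1/3) * (real_of_int q / 2 ^ a) \<le> 100000 * C powr (1/3) * of_int q powr (-1/16)"
      using q1 by (intro mult_mono) auto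
    then show "tensor_const 37 C * of_int q powr (-1/16) + 640 * C powr (1/3) * (74 * of_int P) / 2 ^ a \<le> block_const C * of_int q powr (-1/16)"
      by (simp add: block_const_def P_def distrib_right)
  qed (use w in \<open>simp add: bump_def\<close>)
qed

section \<open>Summation over the scales\<close>

text \<open>The fraction \<open>b / q\<close> has a denominator that is small for the scale \<open>j\<close>, and it approximates \<open>\<beta>\<close> as well as
  Dirichlet's theorem with denominators up to \<open>8 \<cdot> 2\<^sup>j\<close> guarantees.\<close>

definition close_frac :: "real \<Rightarrow> nat \<Rightarrow> int \<times> int \<Rightarrow> bool" where
  "close_frac \<beta> j = (\<lambda>(b, q). coprime b q \<and> q \<ge> 1 \<and> q\<^sup>2 \<le> 2 ^ j \<and>
     \<bar>\<beta> - of_int b / of_int q\<bar> \<le> 1 / (8 * 2 ^ j * of_int q))"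

text \<open>Distinct fractions are at distance at least \<open>1 / (q q')\<close>, but both are close to \<open>\<beta>\<close>; as \<open>q\<close> is small for its
  scale, \<open>q'\<close> must be much larger.\<close>

lemma close_frac_lacunary:
  assumes 1: "close_frac \<beta> j (b, q)" and 2: "close_frac \<beta> j' (b', q')" and jj: "j \<le> j'" and ne: "(b, q) \<noteq> (b', q')"
  shows "2 * q \<le> q'"
proof -
  have q: "coprime b q" "q \<ge> 1" "q\<^sup>2 \<le> 2 ^ j" "\<bar>\<beta> - of_int b / of_int q\<bar> \<le> 1 / (8 * 2 ^ j * of_int q)"
    and q': "coprime b' q'" "q' \<ge> 1" "\<bar>\<beta> - of_int b' / of_int q'\<bar> \<le> 1 / (8 * 2 ^ j' * of_int q')"
    using 1 2 by (auto simp: close_frac_def)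
  have r: "real_of_int q \<ge> 1" "real_of_int q' \<ge> 1" using q q' by auto
  have "b * q' \<noteq> b' * q"
  proof
    assume e: "b * q' = b' * q"
    then have "q dvd b * q'" by simp
    then have "q dvd q'" using q(1) by (simp add: coprime_dvd_mult_right_iff coprime_commute)
    moreover have "q' dvd b' * q" using e by (metis dvd_triv_right)
    then have "q' dvd q" using q'(1) by (simp add: coprime_dvd_mult_right_iff coprime_commute)
    ultimately have "q = q'" using q(2) q'(2) by (simp add: zdvd_antisym_nonneg)
    then have "b = b'" using e q(2) by simp
    with \<open>q = q'\<close> ne show False by simp
  qed
  then have "1 \<le> \<bar>b * q' - b' * q\<bar>" by simp
  then have "real_of_int 1 \<le> real_of_int \<bar>b * q' - b' * q\<bar>" by (simp only: of_int_le_iff)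
  then have "1 \<le> \<bar>real_of_int b * of_int q' - of_int b' * of_int q\<bar>" by simp
  then have "1 / (of_int q * of_int q') \<le> \<bar>real_of_int b * of_int q' - of_int b' * of_int q\<bar> / (of_int q * of_int q')"
    using r by (intro divide_right_mono) auto
  also have "\<dots> = \<bar>of_int b / of_int q - of_int b' / of_int q'\<bar>"
  proof -
    have "of_int b / of_int q - of_int b' / of_int q' = (real_of_int b * of_int q' - of_int b' * of_int q) / (of_int q * of_int q')"
      using r by (simp add: field_simps)
    then show ?thesis using r by (simp add: abs_divide abs_mult)
  qed
  also have "\<dots> \<le> 1 / (8 * 2 ^ j * of_int q) + 1 / (8 * 2 ^ j' * of_int q')" using q(4) q'(3) by linarith
  finally have "1 / (of_int q * of_int q') * (of_int q * of_int q') \<le> (1 / (8 * 2 ^ j * of_int q) + 1 / (8 * 2 ^ j' * of_int q')) * (real_of_int q * of_int q')"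
    using r by (intro mult_right_mono) auto
  then have "1 \<le> real_of_int q' / (8 * 2 ^ j) + real_of_int q / (8 * 2 ^ j')"
    using r by (simp add: distrib_right)
  moreover have "of_int q / (8 * 2 ^ j') \<le> (1/8::real)"
  proof -
    have "q * 1 \<le> q * q" using q(2) by (intro mult_left_mono) auto
    also have "\<dots> \<le> 2 ^ j" using q(3) by (simp add: power2_eq_square)
    also have "\<dots> \<le> 2 ^ j'" using jj by (intro power_increasing) auto
    finally have "real_of_int q \<le> real_of_int (2 ^ j')" by (simp only: of_int_le_iff mult_1_right)
    then show ?thesis by (simp add: field_simps)
  qed
  ultimately have "7 / 8 \<le> of_int q' / (8 * 2 ^ j :: real)" by linarith
  then have "real_of_int (7 * 2 ^ j) \<le> real_of_int q'" by (simp add: field_simps)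
  then have "7 * 2 ^ j \<le> q'" by (simp only: of_int_le_iff)
  moreover have "q * 1 \<le> q * q" using q(2) by (intro mult_left_mono) auto
  moreover have "q * q \<le> 2 ^ j" using q(3) by (simp add: power2_eq_square)
  ultimately show ?thesis using q(2) by linarith
qed

text \<open>At most one denominator lies in each dyadic interval.\<close>

lemma lacunary_sum:
  fixes Fs :: "(int \<times> int) set"
  assumes F: "finite Fs" and q1: "\<And>b q. (b, q) \<in> Fs \<Longrightarrow> q \<ge> 1"
    and lac: "\<And>b q b' q'. (b, q) \<in> Fs \<Longrightarrow> (b', q') \<in> Fs \<Longrightarrow> (b, q) \<noteq> (b', q') \<Longrightarrow> 2 * q \<le> q' \<or> 2 * q' \<le> q"
  shows "(\<Sum>(b, q)\<in>Fs. real_of_int q powr (-1/16)) \<le> 1 / (1 - 2 powr (-1/16))"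
proof -
  define lv where "lv = (\<lambda>(b :: int, q :: int). - \<lfloor>log 2 (real_of_int q)\<rfloor>)"
  have lvb: "2 powr (- lv (b, q)) \<le> q" "q < 2 * 2 powr (- lv (b, q))" "lv (b, q) \<le> 0" if "(b, q) \<in> Fs" for b q
  proof -
    have q: "real_of_int q \<ge> 1" using q1[OF that] by simp
    have "real_of_int \<lfloor>log 2 q\<rfloor> \<le> log 2 q" by simp
    then have "2 powr real_of_int \<lfloor>log 2 q\<rfloor> \<le> q" using q by (intro iffD1[OF le_log_iff]) auto
    then show "2 powr (- lv (b, q)) \<le> q" by (simp add: lv_def)
    have "log 2 q < real_of_int \<lfloor>log 2 q\<rfloor> + 1" by linarith
    then have "q < 2 powr (real_of_int \<lfloor>log 2 q\<rfloor> + 1)" using q by (intro iffD1[OF log_less_iff]) auto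
    then show "q < 2 * 2 powr (- lv (b, q))" by (simp add: lv_def powr_add)
    have "0 \<le> log 2 q" using q by simp
    then show "lv (b, q) \<le> 0" by (simp add: lv_def)
  qed
  have inj: "inj_on lv Fs"
  proof (rule inj_onI, rule ccontr)
    fix x y assume xy: "x \<in> Fs" "y \<in> Fs" "lv x = lv y" "x \<noteq> y"
    obtain b q where x: "x = (b, q)" by (cases x)
    obtain b' q' where y: "y = (b', q')" by (cases y)
    have "2 * q \<le> q' \<or> 2 * q' \<le> q" using lac xy unfolding x y by blast
    then have "2 * real_of_int q \<le> real_of_int q' \<or> 2 * real_of_int q' \<le> real_of_int q" by linarith
    then show False using lvb[of b q] lvb[of b' q'] xy unfolding x y by auto
  qed
  have "(\<Sum>(b, q)\<in>Fs. of_int q powr (-1/16)) \<le> (\<Sum>x\<in>Fs. 2 powr (1/16 * lv x))"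
  proof (rule sum_mono)
    fix x assume x: "x \<in> Fs"
    obtain b q where [simp]: "x = (b, q)" by (cases x)
    have "of_int q powr (-1/16) \<le> (2 powr (- lv (b, q))) powr (-1/16)"
      using lvb[of b q] x by (intro powr_mono2') auto
    also have "\<dots> = 2 powr (1/16 * lv (b, q))" by (simp add: powr_powr)
    finally show "(case x of (b, q) \<Rightarrow> of_int q powr (-1/16)) \<le> 2 powr (1/16 * lv x)" by simp
  qed
  also have "\<dots> = (\<Sum>i\<in>lv ` Fs. 2 powr (1/16 * i))" using inj by (simp add: sum.reindex)
  also have "\<dots> \<le> 1 powr (1/16) / (1 - 2 powr (-(1/16)))"
  proof (rule geometric_levels)
    fix i assume "i \<in> lv ` Fs"
    then have "i \<le> 0" using lvb by auto
    then have "2 powr real_of_int i \<le> 2 powr 0" by (intro powr_mono) auto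
    then show "2 powr real_of_int i \<le> 1" by simp
  qed (use F in auto)
  finally show ?thesis by simp
qed

lemma phase_decay_sum:
  fixes \<theta> :: real
  assumes "finite J"
  shows "(\<Sum>j\<in>J. if 4 ^ j * \<bar>\<theta>\<bar> > 1 then (4 ^ j * \<bar>\<theta>\<bar>) powr (-1/32) else 0) \<le> 1 / (1 - 2 powr (-1/16))"
proof -
  define J' where "J' = {j\<in>J. 4 ^ j * \<bar>\<theta>\<bar> > 1}"
  have J': "finite J'" using assms by (simp add: J'_def)
  have pos: "1 - 2 powr (-1/16::real) > 0" by (simp add: powr_less_one)
  have "(\<Sum>j\<in>J. if 4 ^ j * \<bar>\<theta>\<bar> > 1 then (4 ^ j * \<bar>\<theta>\<bar>) powr (-1/32) else 0) = (\<Sum>j\<in>J'. (4 ^ j * \<bar>\<theta>\<bar>) powr (-1/32))"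
    unfolding J'_def using assms by (rule sum.inter_filter[symmetric])
  also have "\<dots> \<le> 1 / (1 - 2 powr (-1/16))"
  proof (cases "\<theta> = 0")
    case True
    then show ?thesis using pos by simp
  next
    case False
    have four: "(4::real) ^ j = 2 powr (2 * real j)" for j
    proof -
      have "(4::real) ^ j = (2 ^ 2) ^ j" by simp
      also have "\<dots> = 2 ^ (2 * j)" by (simp only: power_mult)
      finally show ?thesis by (simp add: powr_realpow[symmetric])
    qed
    have "(\<Sum>j\<in>J'. (4 ^ j * \<bar>\<theta>\<bar>) powr (-1/32)) = (\<Sum>j\<in>J'. \<bar>\<theta>\<bar> powr (-1/32) * 2 powr (1/16 * real_of_int (- int j)))"
      unfolding four by (intro sum.cong refl) (simp add: powr_mult powr_powr)
    also have "\<dots> = \<bar>\<theta>\<bar> powr (-1/32) * (\<Sum>i\<in>(\<lambda>j. - int j) ` J'. 2 powr (1/16 * real_of_int i))"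
      by (subst sum.reindex) (auto simp: inj_on_def sum_distrib_left)
    also have "\<dots> \<le> \<bar>\<theta>\<bar> powr (-1/32) * ((\<bar>\<theta>\<bar> powr (1/2)) powr (1/16) / (1 - 2 powr (-(1/16))))"
    proof (intro mult_left_mono geometric_levels)
      fix i assume "i \<in> (\<lambda>j. - int j) ` J'"
      then obtain j where i: "i = - int j" and j: "4 ^ j * \<bar>\<theta>\<bar> > 1" by (auto simp: J'_def)
      have "1 \<le> (2 powr (2 * real j) * \<bar>\<theta>\<bar>) powr (1/2)" using j unfolding four by (intro ge_one_powr_ge_zero) auto
      also have "\<dots> = 2 powr (real j) * \<bar>\<theta>\<bar> powr (1/2)" by (simp add: powr_mult powr_powr)
      finally have "2 powr (- real j) * 1 \<le> 2 powr (- real j) * (2 powr (real j) * \<bar>\<theta>\<bar> powr (1/2))" by (intro mult_left_mono) auto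
      also have "\<dots> = \<bar>\<theta>\<bar> powr (1/2)" by (simp add: powr_minus)
      finally show "2 powr real_of_int i \<le> \<bar>\<theta>\<bar> powr (1/2)" by (simp add: i)
    qed (use J' in auto)
    also have "\<dots> = (\<bar>\<theta>\<bar> powr (-1/32) * \<bar>\<theta>\<bar> powr (1/32)) / (1 - 2 powr (-1/16))" by (simp add: powr_powr)
    also have "\<bar>\<theta>\<bar> powr (-1/32) * \<bar>\<theta>\<bar> powr (1/32) = 1" using False by (simp flip: powr_add)
    finally show ?thesis .
  qed
  finally show ?thesis .
qed

lemma scale_decay_sum:
  assumes "finite J"
  shows "(\<Sum>j\<in>J. 2 powr (- real j / 32)) \<le> 1 / (1 - 2 powr (-1/32))"
proof -
  have "(\<Sum>j\<in>J. 2 powr (- real j / 32)) = (\<Sum>i\<in>(\<lambda>j. - int j) ` J. 2 powr (1/32 * real_of_int i))"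
    by (subst sum.reindex) (auto simp: inj_on_def)
  also have "\<dots> \<le> 1 powr (1/32) / (1 - 2 powr (-(1/32)))"
  proof (intro geometric_levels)
    fix i assume "i \<in> (\<lambda>j. - int j) ` J"
    then have "2 powr real_of_int i \<le> 2 powr 0" by (intro powr_mono) auto
    then show "2 powr real_of_int i \<le> 1" by simp
  qed (use assms in auto)
  finally show ?thesis by simp
qed

lemma cutoff_telescope: "a \<le> e \<Longrightarrow> cutoff a e m = (\<Sum>j\<in>{a..<e}. cutoff j (Suc j) m)"
proof (induction e rule: dec_induct)
  case (step n)
  then show ?case by (simp add: sum.atLeastLessThan_Suc) (simp add: cutoff_def)
qed (simp add: cutoff_def)

lemma phased_telescope:
  assumes "a \<le> e"
  shows "phased \<alpha> a e m = (\<Sum>j\<in>{a..<e}. phased \<alpha> j (Suc j) m)"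
  unfolding phased_def cutoff_telescope[OF assms] by (simp add: sum_distrib_left sum_divide_distrib)

definition total_const :: "real \<Rightarrow> real" where
  "total_const C = block_const C * (1 / (1 - 2 powr (-1/16)))
     + 4800 * C powr (1/3) * (2 * (1 / (1 - 2 powr (-1/32))) + 6 + (1 / (1 - 2 powr (-1/16))) * (1 / (1 - 2 powr (-1/16))))"

lemma block_const_nonneg: "block_const C \<ge> 0"
  unfolding block_const_def tensor_const_def cz_const_def
  by (intro add_nonneg_nonneg mult_nonneg_nonneg) (auto intro: max_const_nonneg)

text \<open>The scales at which \<open>2 \<alpha>\<close> is within \<open>4\<^bsup>-j\<^esup>\<close> of a fraction with small denominator are grouped
  into one block for each fraction. At the other scales Weyl's inequality gives decay, either in the scale or
  in the distance to a nearby fraction. The sum over the fractions converges because their denominators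
  grow geometrically.\<close>

lemma truncated_kernel_bdd:
  assumes w: "bump C w"
  shows "form_bdd w (total_const C) (\<lambda>n m. phased \<alpha> 0 J (n - m))"
proof -
  define \<beta> where "\<beta> = 2 * \<alpha>"
  define \<theta> where "\<theta> = (\<lambda>(b :: int, q :: int). \<beta> - of_int b / of_int q)"
  define \<sigma> where "\<sigma> = 1 / (1 - 2 powr (-1/16 :: real))"
  have \<sigma>: "\<sigma> \<ge> 0" by (simp add: \<sigma>_def powr_less_one less_imp_le)
  \<comment> \<open>At the scales from \<open>6\<close> on, a fraction within \<open>4\<^bsup>-j\<^esup>\<close> of \<open>\<beta>\<close> with \<open>q\<^sup>2 \<le> 2\<^sup>j\<close> meets the weaker requirement of \<open>close_frac\<close>.\<close>
  define J6 where "J6 = {j\<in>{6..<J}. \<exists>x. close_frac \<beta> j x}"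
  define fr where "fr j = (SOME x. close_frac \<beta> j x)" for j
  have fr: "close_frac \<beta> j (fr j)" if "j \<in> J6" for j
    using that unfolding J6_def fr_def by (auto intro: someI_ex)
  have uniq: "x = y" if "close_frac \<beta> j x" "close_frac \<beta> j y" for j x y
  proof (rule ccontr)
    assume ne: "x \<noteq> y"
    obtain b q b' q' where xy: "x = (b, q)" "y = (b', q')" by (cases x, cases y) auto
    have "2 * q \<le> q'" "2 * q' \<le> q" using close_frac_lacunary that ne unfolding xy by blast+
    moreover have "q \<ge> 1" using that unfolding xy by (simp add: close_frac_def)
    ultimately show False by simp
  qed
  define Fs where "Fs = fr ` J6"
  have Fs: "finite Fs" by (simp add: Fs_def J6_def)
  have FsD: "\<exists>j. close_frac \<beta> j x" if "x \<in> Fs" for x using that fr by (auto simp: Fs_def)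
  have lac: "2 * q \<le> q' \<or> 2 * q' \<le> q" if x: "(b, q) \<in> Fs" "(b', q') \<in> Fs" "(b, q) \<noteq> (b', q')" for b q b' q'
  proof -
    obtain j j' where j: "close_frac \<beta> j (b, q)" "close_frac \<beta> j' (b', q')"
      using FsD x by blast
    show ?thesis
      using close_frac_lacunary[OF j _ x(3)] close_frac_lacunary[OF j(2,1) _ x(3)[symmetric]] nat_le_linear[of j j'] by blast
  qed
  have q1: "q \<ge> 1" "coprime b q" if bq: "(b, q) \<in> Fs" for b q
  proof -
    obtain j where "close_frac \<beta> j (b, q)" using FsD bq by blast
    then show "q \<ge> 1" "coprime b q" by (auto simp: close_frac_def)
  qed
  have sF: "(\<Sum>(b, q)\<in>Fs. of_int q powr (-1/16)) \<le> \<sigma>"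
    unfolding \<sigma>_def using Fs q1(1) lac by (rule lacunary_sum)
  define Mj where "Mj x = {j\<in>{6..<J}. (snd x)\<^sup>2 \<le> 2 ^ j \<and> 4 ^ j * \<bar>\<theta> x\<bar> \<le> 1}" for x
  have Mj_close: "close_frac \<beta> j x" if x: "x \<in> Fs" and j: "j \<in> Mj x" for x j
  proof -
    obtain b q where [simp]: "x = (b, q)" by (cases x)
    have q: "q \<ge> 1" "coprime b q" using q1 x by auto
    have j': "6 \<le> j" "q\<^sup>2 \<le> 2 ^ j" "4 ^ j * \<bar>\<theta> x\<bar> \<le> 1" using j by (auto simp: Mj_def)
    have "(8 * q)\<^sup>2 = 64 * q\<^sup>2" by (simp add: power_mult_distrib)
    also have "\<dots> \<le> 2 ^ 6 * 2 ^ j" using j' by simp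
    also have "\<dots> \<le> 2 ^ j * 2 ^ j" using j' by (intro mult_right_mono power_increasing) auto
    finally have "(8 * q)\<^sup>2 \<le> (2 ^ j)\<^sup>2" by (simp add: power2_eq_square)
    then have "8 * q \<le> 2 ^ j" by (rule power2_le_imp_le) simp
    then have q8: "8 * real_of_int q \<le> 2 ^ j" by (metis of_int_le_iff of_int_mult of_int_numeral of_int_power)
    have "\<bar>\<theta> x\<bar> \<le> 1 / 4 ^ j" using j'(3) by (simp add: field_simps)
    also have "(4::real) ^ j = 2 ^ j * 2 ^ j" by (simp flip: power_mult_distrib)
    also have "1 / (2 ^ j * 2 ^ j) \<le> 1 / (8 * real_of_int q * 2 ^ j)" using q8 q by (intro divide_left_mono mult_right_mono) auto
    finally show ?thesis using q j'(2) by (simp add: close_frac_def \<theta>_def mult_ac)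
  qed
  have block: "form_bdd w (block_const C * of_int (snd x) powr (-1/16)) (\<lambda>n m. \<Sum>j\<in>Mj x. phased \<alpha> j (Suc j) (n - m))" if x: "x \<in> Fs" for x
  proof (cases "Mj x = {}")
    case True
    have "0 \<le> block_const C * of_int (snd x) powr (-1/16)" using block_const_nonneg by simp
    then show ?thesis using True form_bdd_mono[OF form_bdd_zero] w by (simp add: bump_def)
  next
    case False
    obtain b q where xq [simp]: "x = (b, q)" by (cases x)
    have fin: "finite (Mj x)" by (simp add: Mj_def)
    define a where "a = Min (Mj x)"
    define e where "e = Suc (Max (Mj x))"
    have a: "a \<in> Mj x" and e: "Max (Mj x) \<in> Mj x" using False fin by (auto simp: a_def)
    have ae: "a \<le> e" using fin e by (simp add: a_def e_def le_SucI)
    have Meq: "Mj x = {a..<e}"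
    proof
      show "Mj x \<subseteq> {a..<e}" using fin by (auto simp: a_def e_def less_Suc_eq_le)
      show "{a..<e} \<subseteq> Mj x"
      proof
        fix j assume j: "j \<in> {a..<e}"
        then have j2: "a \<le> j" "j \<le> Max (Mj x)" by (auto simp: e_def)
        have "q\<^sup>2 \<le> 2 ^ a" using a by (simp add: Mj_def)
        also have "(2::int) ^ a \<le> 2 ^ j" using j2 by (intro power_increasing) auto
        finally have "q\<^sup>2 \<le> 2 ^ j" .
        moreover have "(4::real) ^ j * \<bar>\<theta> x\<bar> \<le> 4 ^ Max (Mj x) * \<bar>\<theta> x\<bar>" using j2 by (intro mult_right_mono power_increasing) auto
        moreover have "4 ^ Max (Mj x) * \<bar>\<theta> x\<bar> \<le> 1" using e by (simp add: Mj_def)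
        moreover have "6 \<le> j" "j < J" using a e j2 by (auto simp: Mj_def)
        ultimately show "j \<in> Mj x" by (simp add: Mj_def)
      qed
    qed
    have "form_bdd w (block_const C * of_int q powr (-1/16)) (\<lambda>n m. phased \<alpha> a e (n - m))"
    proof (rule block_weighted[OF w _ _ _ _ ae])
      show "\<bar>2 * \<alpha> - of_int b / of_int q\<bar> * 4 ^ e \<le> 4" using e by (simp add: Mj_def e_def \<theta>_def \<beta>_def mult.commute)
    qed (use q1 x a in \<open>auto simp: Mj_def\<close>)
    then show ?thesis unfolding Meq phased_telescope[OF ae] by simp
  qed
  define M where "M = (\<Union>x\<in>Fs. Mj x)"
  define R where "R = {..<J} - M"
  have MJ: "M \<subseteq> {..<J}" by (auto simp: M_def Mj_def)
  define X where "X j = (\<Sum>(b, q)\<in>Fs. (if 4 ^ j * \<bar>\<theta> (b, q)\<bar> > 1 then (4 ^ j * \<bar>\<theta> (b, q)\<bar>) powr (-1/32) else 0) * of_int q powr (-1/16))" for j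
  have X0: "X j \<ge> 0" for j unfolding X_def by (intro sum_nonneg) auto
  define c where "c j = 4800 * C powr (1/3) * (2 * 2 powr (- real j / 32) + (if j < 6 then 1 else 0) + X j)" for j
  have rest: "form_bdd w (c j) (\<lambda>n m. phased \<alpha> j (Suc j) (n - m))" if j: "j \<in> R" for j
  proof -
    obtain b q where bq: "coprime b q" and q0: "0 < q" and qN: "q \<le> int (8 * 2 ^ j)"
      and ap: "\<bar>of_int q * \<beta> - of_int b\<bar> < 1 / real (8 * 2 ^ j)"
      using Dirichlet_approx_coprime[of "8 * 2 ^ j" \<beta>] by auto
    have qr: "real_of_int q \<ge> 1" using q0 by simp
    have "\<bar>\<beta> - of_int b / of_int q\<bar> = \<bar>of_int q * \<beta> - of_int b\<bar> / of_int q"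
    proof -
      have "\<beta> - of_int b / of_int q = (of_int q * \<beta> - of_int b) / of_int q" using qr by (simp add: field_simps)
      then show ?thesis using qr by (simp add: abs_divide)
    qed
    also have "\<dots> \<le> 1 / real (8 * 2 ^ j) / of_int q" using ap qr by (intro divide_right_mono) auto
    finally have th: "\<bar>\<beta> - of_int b / of_int q\<bar> \<le> 1 / (8 * 2 ^ j * of_int q)" by simp
    define y where "y = (damp (4 ^ j * \<bar>\<theta> (b, q)\<bar>) / of_int q) powr (1/16)"
    have piece: "form_bdd w (4800 * C powr (1/3) * (2 powr (- real j / 32) + y)) (\<lambda>n m. phased \<alpha> j (Suc j) (n - m))"
      using piece_weighted[OF w _ _ bq, of j \<alpha>] q0 qN th by (simp add: y_def \<theta>_def \<beta>_def)
    have yq: "y \<le> of_int q powr (-1/16)"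
    proof -
      have "y \<le> (1 / of_int q) powr (1/16)" unfolding y_def using damp_bounds qr by (intro powr_mono2 divide_right_mono) auto
      then show ?thesis using qr by (simp add: powr_divide powr_minus_divide)
    qed
    have "y \<le> 2 powr (- real j / 32) + (if j < 6 then 1 else 0) + X j"
    proof -
      consider "j < 6" | "j \<ge> 6" "2 ^ j < q\<^sup>2" | "j \<ge> 6" "q\<^sup>2 \<le> 2 ^ j" by linarith
      then show ?thesis
      proof cases
        case 1
        have "real_of_int q powr (-1/16) \<le> 1 powr (-1/16)" using qr by (intro powr_mono2') auto
        then have "y \<le> 1" using yq by simp
        then show ?thesis using 1 X0[of j] by (smt (verit) powr_ge_zero)
      next
        case 2
        have "real_of_int (2 ^ j) \<le> real_of_int (q\<^sup>2)" using 2 by (simp only: of_int_le_iff less_imp_le)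
        then have "2 ^ j \<le> (real_of_int q)\<^sup>2" by simp
        then have "sqrt (2 ^ j) \<le> real_of_int q" using qr by (intro real_le_lsqrt) auto
        then have "2 powr (real j / 2) \<le> real_of_int q"
          by (simp add: powr_half_sqrt[symmetric] powr_realpow[symmetric] powr_powr)
        then have "of_int q powr (-1/16) \<le> (2 powr (real j / 2)) powr (-1/16)" by (intro powr_mono2') auto
        also have "\<dots> = 2 powr (- real j / 32)" by (simp add: powr_powr)
        finally show ?thesis using yq X0[of j] 2 by simp
      next
        case 3
        then have cl: "close_frac \<beta> j (b, q)" using bq q0 th by (simp add: close_frac_def)
        then have j6: "j \<in> J6" using 3 j by (auto simp: J6_def R_def)
        then have "fr j = (b, q)" using uniq[OF fr cl] by simp
        then have inF: "(b, q) \<in> Fs" using imageI[OF j6, of fr] by (simp add: Fs_def)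
        then have "j \<notin> Mj (b, q)" using j by (auto simp: R_def M_def)
        then have big: "4 ^ j * \<bar>\<theta> (b, q)\<bar> > 1" using 3 j by (auto simp: Mj_def R_def)
        have "y = ((4 ^ j * \<bar>\<theta> (b, q)\<bar>) powr (-1/2)) powr (1/16) * (1 / of_int q) powr (1/16)"
          unfolding y_def damp_def using big qr by (simp add: powr_divide)
        also have "\<dots> = (4 ^ j * \<bar>\<theta> (b, q)\<bar>) powr (-1/32) * of_int q powr (-1/16)"
          using qr by (simp add: powr_powr powr_divide powr_minus_divide)
        also have "\<dots> = (\<Sum>(b, q)\<in>{(b, q)}. (if 4 ^ j * \<bar>\<theta> (b, q)\<bar> > 1 then (4 ^ j * \<bar>\<theta> (b, q)\<bar>) powr (-1/32) else 0) * of_int q powr (-1/16))"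
          using big by simp
        also have "\<dots> \<le> X j" unfolding X_def using Fs inF by (intro sum_mono2) auto
        finally show ?thesis by (smt (verit) powr_ge_zero)
      qed
    qed
    then have "4800 * C powr (1/3) * (2 powr (- real j / 32) + y) \<le> c j"
      unfolding c_def by (intro mult_left_mono) auto
    then show ?thesis using piece w by (intro form_bdd_mono[OF piece]) (auto simp: bump_def)
  qed
  have disj: "Mj x \<inter> Mj y = {}" if "x \<in> Fs" "y \<in> Fs" "x \<noteq> y" for x y
    using Mj_close uniq that by blast
  have "form_bdd w ((\<Sum>j\<in>R. c j) + (\<Sum>x\<in>Fs. block_const C * of_int (snd x) powr (-1/16)))
     (\<lambda>n m. (\<Sum>j\<in>R. phased \<alpha> j (Suc j) (n - m)) + (\<Sum>x\<in>Fs. \<Sum>j\<in>Mj x. phased \<alpha> j (Suc j) (n - m)))"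
    by (intro form_bdd_add form_bdd_sum rest block Fs) (auto simp: R_def)
  moreover have "(\<Sum>j\<in>R. phased \<alpha> j (Suc j) (n - m)) + (\<Sum>x\<in>Fs. \<Sum>j\<in>Mj x. phased \<alpha> j (Suc j) (n - m)) = phased \<alpha> 0 J (n - m)" for n m
  proof -
    have "(\<Sum>x\<in>Fs. \<Sum>j\<in>Mj x. phased \<alpha> j (Suc j) (n - m)) = (\<Sum>j\<in>M. phased \<alpha> j (Suc j) (n - m))"
      unfolding M_def using Fs disj by (intro sum.UNION_disjoint[symmetric]) (auto simp: Mj_def)
    then show ?thesis
      using MJ unfolding R_def phased_telescope[OF le0] atLeast0LessThan by (simp add: sum.subset_diff[of M "{..<J}"])
  qed
  ultimately have "form_bdd w ((\<Sum>j\<in>R. c j) + (\<Sum>x\<in>Fs. block_const C * of_int (snd x) powr (-1/16))) (\<lambda>n m. phased \<alpha> 0 J (n - m))"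
    by simp
  then show ?thesis
  proof (rule form_bdd_mono)
    have R: "finite R" by (simp add: R_def)
    have s1: "(\<Sum>j\<in>R. 2 powr (- real j / 32)) \<le> 1 / (1 - 2 powr (-1/32))" by (rule scale_decay_sum[OF R])
    have s2: "(\<Sum>j\<in>R. if j < 6 then 1 else 0 :: real) \<le> 6"
    proof -
      have "(\<Sum>j\<in>R. if j < 6 then 1 else 0 :: real) = real (card {j\<in>R. j < 6})" using R by (simp add: sum.inter_filter[symmetric])
      also have "\<dots> \<le> real (card {..<6::nat})" by (intro of_nat_mono card_mono) auto
      finally show ?thesis by simp
    qed
    have s3: "(\<Sum>j\<in>R. X j) \<le> \<sigma> * \<sigma>"
    proof -
      have "(\<Sum>j\<in>R. X j) = (\<Sum>x\<in>Fs. \<Sum>j\<in>R. (if 4 ^ j * \<bar>\<theta> x\<bar> > 1 then (4 ^ j * \<bar>\<theta> x\<bar>) powr (-1/32) else 0) * of_int (snd x) powr (-1/16))"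
        unfolding X_def by (subst sum.swap) (simp add: case_prod_unfold cong: if_cong)
      also have "\<dots> = (\<Sum>x\<in>Fs. (\<Sum>j\<in>R. if 4 ^ j * \<bar>\<theta> x\<bar> > 1 then (4 ^ j * \<bar>\<theta> x\<bar>) powr (-1/32) else 0) * of_int (snd x) powr (-1/16))"
        by (simp only: sum_distrib_right)
      also have "\<dots> \<le> (\<Sum>x\<in>Fs. \<sigma> * of_int (snd x) powr (-1/16))"
        unfolding \<sigma>_def by (intro sum_mono mult_right_mono phase_decay_sum R) auto
      also have "\<dots> = \<sigma> * (\<Sum>(b, q)\<in>Fs. of_int q powr (-1/16))" by (simp add: sum_distrib_left case_prod_unfold)
      also have "\<dots> \<le> \<sigma> * \<sigma>" using sF \<sigma> by (rule mult_left_mono)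
      finally show ?thesis .
    qed
    have "(\<Sum>j\<in>R. c j) = 4800 * C powr (1/3) * (2 * (\<Sum>j\<in>R. 2 powr (- real j / 32)) + (\<Sum>j\<in>R. if j < 6 then 1 else 0) + (\<Sum>j\<in>R. X j))"
      unfolding c_def by (simp only: sum_distrib_left[symmetric] sum.distrib)
    also have "\<dots> \<le> 4800 * C powr (1/3) * (2 * (1 / (1 - 2 powr (-1/32))) + 6 + \<sigma> * \<sigma>)"
      using s1 s2 s3 by (intro mult_left_mono add_mono) auto
    finally have sc: "(\<Sum>j\<in>R. c j) \<le> 4800 * C powr (1/3) * (2 * (1 / (1 - 2 powr (-1/32))) + 6 + \<sigma> * \<sigma>)" .
    have "(\<Sum>x\<in>Fs. block_const C * of_int (snd x) powr (-1/16)) = block_const C * (\<Sum>(b, q)\<in>Fs. of_int q powr (-1/16))"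
      by (simp add: sum_distrib_left case_prod_unfold)
    also have "\<dots> \<le> block_const C * \<sigma>" using sF block_const_nonneg by (rule mult_left_mono)
    finally show "(\<Sum>j\<in>R. c j) + (\<Sum>x\<in>Fs. block_const C * of_int (snd x) powr (-1/16)) \<le> total_const C"
      using sc unfolding total_const_def \<sigma>_def by linarith
  qed (use w in \<open>simp add: bump_def\<close>)
qed

section \<open>The operator norm\<close>

lemma exp_eq_ee: "exp (2 * of_real pi * \<i> * of_real \<alpha> * of_int (m\<^sup>2)) = ee (\<alpha> * (of_int m)\<^sup>2)"
  by (simp add: ee_def cis_conv_exp mult_ac)

lemma cutoff_eq_1: "m \<noteq> 0 \<Longrightarrow> 2 * \<bar>real_of_int m\<bar> \<le> 2 ^ J \<Longrightarrow> cutoff 0 J m = 1"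
proof -
  assume m: "m \<noteq> 0" "2 * \<bar>real_of_int m\<bar> \<le> 2 ^ J"
  have "1 \<le> \<bar>m\<bar>" using m by simp
  then have "1 \<le> \<bar>real_of_int m\<bar>" by linarith
  then show ?thesis using m ramp_eq_1[of 0 m] ramp_eq_0[of m J] by (simp add: cutoff_def)
qed

lemma H_eq_phased:
  assumes f: "finite W" "\<And>m. m \<notin> W \<Longrightarrow> f m = 0" and J: "\<And>m. m \<in> W \<Longrightarrow> 2 * \<bar>real_of_int (n - m)\<bar> \<le> 2 ^ J"
  shows "H \<alpha> f n = (\<Sum>m\<in>W. phased \<alpha> 0 J (n - m) * f m)"
proof -
  have "H \<alpha> f n = (\<Sum>\<^sub>\<infinity>m\<in>(\<lambda>m. n - m) ` W. phased \<alpha> 0 J m * f (n - m))"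
    unfolding H_def exp_eq_ee
  proof (rule infsum_cong_neutral)
    fix m assume "m \<in> (\<lambda>m. n - m) ` W - - {0}"
    then show "phased \<alpha> 0 J m * f (n - m) = 0" by (simp add: phased_def)
  next
    fix m assume "m \<in> - {0} - (\<lambda>m. n - m) ` W"
    then have "n - m \<notin> W" by (auto simp: image_iff)
    then show "ee (\<alpha> * (real_of_int m)\<^sup>2) * f (n - m) / of_int m = 0" using f by simp
  next
    fix m assume m: "m \<in> - {0} \<inter> (\<lambda>m. n - m) ` W"
    then have "cutoff 0 J m = 1" using J by (intro cutoff_eq_1) auto
    then show "ee (\<alpha> * (real_of_int m)\<^sup>2) * f (n - m) / of_int m = phased \<alpha> 0 J m * f (n - m)"
      by (simp add: phased_def)
  qed
  also have "\<dots> = (\<Sum>m\<in>(\<lambda>m. n - m) ` W. phased \<alpha> 0 J m * f (n - m))" using f by simp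
  also have "\<dots> = (\<Sum>m\<in>W. phased \<alpha> 0 J (n - m) * f m)" by (subst sum.reindex) (auto simp: inj_on_def)
  finally show ?thesis .
qed

lemma H_finite_sums:
  assumes w: "bump C w" and f: "finitely_supported f" and Y: "finite Y"
  shows "(\<Sum>n\<in>Y. (cmod (H \<alpha> f n))\<^sup>2 * w n) \<le> (total_const C)\<^sup>2 * (\<Sum>m\<in>{m. f m \<noteq> 0}. (cmod (f m))\<^sup>2 * w m)"
proof -
  have w0: "w n > 0" for n using w by (simp add: bump_def weight_def)
  define S where "S = {m. f m \<noteq> 0}"
  have S: "finite S" using f by (simp add: finitely_supported_def S_def)
  define W where "W = Y \<union> S"
  have W: "finite W" using Y S by (simp add: W_def)
  define D where "D = Max (insert 0 ((\<lambda>(n, m). \<bar>n - m\<bar>) ` (W \<times> W)))"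
  define J where "J = Suc (nat D)"
  have J: "2 * \<bar>real_of_int (n - m)\<bar> \<le> 2 ^ J" if "n \<in> W" "m \<in> W" for n m
  proof -
    have "\<bar>n - m\<bar> \<in> insert 0 ((\<lambda>(n, m). \<bar>n - m\<bar>) ` (W \<times> W))" using that by force
    then have "\<bar>n - m\<bar> \<le> D" unfolding D_def using W by (intro Max_ge) auto
    then have "\<bar>n - m\<bar> \<le> int (nat D)" by linarith
    also have "\<dots> \<le> 2 ^ nat D" using of_nat_less_two_power[of "nat D"] by (rule less_imp_le)
    finally have "real_of_int \<bar>n - m\<bar> \<le> real_of_int (2 ^ nat D)" by (simp only: of_int_le_iff)
    then show ?thesis by (simp add: J_def)
  qed
  \<comment> \<open>Testing the form against this function turns it into the square of the weighted norm of the image.\<close>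
  define g where "g n = (if n \<in> Y then cnj (H \<alpha> f n) * of_real (w n) else 0)" for n
  define Z where "Z = (\<Sum>n\<in>Y. (cmod (H \<alpha> f n))\<^sup>2 * w n)"
  have Z0: "Z \<ge> 0" using less_imp_le[OF w0] by (auto simp: Z_def intro!: sum_nonneg)
  define A where "A = (\<Sum>m\<in>S. (cmod (f m))\<^sup>2 * w m)"
  have A0: "A \<ge> 0" using less_imp_le[OF w0] by (auto simp: A_def intro!: sum_nonneg)
  have Hn: "H \<alpha> f n = (\<Sum>m\<in>W. phased \<alpha> 0 J (n - m) * f m)" if "n \<in> W" for n
    by (rule H_eq_phased[OF W]) (use that J in \<open>auto simp: W_def S_def\<close>)
  have "(\<Sum>n\<in>W. \<Sum>m\<in>W. phased \<alpha> 0 J (n - m) * f m * g n) = (\<Sum>n\<in>W. H \<alpha> f n * g n)"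
    by (simp add: Hn sum_distrib_right)
  also have "\<dots> = (\<Sum>n\<in>Y. H \<alpha> f n * g n)"
    using W by (intro sum.mono_neutral_right) (auto simp: W_def g_def)
  also have "\<dots> = (\<Sum>n\<in>Y. complex_of_real ((cmod (H \<alpha> f n))\<^sup>2 * w n))"
  proof (rule sum.cong[OF refl])
    fix n assume "n \<in> Y"
    then have "H \<alpha> f n * g n = (H \<alpha> f n * cnj (H \<alpha> f n)) * of_real (w n)" by (simp add: g_def)
    then show "H \<alpha> f n * g n = complex_of_real ((cmod (H \<alpha> f n))\<^sup>2 * w n)"
      by (simp only: of_real_mult complex_norm_square)
  qed
  also have "\<dots> = complex_of_real Z" by (simp add: Z_def)
  finally have "cmod (\<Sum>n\<in>W. \<Sum>m\<in>W. phased \<alpha> 0 J (n - m) * f m * g n) = cmod (complex_of_real Z)" by (rule arg_cong)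
  also have "\<dots> = Z" using Z0 by (simp only: norm_of_real abs_of_nonneg)
  finally have "Z \<le> total_const C * sqrt (\<Sum>m\<in>W. (cmod (f m))\<^sup>2 * w m) * sqrt (\<Sum>n\<in>W. (cmod (g n))\<^sup>2 / w n)"
    using form_bddD[OF truncated_kernel_bdd[OF w] W, of \<alpha> J f g] by simp
  also have "(\<Sum>m\<in>W. (cmod (f m))\<^sup>2 * w m) = A"
    unfolding A_def using W by (intro sum.mono_neutral_right) (auto simp: W_def S_def)
  also have "(\<Sum>n\<in>W. (cmod (g n))\<^sup>2 / w n) = Z"
  proof -
    have "(\<Sum>n\<in>W. (cmod (g n))\<^sup>2 / w n) = (\<Sum>n\<in>Y. (cmod (g n))\<^sup>2 / w n)"
      using W by (intro sum.mono_neutral_right) (auto simp: W_def g_def)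
    also have "\<dots> = Z" unfolding Z_def
    proof (rule sum.cong[OF refl])
      fix n assume "n \<in> Y"
      then show "(cmod (g n))\<^sup>2 / w n = (cmod (H \<alpha> f n))\<^sup>2 * w n"
        using w0[of n] by (simp add: g_def norm_mult power_mult_distrib power2_eq_square)
    qed
    finally show ?thesis .
  qed
  finally have le: "Z \<le> total_const C * sqrt A * sqrt Z" .
  have "Z \<le> (total_const C)\<^sup>2 * A"
  proof (cases "Z = 0")
    case False
    then have sZ: "sqrt Z > 0" using Z0 by simp
    have "sqrt Z * sqrt Z \<le> (total_const C * sqrt A) * sqrt Z" using le Z0 by simp
    then have "sqrt Z \<le> total_const C * sqrt A" using sZ by (rule mult_right_le_imp_le)
    then have "(sqrt Z)\<^sup>2 \<le> (total_const C * sqrt A)\<^sup>2" using Z0 by (intro power_mono) auto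
    then show ?thesis using Z0 A0 by (simp add: power_mult_distrib)
  qed (use A0 in simp)
  then show ?thesis by (simp add: Z_def A_def S_def)
qed

lemma total_const_nonneg: "total_const C \<ge> 0"
  unfolding total_const_def
  by (intro add_nonneg_nonneg mult_nonneg_nonneg block_const_nonneg divide_nonneg_nonneg)
     (auto simp: powr_less_one less_imp_le)

lemma H_op_norm:
  assumes w: "bump C w"
  shows "op_norm (H \<alpha>) w \<le> ennreal (total_const C)"
  unfolding op_norm_def
proof (rule Inf_lower, rule CollectI, intro allI impI)
  fix f assume f: "finitely_supported f"
  have w0: "w n > 0" for n using w by (simp add: bump_def weight_def)
  define S where "S = {m. f m \<noteq> 0}"
  have S: "finite S" using f by (simp add: finitely_supported_def S_def)
  define A where "A = (\<Sum>m\<in>S. (cmod (f m))\<^sup>2 * w m)"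
  have A0: "A \<ge> 0" using less_imp_le[OF w0] by (auto simp: A_def intro!: sum_nonneg)
  have "((\<lambda>n. (cmod (f n))\<^sup>2 * w n) has_sum A) UNIV"
    unfolding A_def by (rule has_sum_finite_neutralI[OF S]) (auto simp: S_def)
  then have nf: "l2_norm w f = ennreal (sqrt A)"
    by (simp add: l2_norm_def has_sum_imp_summable infsumI)
  let ?h = "\<lambda>n. (cmod (H \<alpha> f n))\<^sup>2 * w n"
  have fs: "sum ?h Y \<le> (total_const C)\<^sup>2 * A" if "finite Y" for Y
    using H_finite_sums[OF w f that, of \<alpha>] by (simp add: A_def S_def)
  have sm: "?h summable_on UNIV"
  proof (rule nonneg_bdd_above_summable_on)
    show "0 \<le> ?h n" for n using less_imp_le[OF w0] by simp
    show "bdd_above (sum ?h ` {F. F \<subseteq> UNIV \<and> finite F})"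
      using fs by (intro bdd_aboveI[of _ "(total_const C)\<^sup>2 * A"]) auto
  qed
  have "infsum ?h UNIV \<le> (total_const C)\<^sup>2 * A" by (rule infsum_le_finite_sums[OF sm fs])
  then have "sqrt (infsum ?h UNIV) \<le> total_const C * sqrt A"
    using total_const_nonneg[of C] by (metis real_sqrt_le_mono real_sqrt_mult real_sqrt_abs abs_of_nonneg)
  then have "l2_norm w (H \<alpha> f) \<le> ennreal (total_const C * sqrt A)"
    using sm by (simp add: l2_norm_def ennreal_leI)
  also have "\<dots> = ennreal (total_const C) * l2_norm w f"
    unfolding nf using total_const_nonneg A0 by (simp add: ennreal_mult)
  finally show "l2_norm w (H \<alpha> f) \<le> ennreal (total_const C) * l2_norm w f" .
qed

lemma atLeastLessThan_in_intervals:
  fixes a b :: int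
  assumes "a < b"
  shows "{a..<b} \<in> intervals"
proof -
  have "{a..<b} = {n. real_of_int n \<in> {real_of_int a..real_of_int (b - 1)}}" by auto
  moreover have "finite {a..<b}" "{a..<b} \<noteq> {}" using assms by auto
  ultimately show ?thesis unfolding intervals_def by blast
qed

lemma RH_powr_le:
  assumes "w \<in> RH (3/2)"
  shows "\<exists>K\<ge>0. \<forall>a b. a < b \<longrightarrow> avg {a..<b} (\<lambda>x. w x powr (3/2)) \<le> (K * avg {a..<b} w) powr (3/2)"
proof -
  obtain K where K: "\<And>I. I \<in> intervals \<Longrightarrow> avg I (\<lambda>x. w x powr (3/2)) powr (1 / (3/2)) \<le> K * avg I w"
    and w0: "weight w" using assms by (auto simp: RH_def)
  have "avg {a..<b} (\<lambda>x. w x powr (3/2)) \<le> (\<bar>K\<bar> * avg {a..<b} w) powr (3/2)" if ab: "a < b" for a b :: int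
  proof -
    have an: "avg {a..<b} w \<ge> 0" using w0 by (intro avg_nonneg) (simp add: weight_def less_imp_le)
    have "avg {a..<b} (\<lambda>x. w x powr (3/2)) = (avg {a..<b} (\<lambda>x. w x powr (3/2)) powr (1 / (3/2))) powr (3/2)"
      by (simp add: powr_powr avg_nonneg)
    also have "\<dots> \<le> (\<bar>K\<bar> * avg {a..<b} w) powr (3/2)"
    proof (intro powr_mono2)
      have "K * avg {a..<b} w \<le> \<bar>K\<bar> * avg {a..<b} w" using an by (intro mult_right_mono) auto
      then show "avg {a..<b} (\<lambda>x. w x powr (3/2)) powr (1 / (3/2)) \<le> \<bar>K\<bar> * avg {a..<b} w"
        using K[OF atLeastLessThan_in_intervals[OF ab]] by linarith
    qed auto
    finally show ?thesis .
  qed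
  then show ?thesis by (intro exI[of _ "\<bar>K\<bar>"]) auto
qed

text \<open>The reverse Hoelder inequalities reduce the averages of \<open>w\<^bsup>3/2\<^esup>\<close> and \<open>w\<^bsup>-3/2\<^esup>\<close> to those of \<open>w\<close> and \<open>w\<^bsup>-1\<^esup>\<close>.\<close>

lemma bump_of_A2_RH:
  assumes w: "w \<in> A2" and r: "w \<in> RH (3/2)" "(\<lambda>n. inverse (w n)) \<in> RH (3/2)"
  shows "\<exists>C. bump C w"
proof -
  have w0: "weight w" using w by (simp add: A2_def)
  then have wp: "w n > 0" for n by (simp add: weight_def)
  let ?v = "\<lambda>n. inverse (w n)"
  obtain A where A: "\<And>I. I \<in> intervals \<Longrightarrow> avg I w * avg I ?v \<le> A"
  proof -
    have "(SUP I\<in>intervals. ereal (avg I w * avg I ?v)) < \<infinity>" using w by (simp add: A2_def)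
    then obtain A where A: "(SUP I\<in>intervals. ereal (avg I w * avg I ?v)) < ereal A"
      using ereal_dense2 by blast
    have "avg I w * avg I ?v \<le> A" if "I \<in> intervals" for I
    proof -
      have "ereal (avg I w * avg I ?v) \<le> (SUP I\<in>intervals. ereal (avg I w * avg I ?v))" using that by (rule SUP_upper)
      with A have "ereal (avg I w * avg I ?v) < ereal A" by (rule order_le_less_trans[rotated])
      then show ?thesis by simp
    qed
    then show ?thesis using that by blast
  qed
  obtain K where K: "K \<ge> 0" "\<And>a b. a < b \<Longrightarrow> avg {a..<b} (\<lambda>x. w x powr (3/2)) \<le> (K * avg {a..<b} w) powr (3/2)"
    using RH_powr_le[OF r(1)] by blast
  obtain K' where K': "K' \<ge> 0" "\<And>a b. a < b \<Longrightarrow> avg {a..<b} (\<lambda>x. ?v x powr (3/2)) \<le> (K' * avg {a..<b} ?v) powr (3/2)"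
    using RH_powr_le[OF r(2)] by blast
  have inv: "?v x powr (3/2) = w x powr (-3/2)" for x
    using wp[of x] by (simp add: inverse_eq_divide powr_divide powr_minus_divide)
  have "avg {a..<b} (\<lambda>x. w x powr (3/2)) * avg {a..<b} (\<lambda>x. w x powr (-3/2)) \<le> (K * K' * A) powr (3/2)" if ab: "a < b" for a b
  proof -
    have an: "avg {a..<b} w \<ge> 0" "avg {a..<b} ?v \<ge> 0" using less_imp_le[OF wp] by (auto intro!: avg_nonneg)
    have "avg {a..<b} (\<lambda>x. w x powr (3/2)) * avg {a..<b} (\<lambda>x. w x powr (-3/2))
      \<le> (K * avg {a..<b} w) powr (3/2) * (K' * avg {a..<b} ?v) powr (3/2)"
      using K(2)[OF ab] K'(2)[OF ab] unfolding inv by (intro mult_mono) (auto intro: avg_nonneg)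
    also have "\<dots> = ((K * avg {a..<b} w) * (K' * avg {a..<b} ?v)) powr (3/2)"
      by (rule powr_mult[symmetric])
    also have "\<dots> = (K * K' * (avg {a..<b} w * avg {a..<b} ?v)) powr (3/2)" by (simp add: mult_ac)
    also have "\<dots> \<le> (K * K' * A) powr (3/2)"
      using A[OF atLeastLessThan_in_intervals[OF ab]] K K' an by (intro powr_mono2 mult_left_mono) auto
    finally show ?thesis .
  qed
  then have "bump ((K * K' * A) powr (3/2)) w" using w0 by (simp add: bump_def)
  then show ?thesis by blast
qed

theorem corollary1p3:
  "\<exists>r :: real. 1 < r \<and> r < 2 \<and>
    (\<forall>w. weight w \<and> w \<in> A2 \<inter> RH r \<and> (\<lambda>n. inverse (w n)) \<in> A2 \<inter> RH r \<longrightarrow>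
      (\<exists>C :: real. 0 \<le> C \<and> (\<forall>\<alpha> :: real. op_norm (H \<alpha>) w \<le> ennreal C)))"
proof (rule exI[of _ "3/2"], intro conjI allI impI)
  fix w assume "weight w \<and> w \<in> A2 \<inter> RH (3/2) \<and> (\<lambda>n. inverse (w n)) \<in> A2 \<inter> RH (3/2)"
  then obtain C where "bump C w" using bump_of_A2_RH by blast
  then show "\<exists>C :: real. 0 \<le> C \<and> (\<forall>\<alpha> :: real. op_norm (H \<alpha>) w \<le> ennreal C)"
    using H_op_norm total_const_nonneg by blast
qed auto

end
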